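(* Let $G$ be a finite soluble permutation group. Then $G$ is extremely primitive if and only if (up to permutation isomorphism) $G=V\rtimes H\leq \mathrm{A\Gamma L}_1(p^d)$ for some prime $p$ and integer $d\geq 1$, acting on $V=\mathbb{F}_{p^d}$, where $H\leq \mathrm{\Gamma L}_1(p^d)$ satisfies $H\cong C_t\rtimes C_e$ with $t=|H\cap \mathrm{GL}_1(p^d)|$ a primitive prime divisor of $p^d-1$, and either $e=1$, or $e$ is a prime dividing $d$ and $t=(p^d-1)/(p^{d/e}-1)$.
   Context: All groups are finite. A finite permutation group $G$ is extremely primitive if it is primitive, not regular, and a point stabiliser $G_\alpha$ acts primitively on each of its orbits other than $\{\alpha\}$. $\mathrm{A\Gamma L}_1(p^d)$ is the group of permutations $x\mapsto a x^{\sigma}+b$ of $V=\mathbb{F}_{p^d}$ ($a\in\mathbb{F}_{p^d}^\times$, $b\in \mathbb{F}_{p^d}$, $\sigma\in\mathrm{Gal}(\mathbb{F}_{p^d}/\mathbb{F}_p)$); $V$ denotes its normal subgroup of translations and $\mathrm{\Gamma L}_1(p^d)$ the stabiliser of $0$, with $\mathrm{GL}_1(p^d)$ the subgroup of maps $x\mapsto ax$. For a prime $p$ and $d\geq1$, a primitive prime divisor of $p^d-1$ is a prime dividing $p^d-1$ but not $p^i-1$ for any $1\leq i\leq d-1$. $C_n$ denotes the cyclic group of order $n$. *)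

theory Defs
  imports "HOL-Algebra.Algebra" "HOL-Computational_Algebra.Primes"
begin

text \<open>A permutation group on \<open>\<Omega>\<close> is a subgroup of \<^term>\<open>BijGroup \<Omega>\<close>, given by its set
  \<open>G\<close> of elements; these are functions that are \<^const>\<open>undefined\<close> outside \<open>\<Omega>\<close>.\<close>

abbreviation perm_group :: "'a set \<Rightarrow> ('a \<Rightarrow> 'a) set \<Rightarrow> ('a \<Rightarrow> 'a) monoid" where
  "perm_group \<Omega> G \<equiv> BijGroup \<Omega> \<lparr>carrier := G\<rparr>"


section \<open>Primitivity\<close>

definition is_block :: "('g, 'm) monoid_scheme \<Rightarrow> 'a set \<Rightarrow> ('g \<Rightarrow> 'a \<Rightarrow> 'a) \<Rightarrow> 'a set \<Rightarrow> bool" where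
  "is_block G E \<phi> B \<longleftrightarrow>
     B \<noteq> {} \<and> B \<subseteq> E \<and> (\<forall>g\<in>carrier G. \<phi> g ` B = B \<or> \<phi> g ` B \<inter> B = {})"

text \<open>The action on a one-point set counts as primitive.\<close>

definition primitive_action :: "('g, 'm) monoid_scheme \<Rightarrow> 'a set \<Rightarrow> ('g \<Rightarrow> 'a \<Rightarrow> 'a) \<Rightarrow> bool" where
  "primitive_action G E \<phi> \<longleftrightarrow>
     transitive_action G E \<phi> \<and> E \<noteq> {} \<and>
     (\<forall>B. is_block G E \<phi> B \<longrightarrow> (\<exists>x. B = {x}) \<or> B = E)"

definition regular_action :: "('g, 'm) monoid_scheme \<Rightarrow> 'a set \<Rightarrow> ('g \<Rightarrow> 'a \<Rightarrow> 'a) \<Rightarrow> bool" where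
  "regular_action G E \<phi> \<longleftrightarrow>
     transitive_action G E \<phi> \<and> (\<forall>x\<in>E. stabilizer G \<phi> x = {\<one>\<^bsub>G\<^esub>})"

text \<open>The induced action of the stabiliser on one of its orbits \<open>\<Delta>\<close> restricts the permutations
  to \<open>\<Delta>\<close>; it need not be faithful.\<close>

definition extremely_primitive :: "'a set \<Rightarrow> ('a \<Rightarrow> 'a) set \<Rightarrow> bool" where
  "extremely_primitive \<Omega> G \<longleftrightarrow>
     primitive_action (perm_group \<Omega> G) \<Omega> (\<lambda>g. g) \<and>
     \<not> regular_action (perm_group \<Omega> G) \<Omega> (\<lambda>g. g) \<and>
     (\<forall>\<alpha>\<in>\<Omega>.
        let G\<alpha> = perm_group \<Omega> (stabilizer (perm_group \<Omega> G) (\<lambda>g. g) \<alpha>)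
        in \<forall>\<Delta>\<in>orbits G\<alpha> \<Omega> (\<lambda>g. g). \<Delta> \<noteq> {\<alpha>} \<longrightarrow>
             primitive_action G\<alpha> \<Delta> (\<lambda>g. restrict g \<Delta>))"

definition permutation_isomorphic ::
    "'a set \<Rightarrow> ('a \<Rightarrow> 'a) set \<Rightarrow> 'b set \<Rightarrow> ('b \<Rightarrow> 'b) set \<Rightarrow> bool" where
  "permutation_isomorphic \<Omega> G \<Omega>' G' \<longleftrightarrow>
     (\<exists>f \<psi>. bij_betw f \<Omega> \<Omega>' \<and> \<psi> \<in> iso (perm_group \<Omega> G) (perm_group \<Omega>' G') \<and>
        (\<forall>g\<in>G. \<forall>x\<in>\<Omega>. f (g x) = \<psi> g (f x)))"


section \<open>Semidirect products\<close>

definition semidirect_product :: "('g, 'm) monoid_scheme \<Rightarrow> 'g set \<Rightarrow> 'g set \<Rightarrow> bool" where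
  "semidirect_product G N H \<longleftrightarrow>
     N \<lhd> G \<and> subgroup H G \<and> N \<inter> H = {\<one>\<^bsub>G\<^esub>} \<and> N <#>\<^bsub>G\<^esub> H = carrier G"

text \<open>\<open>G\<close> is isomorphic to some semidirect product of \<open>C\<^sub>t\<close> by \<open>C\<^sub>e\<close>.\<close>

definition iso_cyclic_semidirect :: "('g, 'm) monoid_scheme \<Rightarrow> nat \<Rightarrow> nat \<Rightarrow> bool" where
  "iso_cyclic_semidirect G t e \<longleftrightarrow>
     (\<exists>N K. semidirect_product G N K \<and>
        G\<lparr>carrier := N\<rparr> \<cong> integer_mod_group t \<and> G\<lparr>carrier := K\<rparr> \<cong> integer_mod_group e)"


section \<open>One-dimensional semilinear groups over a finite field\<close>

definition galois_group :: "('f, 'm) ring_scheme \<Rightarrow> 'f set \<Rightarrow> ('f \<Rightarrow> 'f) set" where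
  "galois_group L K = {\<sigma> \<in> ring_iso L L. \<forall>k\<in>K. \<sigma> k = k}"

abbreviation prime_subfield :: "('f, 'm) ring_scheme \<Rightarrow> 'f set" where
  "prime_subfield F \<equiv> generate_field F {}"

definition AGammaL1 :: "('f, 'm) ring_scheme \<Rightarrow> ('f \<Rightarrow> 'f) set" where
  "AGammaL1 F =
     {\<lambda>x\<in>carrier F. a \<otimes>\<^bsub>F\<^esub> \<sigma> x \<oplus>\<^bsub>F\<^esub> b | a b \<sigma>.
        a \<in> carrier F - {\<zero>\<^bsub>F\<^esub>} \<and> b \<in> carrier F \<and> \<sigma> \<in> galois_group F (prime_subfield F)}"

definition translation_group :: "('f, 'm) ring_scheme \<Rightarrow> ('f \<Rightarrow> 'f) set" where
  "translation_group F = {\<lambda>x\<in>carrier F. x \<oplus>\<^bsub>F\<^esub> b | b. b \<in> carrier F}"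

definition GammaL1 :: "('f, 'm) ring_scheme \<Rightarrow> ('f \<Rightarrow> 'f) set" where
  "GammaL1 F = stabilizer (perm_group (carrier F) (AGammaL1 F)) (\<lambda>g. g) \<zero>\<^bsub>F\<^esub>"

definition GL1 :: "('f, 'm) ring_scheme \<Rightarrow> ('f \<Rightarrow> 'f) set" where
  "GL1 F = {\<lambda>x\<in>carrier F. a \<otimes>\<^bsub>F\<^esub> x | a. a \<in> carrier F - {\<zero>\<^bsub>F\<^esub>}}"


definition primitive_prime_divisor :: "nat \<Rightarrow> nat \<Rightarrow> nat \<Rightarrow> bool" where
  "primitive_prime_divisor r p d \<longleftrightarrow>
     Factorial_Ring.prime r \<and> r dvd p ^ d - 1 \<and> (\<forall>i. 1 \<le> i \<and> i \<le> d - 1 \<longrightarrow> \<not> r dvd p ^ i - 1)"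

end

theory Submission
  imports Defs
begin

text \<open>Let \<open>G\<close> be soluble and extremely primitive. An elementary abelian normal subgroup \<open>N\<close> is regular, so the
  points form a vector space \<open>V\<close> on which the stabiliser \<open>H\<close> of zero acts irreducibly. An elementary abelian
  normal subgroup \<open>M\<close> of \<open>H\<close> fixes no nonzero vector, hence is transitive on every \<open>H\<close>-orbit of nonzero
  vectors by primitivity; so every \<open>M\<close>-submodule is \<open>H\<close>-invariant and \<open>M\<close> is itself irreducible. The double
  centralizer of \<open>M\<close> in the endomorphisms of \<open>V\<close> is therefore a field of size \<open>|V|\<close>, \<open>H\<close> acts
  semilinearly over it, and \<open>M = H \<inter> GL\<^sub>1\<close> has prime order \<open>t\<close>. All \<open>H\<close>-orbits being cosets of \<open>M\<close>, a
  field automorphism \<open>x \<mapsto> x\<^sup>q\<close> in \<open>H\<close> maps a generator \<open>\<gamma>\<close> of the multiplicative group into \<open>M \<gamma>\<close>, so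
  \<open>\<gamma>\<^bsup>q - 1\<^esup>\<close> lies in \<open>M\<close>, which gives \<open>t = (p\<^sup>d - 1) / (q - 1)\<close>. Conversely, the numerical conditions force
  every \<open>H\<close>-orbit of nonzero vectors to be a coset of the group of \<open>t\<close>-th roots of unity, of prime size, and
  a primitive prime divisor leaves no invariant subgroup of intermediate order.\<close>

section \<open>Finite fields\<close>

text \<open>The double centralizer is taken in place of the centralizer because its commutativity is
  free: the centralizer of \<open>M\<close> is only known to be a division ring by Schur's argument,
  whereas two elements of the double centralizer commute because \<open>M\<close> is abelian.
  Semilinearity comes from \<open>H\<close> normalising \<open>M\<close>: conjugation by
  \<open>h\<close> preserves the centralizer, hence the double centralizer. The order of
  \<open>M\<close> is a count of roots: \<open>M\<close> has prime exponent r, and X^r - 1 has at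
  most r roots in the field. If \<open>t\<close> divided p^i - 1 with 1 <= i < d, the subfield of
  fixed points of x^(p^i) would be a proper \<open>M\<close>-submodule. The index \<open>e\<close>
  is prime because a factorisation of \<open>e\<close> would factor the prime 1 + q + ... + q^(e-1).
  In the converse the obstacle is an element x \<mapsto> a x^q of \<open>H\<close> whose coefficient
  is not known to be a t-th root of unity. Its e-th iterate is multiplication by the norm a^t, whose
  order divides both t and q - 1; these are coprime, so a^t = 1. Field automorphisms are handled
  throughout as exponents p^j.\<close>

locale galois_field = field R for R (structure) +
  fixes p d :: nat
  assumes prime_p: "Factorial_Ring.prime p"
    and card_R: "card (carrier R) = p ^ d"

section \<open>Powers of X + 1: coefficients and values\<close>

context UP_cring begin

text \<open>Pascal's rule in polynomial form, the induction step for the binomial theorem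
  below.\<close>

lemma coeff_X_plus_one_mult:
  assumes "f \<in> carrier P"
  shows "up_ring.coeff P ((up_ring.monom P \<one> (Suc 0) \<oplus>\<^bsub>P\<^esub> \<one>\<^bsub>P\<^esub>) \<otimes>\<^bsub>P\<^esub> f) k
     = (if k = 0 then \<zero> else up_ring.coeff P f (k - 1)) \<oplus> up_ring.coeff P f k"
proof -
  have "(up_ring.monom P \<one> (Suc 0) \<oplus>\<^bsub>P\<^esub> \<one>\<^bsub>P\<^esub>) \<otimes>\<^bsub>P\<^esub> f = (up_ring.monom P \<one> (Suc 0) \<otimes>\<^bsub>P\<^esub> f) \<oplus>\<^bsub>P\<^esub> f"
    using assms by (simp add: P.l_distr)
  moreover have "up_ring.coeff P (up_ring.monom P \<one> (Suc 0) \<otimes>\<^bsub>P\<^esub> f) k = (if k = 0 then \<zero> else up_ring.coeff P f (k - 1))"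
  proof (cases k)
    case 0
    then show ?thesis using assms by simp
  next
    case (Suc j)
    then show ?thesis using coeff_monom_mult[OF _ assms, of \<one> "Suc 0" j] assms by simp
  qed
  ultimately show ?thesis using assms by (simp del: coeff_mult)
qed

text \<open>The binomial theorem, kept at the level of polynomials because it serves twice: for
  exponent \<open>p\<close> the middle coefficients vanish, and for another exponent the
  coefficients exhibit a nonzero polynomial with too many roots.\<close>

lemma coeff_X_plus_one_pow:
  "up_ring.coeff P ((up_ring.monom P \<one> (Suc 0) \<oplus>\<^bsub>P\<^esub> \<one>\<^bsub>P\<^esub>) [^]\<^bsub>P\<^esub> n) k = add_pow R (n choose k) \<one>"
proof (induction n arbitrary: k)
  case 0
  then show ?case by (cases k) auto
next
  case (Suc n)
  show ?case
    by (subst P.nat_pow_Suc2, simp, subst coeff_X_plus_one_mult, simp)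
      (cases k, auto simp: Suc.IH R.add.nat_pow_mult)
qed

lemma eval_X_plus_one_pow:
  fixes n :: nat
  assumes "x \<in> carrier R"
  shows "UnivPoly.eval R R id x ((up_ring.monom P \<one> (Suc 0) \<oplus>\<^bsub>P\<^esub> \<one>\<^bsub>P\<^esub>) [^]\<^bsub>P\<^esub> n) = (x \<oplus> \<one>) [^] n"
proof -
  interpret UP_pre_univ_prop R R id P
    by (rule UP_pre_univ_propI) (auto simp: R.is_cring P_def UP_cring_def ring_hom_def)
  interpret E: ring_hom_cring P R "UnivPoly.eval R R id x"
    using eval_ring_hom[OF assms] by unfold_locales
  have "UnivPoly.eval R R id x (up_ring.monom P \<one> (Suc 0) \<oplus>\<^bsub>P\<^esub> \<one>\<^bsub>P\<^esub>) = x \<oplus> \<one>"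
    by (subst E.hom_add) (use assms eval_monom1[of x] E.hom_one in simp_all)
  then show ?thesis
    by (subst E.hom_pow) simp_all
qed

end

section \<open>Multiplicative order, characteristic and Frobenius maps\<close>

context galois_field begin

lemma p_gt_1: "p > 1"
  using prime_p prime_gt_1_nat by blast

lemma finite_carrier: "finite (carrier R)"
  using card_R p_gt_1 by (metis card.infinite less_nat_zero_code zero_less_one power_not_zero neq0_conv)

lemma d_pos: "d > 0"
proof (rule ccontr)
  assume "\<not> d > 0"
  then have "card (carrier R) = 1" using card_R by simp
  then show False
    by (metis card_1_singletonE one_closed zero_closed singletonD zero_not_one)
qed

lemma card_gt_1: "p ^ d > 1"
  using p_gt_1 d_pos by (rule one_less_power)

lemma group_mult: "group (Multiplicative_Group.mult_of R)"
  by (rule field_mult_group)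

lemma order_mult: "order (Multiplicative_Group.mult_of R) = p ^ d - 1"
  using order_mult_of[OF finite_carrier] card_R by (simp add: order_def)

lemma pow_card_minus_one:
  assumes "x \<in> carrier R" "x \<noteq> \<zero>"
  shows "x [^] (p ^ d - 1) = \<one>"
  using group.pow_order_eq_1[OF group_mult, of x] assms
  by (simp add: order_mult Multiplicative_Group.nat_pow_mult_of)

lemma pow_card:
  assumes "x \<in> carrier R"
  shows "x [^] (p ^ d) = x"
proof (cases "x = \<zero>")
  case True
  then show ?thesis using p_gt_1 by (simp add: nat_pow_zero)
next
  case False
  have "Suc (p ^ d - 1) = p ^ d" using card_gt_1 by simp
  then have "x [^] (p ^ d) = x [^] (Suc (p ^ d - 1))" by (rule arg_cong[OF sym])
  also have "\<dots> = x" using pow_card_minus_one[OF assms False] assms by simp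
  finally show ?thesis .
qed

lemma pow_eq_zeroD:
  assumes "x \<in> carrier R" "x [^] (n::nat) = \<zero>"
  shows "x = \<zero>"
  using assms by (induction n) (auto simp: integral_iff)

text \<open>Lagrange in the additive group only kills the \<open>p ^ d\<close>-fold multiple of one.
  That multiple is the d-th power of the p-fold one, and a field has no nilpotents.\<close>

lemma add_pow_p_one: "add_pow R p \<one> = \<zero>"
proof -
  have pw: "add_pow R (p ^ n) \<one> = (add_pow R p \<one>) [^] n" for n
  proof (induction n)
    case (Suc n)
    have "add_pow R (p ^ Suc n) \<one> = add_pow R p (add_pow R (p ^ n) \<one>)"
      by (simp add: add.nat_pow_pow mult.commute)
    also have "\<dots> = add_pow R p (add_pow R (p ^ n) \<one> \<otimes> \<one>)" by simp
    also have "\<dots> = add_pow R (p ^ n) \<one> \<otimes> add_pow R p \<one>"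
      by (rule add_pow_rdistr[symmetric]) auto
    finally show ?case using Suc by simp
  qed simp
  have "group (add_monoid R)" by (rule add.is_group)
  then have "\<one> [^]\<^bsub>add_monoid R\<^esub> (order (add_monoid R)) = \<one>\<^bsub>add_monoid R\<^esub>"
    by (rule group.pow_order_eq_1) simp
  then have "add_pow R (p ^ d) \<one> = \<zero>"
    using card_R by (simp add: order_def add_pow_def)
  then show ?thesis
    using pw pow_eq_zeroD by (metis add.nat_pow_closed one_closed)
qed

lemma add_pow_one_eq_zero_iff: "add_pow R (n::nat) \<one> = \<zero> \<longleftrightarrow> p dvd n"
proof
  note A = add.is_group
  assume "add_pow R n \<one> = \<zero>"
  then have "group.ord (add_monoid R) \<one> dvd n"
    using group.pow_eq_id[OF A, of \<one> n] by (simp add: add_pow_def)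
  moreover have "group.ord (add_monoid R) \<one> dvd p"
    using group.pow_eq_id[OF A, of \<one> p] add_pow_p_one by (simp add: add_pow_def)
  moreover have "group.ord (add_monoid R) \<one> \<noteq> 1"
    using group.ord_eq_1[OF A, of \<one>] by simp
  ultimately show "p dvd n"
    using prime_p by (metis prime_nat_iff)
next
  assume "p dvd n"
  then obtain k where "n = p * k" by blast
  then show "add_pow R n \<one> = \<zero>"
    by (metis add_pow_p_one add.nat_pow_one add.nat_pow_pow one_closed)
qed

text \<open>The prime \<open>p\<close> divides its middle binomial coefficients, so (X + 1)^p and
  X^p + 1 agree as polynomials and hence at every point.\<close>

lemma frobenius_one_add:
  assumes "x \<in> carrier R"
  shows "(x \<oplus> \<one>) [^] p = x [^] p \<oplus> \<one>"
proof -
  interpret U: UP_domain R "UP R" by unfold_locales simp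
  let ?P = "UP R"
  have "(up_ring.monom ?P \<one> (Suc 0) \<oplus>\<^bsub>?P\<^esub> \<one>\<^bsub>?P\<^esub>) [^]\<^bsub>?P\<^esub> p
      = up_ring.monom ?P \<one> p \<oplus>\<^bsub>?P\<^esub> up_ring.monom ?P \<one> 0"
  proof (rule U.up_eqI)
    fix k
    have "p dvd (p choose k)" if "0 < k" "k < p"
      using that prime_p by (intro dvd_choose_prime) auto
    then show "up_ring.coeff ?P ((up_ring.monom ?P \<one> (Suc 0) \<oplus>\<^bsub>?P\<^esub> \<one>\<^bsub>?P\<^esub>) [^]\<^bsub>?P\<^esub> p) k
      = up_ring.coeff ?P (up_ring.monom ?P \<one> p \<oplus>\<^bsub>?P\<^esub> up_ring.monom ?P \<one> 0) k"
      using p_gt_1 add_pow_one_eq_zero_iff[of "p choose k"]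
      by (cases "k < p"; cases "k = 0"; cases "k = p") (auto simp: U.coeff_X_plus_one_pow binomial_eq_0)
  qed auto
  then have "UnivPoly.eval R R id x ((up_ring.monom ?P \<one> (Suc 0) \<oplus>\<^bsub>?P\<^esub> \<one>\<^bsub>?P\<^esub>) [^]\<^bsub>?P\<^esub> p)
    = UnivPoly.eval R R id x (up_ring.monom ?P \<one> p \<oplus>\<^bsub>?P\<^esub> up_ring.monom ?P \<one> 0)" by simp
  then show ?thesis
    using assms by (simp add: U.eval_X_plus_one_pow U.evalRR_simps)
qed

text \<open>Dividing by \<open>y\<close> reduces to the case where the second summand is
  one.\<close>

lemma frobenius_add:
  assumes x: "x \<in> carrier R" and y: "y \<in> carrier R"
  shows "(x \<oplus> y) [^] p = x [^] p \<oplus> y [^] p"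
proof (cases "y = \<zero>")
  case True
  then show ?thesis using x p_gt_1 by (simp add: nat_pow_zero)
next
  case False
  then have iy: "inv y \<in> carrier R" "inv y \<otimes> y = \<one>"
    using y field_Units by auto
  have xy: "x \<oplus> y = (x \<otimes> inv y \<oplus> \<one>) \<otimes> y"
    using x y iy by (simp add: l_distr m_assoc)
  have "(x \<oplus> y) [^] p = ((x \<otimes> inv y) [^] p \<oplus> \<one>) \<otimes> y [^] p"
    using x y iy by (subst xy) (simp add: nat_pow_distrib frobenius_one_add)
  also have "\<dots> = ((x \<otimes> inv y) \<otimes> y) [^] p \<oplus> y [^] p"
    using x y iy by (simp add: l_distr nat_pow_distrib)
  also have "(x \<otimes> inv y) \<otimes> y = x"
    using x y iy by (simp add: m_assoc)
  finally show ?thesis .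
qed

lemma frobenius_pow_add:
  assumes "x \<in> carrier R" "y \<in> carrier R"
  shows "(x \<oplus> y) [^] (p ^ j) = x [^] (p ^ j) \<oplus> y [^] (p ^ j)"
proof (induction j)
  case (Suc j)
  have *: "z [^] (p ^ Suc j) = (z [^] (p ^ j)) [^] p" if "z \<in> carrier R" for z
    using that by (simp add: nat_pow_pow mult.commute)
  show ?case using assms Suc by (simp add: * frobenius_add del: power_Suc)
qed (use assms in simp)

text \<open>Additivity is applied to the sum of \<open>x \<ominus> y\<close> and \<open>y\<close>,
  so that powers of minus one need no treatment.\<close>

lemma frobenius_pow_inj_on: "inj_on (\<lambda>x. x [^] (p ^ j)) (carrier R)"
proof (rule inj_onI)
  fix x y assume x: "x \<in> carrier R" and y: "y \<in> carrier R" and e: "x [^] (p ^ j) = y [^] (p ^ j)"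
  have "(x \<ominus> y) [^] (p ^ j) \<oplus> y [^] (p ^ j) = (x \<ominus> y \<oplus> y) [^] (p ^ j)"
    using x y by (simp add: frobenius_pow_add)
  also have "x \<ominus> y \<oplus> y = x" using x y by algebra
  finally have "(x \<ominus> y) [^] (p ^ j) = \<zero>"
    using x y e by (metis add.r_cancel_one' minus_closed nat_pow_closed)
  then have "x \<ominus> y = \<zero>"
    using x y by (metis minus_closed pow_eq_zeroD)
  then show "x = y" using x y by simp
qed

lemma frobenius_pow_surj:
  assumes "y \<in> carrier R"
  obtains x where "x \<in> carrier R" "y = x [^] (p ^ j)"
  using endo_inj_surj[OF finite_carrier _ frobenius_pow_inj_on, of j] assms
  by (smt (verit, best) image_iff image_subsetI nat_pow_closed)

text \<open>Since the powers of \<open>g\<close> fill the nonzero elements, counting bounds its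
  order from below, and Lagrange bounds it from above. This fixes both the range of exponents and
  the period.\<close>

lemma obtain_mult_generator:
  obtains g where "g \<in> carrier R" "g \<noteq> \<zero>"
    "\<And>x. x \<in> carrier R \<Longrightarrow> x \<noteq> \<zero> \<Longrightarrow> \<exists>i<p ^ d - 1. x = g [^] i"
    "\<And>i. g [^] i = \<one> \<longleftrightarrow> (p ^ d - 1) dvd i"
proof -
  interpret M: group "Multiplicative_Group.mult_of R" by (rule group_mult)
  obtain g where g: "g \<in> carrier R - {\<zero>}" "carrier R - {\<zero>} = {g [^] i | i::nat. i \<in> UNIV}"
    using finite_field_mult_group_has_gen[OF finite_carrier] by auto
  have fin: "finite (carrier (Multiplicative_Group.mult_of R))" using finite_carrier by simp
  have im: "carrier R - {\<zero>} = (\<lambda>i. g [^] i) ` {0 .. group.ord (Multiplicative_Group.mult_of R) g - 1}"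
    using g M.ord_elems[OF fin, of g] by (auto simp: Multiplicative_Group.nat_pow_mult_of)
  have "group.ord (Multiplicative_Group.mult_of R) g > 0" using M.ord_ge_1[OF fin, of g] g by simp
  then have "card (carrier R - {\<zero>}) \<le> group.ord (Multiplicative_Group.mult_of R) g"
    using im card_image_le[of "{0 .. group.ord (Multiplicative_Group.mult_of R) g - 1}" "\<lambda>i. g [^] i"] by simp
  moreover have "group.ord (Multiplicative_Group.mult_of R) g dvd p ^ d - 1"
    using M.ord_dvd_group_order[of g] g order_mult by simp
  ultimately have ord: "group.ord (Multiplicative_Group.mult_of R) g = p ^ d - 1"
    using card_R finite_carrier card_gt_1 by (simp add: dvd_imp_le le_antisym)
  show thesis
  proof (rule that[of g])
    show "\<exists>i<p ^ d - 1. x = g [^] i" if "x \<in> carrier R" "x \<noteq> \<zero>" for x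
    proof -
      have "x \<in> (\<lambda>i. g [^] i) ` {0 .. group.ord (Multiplicative_Group.mult_of R) g - 1}" using that im by auto
      then obtain i where "i \<le> p ^ d - 1 - 1" "x = g [^] i" using ord by auto
      moreover from this have "i < p ^ d - 1" using card_gt_1 by linarith
      ultimately show ?thesis by blast
    qed
    show "g [^] i = \<one> \<longleftrightarrow> (p ^ d - 1) dvd i" for i
      using M.pow_eq_id[of g i] g ord by (simp add: Multiplicative_Group.nat_pow_mult_of)
  qed (use g in auto)
qed

text \<open>Apart from zero, the fixed points are roots of X^(p^j - 1) - 1.\<close>

lemma card_frobenius_fixed:
  assumes "0 < j" shows "card {x \<in> carrier R. x [^] (p ^ j) = x} \<le> p ^ j"
proof -
  have pj: "p ^ j > 1" using p_gt_1 assms by (rule one_less_power)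
  have "{x \<in> carrier R. x [^] (p ^ j) = x} \<subseteq> insert \<zero> {x \<in> carrier R. x [^] (p ^ j - 1) = \<one>}"
  proof
    fix x assume "x \<in> {x \<in> carrier R. x [^] (p ^ j) = x}"
    then have x: "x \<in> carrier R" "x [^] (p ^ j) = x" by auto
    have "Suc (p ^ j - 1) = p ^ j" using pj by simp
    then have "x [^] (Suc (p ^ j - 1)) = x" using x(2) by (rule ssubst)
    then have *: "x [^] (p ^ j - 1) \<otimes> x = \<one> \<otimes> x" using x by (simp del: One_nat_def)
    have "x [^] (p ^ j - 1) = \<one>" if "x \<noteq> \<zero>"
      using that * x(1) m_rcancel nat_pow_closed one_closed by metis
    then show "x \<in> insert \<zero> {x \<in> carrier R. x [^] (p ^ j - 1) = \<one>}" using x(1) by blast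
  qed
  then have "card {x \<in> carrier R. x [^] (p ^ j) = x} \<le> card (insert \<zero> {x \<in> carrier R. x [^] (p ^ j - 1) = \<one>})"
    using finite_carrier by (intro card_mono) auto
  also have "\<dots> \<le> Suc (card {x \<in> carrier R. x [^] (p ^ j - 1) = \<one>})"
    using finite_carrier by (simp add: card_insert_if)
  also have "\<dots> \<le> Suc (p ^ j - 1)"
    using num_roots_le_deg[OF finite_carrier, of "p ^ j - 1"] pj by simp
  finally show ?thesis using pj by simp
qed

text \<open>This separates the Frobenius powers with exponent below \<open>d\<close>, and later
  excludes a proper subfield that contains all scalars.\<close>

lemma frobenius_pow_id_imp_ge:
  assumes "0 < j" "\<And>x. x \<in> carrier R \<Longrightarrow> x [^] (p ^ j) = x"
  shows "d \<le> j"
proof -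
  have "{x \<in> carrier R. x [^] (p ^ j) = x} = carrier R" using assms by auto
  then have "p ^ d \<le> p ^ j" using card_frobenius_fixed[OF assms(1)] card_R by simp
  then show ?thesis using p_gt_1 by simp
qed

text \<open>An automorphism raises a generator to some power \<open>c = p\<^sup>j u\<close> with \<open>p\<close> not dividing \<open>u\<close>, and then
  every \<open>y\<close> is a root of \<open>(X + 1)\<^sup>u - X\<^sup>u - 1\<close>, whose linear coefficient is \<open>u\<close> unless \<open>u = 1\<close>.\<close>

lemma ring_iso_is_frobenius_pow:
  fixes \<sigma> :: "'a \<Rightarrow> 'a"
  assumes \<sigma>: "\<sigma> \<in> ring_iso R R"
  obtains j where "j < d" "\<And>x. x \<in> carrier R \<Longrightarrow> \<sigma> x = x [^] (p ^ j)"
proof -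
  have hom: "\<sigma> \<in> ring_hom R R" and bij: "bij_betw \<sigma> (carrier R) (carrier R)"
    using \<sigma> by (auto simp: ring_iso_def)
  interpret S: ring_hom_cring R R \<sigma> using hom by unfold_locales
  obtain g where g: "g \<in> carrier R" "g \<noteq> \<zero>"
    "\<And>x. x \<in> carrier R \<Longrightarrow> x \<noteq> \<zero> \<Longrightarrow> \<exists>i<p ^ d - 1. x = g [^] i"
    "\<And>i. g [^] i = \<one> \<longleftrightarrow> (p ^ d - 1) dvd i"
    using obtain_mult_generator by metis
  have "\<sigma> g \<noteq> \<zero>" using bij g by (metis S.hom_zero bij_betw_imp_inj_on inj_on_eq_iff zero_closed)
  then obtain c0 where c0: "c0 < p ^ d - 1" "\<sigma> g = g [^] c0" using g by (metis S.hom_closed)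
  \<comment> \<open>The exponent 0 is replaced by \<open>p ^ d - 1\<close>: the power of
    \<open>g\<close> is the same, but a positive exponent also sends zero to zero.\<close>
  define c where "c = (if c0 = 0 then p ^ d - 1 else c0)"
  have c: "0 < c" "c < p ^ d" "\<sigma> g = g [^] c"
    using c0 card_gt_1 pow_card_minus_one[OF g(1,2)] by (auto simp: c_def)
  have sig: "\<sigma> x = x [^] c" if x: "x \<in> carrier R" for x
  proof (cases "x = \<zero>")
    case True
    then show ?thesis using c by (simp add: nat_pow_zero)
  next
    case False
    then obtain i :: nat where "x = g [^] i" using g(3)[OF x] by auto
    then show ?thesis using g(1) c(3) by (simp add: S.hom_pow nat_pow_pow mult.commute)
  qed
  define j where "j = multiplicity p c"
  obtain u where u: "c = p ^ j * u" "\<not> p dvd u"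
    using multiplicity_decompose'[of c p] c(1) prime_p unfolding j_def
    by (metis less_numeral_extra(3) not_prime_unit)
  have pj: "p ^ j \<le> c" using u c by (cases u) auto
  have "j < d"
  proof (rule ccontr)
    assume "\<not> j < d"
    then have "p ^ d \<le> p ^ j" using p_gt_1 by simp
    then show False using pj c by linarith
  qed
  \<comment> \<open>Writing \<open>y\<close> as a \<open>p ^ j\<close>-th power turns the u-th power
    into the c-th power, which is \<sigma> and therefore additive.\<close>
  have root: "(y \<oplus> \<one>) [^] u = y [^] u \<oplus> \<one>" if y: "y \<in> carrier R" for y
  proof -
    obtain x where x: "x \<in> carrier R" "y = x [^] (p ^ j)"
      by (rule frobenius_pow_surj[OF y, of j])
    have "(y \<oplus> \<one>) [^] u = (x \<oplus> \<one>) [^] c"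
      using x u(1) frobenius_pow_add[of x \<one> j] nat_pow_pow[of "x \<oplus> \<one>" "p ^ j" u] by simp
    also have "\<dots> = \<sigma> (x \<oplus> \<one>)" using x sig by simp
    also have "\<dots> = x [^] c \<oplus> \<one>" using x sig[of x] by simp
    finally show ?thesis using x u(1) by (simp add: nat_pow_pow)
  qed
  have "u = 1"
  proof (rule ccontr)
    assume "u \<noteq> 1"
    then have u2: "u > 1" using u c by (cases u) auto
    interpret U: UP_domain R "UP R" by unfold_locales simp
    let ?P = "UP R"
    define f where "f = (up_ring.monom ?P \<one> (Suc 0) \<oplus>\<^bsub>?P\<^esub> \<one>\<^bsub>?P\<^esub>) [^]\<^bsub>?P\<^esub> u
       \<ominus>\<^bsub>?P\<^esub> (up_ring.monom ?P \<one> u \<oplus>\<^bsub>?P\<^esub> up_ring.monom ?P \<one> 0)"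
    have f: "f \<in> carrier ?P" by (simp add: f_def)
    have cf: "up_ring.coeff ?P f k = add_pow R (u choose k) \<one>
        \<ominus> ((if u = k then \<one> else \<zero>) \<oplus> (if k = 0 then \<one> else \<zero>))" for k
      by (simp add: f_def U.coeff_X_plus_one_pow)
    have "up_ring.coeff ?P f 1 = add_pow R u \<one>"
      using u2 by (simp add: cf a_minus_def)
    then have "up_ring.coeff ?P f 1 \<noteq> \<zero>"
      using add_pow_one_eq_zero_iff u by simp
    then have fz: "f \<noteq> \<zero>\<^bsub>?P\<^esub>" by auto
    \<comment> \<open>All \<open>p ^ d\<close> elements are roots of the nonzero \<open>f\<close>,
      so \<open>p ^ d\<close> is at most its degree, while \<open>u\<close> is at most
      \<open>c\<close> and \<open>c < p ^ d\<close>.\<close>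
    have "deg R f \<le> u"
      by (rule U.deg_aboveI) (auto simp: f cf a_minus_def binomial_eq_0)
    moreover have "card {a \<in> carrier R. UnivPoly.eval R R id a f = \<zero>} \<le> deg R f"
      using U.roots_bound[OF f fz finite_carrier] by simp
    moreover have "{a \<in> carrier R. UnivPoly.eval R R id a f = \<zero>} = carrier R"
      by (auto simp: f_def U.evalRR_simps U.eval_X_plus_one_pow root)
    ultimately have "p ^ d \<le> u" using card_R by simp
    moreover have "u \<le> c" using u p_gt_1 by simp
    ultimately show False using c by simp
  qed
  then show thesis using that[of j] \<open>j < d\<close> sig u by simp
qed

end

section \<open>Permutation groups\<close>

lemma BijGroup_mult: "g \<in> Bij \<Omega> \<Longrightarrow> h \<in> Bij \<Omega> \<Longrightarrow> g \<otimes>\<^bsub>BijGroup \<Omega>\<^esub> h = compose \<Omega> g h"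
  by (simp add: BijGroup_def)

lemma carrier_BijGroup: "carrier (BijGroup \<Omega>) = Bij \<Omega>"
  by (simp add: BijGroup_def)

lemma one_BijGroup: "\<one>\<^bsub>BijGroup \<Omega>\<^esub> = (\<lambda>x\<in>\<Omega>. x)"
  by (simp add: BijGroup_def)

lemma BijI: "g \<in> extensional \<Omega> \<Longrightarrow> bij_betw g \<Omega> \<Omega> \<Longrightarrow> g \<in> Bij \<Omega>"
  by (simp add: Bij_def)

lemma Bij_eqI:
  assumes "g \<in> Bij \<Omega>" "h \<in> Bij \<Omega>" "\<And>x. x \<in> \<Omega> \<Longrightarrow> g x = h x"
  shows "g = h"
  using assms by (intro extensionalityI) (auto simp: Bij_def)

locale permutation_group =
  fixes \<Omega> :: "'a set" and G :: "('a \<Rightarrow> 'a) set"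
  assumes subgroup_Bij: "subgroup G (BijGroup \<Omega>)"
begin

lemma elem_Bij: "g \<in> G \<Longrightarrow> g \<in> Bij \<Omega>"
  using subgroup.subset[OF subgroup_Bij] by (auto simp: carrier_BijGroup)

lemma elem_bij_betw: "g \<in> G \<Longrightarrow> bij_betw g \<Omega> \<Omega>"
  using elem_Bij by (auto simp: Bij_def)

lemma elem_closed: "g \<in> G \<Longrightarrow> x \<in> \<Omega> \<Longrightarrow> g x \<in> \<Omega>"
  using elem_bij_betw bij_betwE by blast

lemma elem_inj: "g \<in> G \<Longrightarrow> x \<in> \<Omega> \<Longrightarrow> y \<in> \<Omega> \<Longrightarrow> g x = g y \<longleftrightarrow> x = y"
  using elem_bij_betw bij_betw_imp_inj_on inj_on_eq_iff by metis

lemma elem_eqI: "g \<in> G \<Longrightarrow> h \<in> G \<Longrightarrow> (\<And>x. x \<in> \<Omega> \<Longrightarrow> g x = h x) \<Longrightarrow> g = h"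
  by (rule Bij_eqI) (auto intro: elem_Bij)

lemma id_mem: "(\<lambda>x\<in>\<Omega>. x) \<in> G"
  using subgroup.one_closed[OF subgroup_Bij] by (simp add: one_BijGroup)

lemma compose_mem: "g \<in> G \<Longrightarrow> h \<in> G \<Longrightarrow> compose \<Omega> g h \<in> G"
  using subgroup.m_closed[OF subgroup_Bij, of g h] by (simp add: BijGroup_mult elem_Bij)

lemma mult_eq: "g \<in> G \<Longrightarrow> h \<in> G \<Longrightarrow> g \<otimes>\<^bsub>BijGroup \<Omega>\<^esub> h = compose \<Omega> g h"
  by (simp add: BijGroup_mult elem_Bij)

text \<open>Inverses are handled through the cancellation laws at points, so later proofs avoid the
  group inverse of \<open>BijGroup\<close>.\<close>

lemma obtain_inverse:
  assumes "g \<in> G"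
  obtains h where "h \<in> G" "\<forall>x\<in>\<Omega>. h (g x) = x" "\<forall>x\<in>\<Omega>. g (h x) = x"
proof (rule that; (intro ballI)?)
  have b: "bij_betw g \<Omega> \<Omega>" by (rule elem_bij_betw[OF assms])
  show "(\<lambda>x\<in>\<Omega>. inv_into \<Omega> g x) \<in> G"
    using subgroup.m_inv_closed[OF subgroup_Bij assms] inv_BijGroup[OF elem_Bij[OF assms]] by simp
  show "(\<lambda>x\<in>\<Omega>. inv_into \<Omega> g x) (g x) = x" if "x \<in> \<Omega>" for x
    using that b elem_closed[OF assms] by (simp add: bij_betw_inv_into_left)
  show "g ((\<lambda>x\<in>\<Omega>. inv_into \<Omega> g x) x) = x" if "x \<in> \<Omega>" for x
    using that b by (simp add: bij_betw_inv_into_right)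
qed

lemma group_perm_group: "group (perm_group \<Omega> G)"
  by (rule subgroup.subgroup_is_group[OF subgroup_Bij group_BijGroup])

lemma finite_elems: "finite \<Omega> \<Longrightarrow> finite G"
proof -
  assume f: "finite \<Omega>"
  have "G \<subseteq> \<Omega> \<rightarrow>\<^sub>E \<Omega>"
    using elem_Bij by (auto simp: Bij_def PiE_def extensional_def dest: bij_betwE)
  then show "finite G" using f by (meson finite_PiE finite_subset)
qed

lemma subgroup_perm_group_iff:
  "subgroup H (perm_group \<Omega> G) \<longleftrightarrow> subgroup H (BijGroup \<Omega>) \<and> H \<subseteq> G"
proof
  assume H: "subgroup H (perm_group \<Omega> G)"
  show "subgroup H (BijGroup \<Omega>) \<and> H \<subseteq> G"
    using group.incl_subgroup[OF group_BijGroup subgroup_Bij H] subgroup.subset[OF H] by simp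
next
  assume "subgroup H (BijGroup \<Omega>) \<and> H \<subseteq> G"
  then show "subgroup H (perm_group \<Omega> G)"
    using group.subgroup_incl[OF group_BijGroup _ subgroup_Bij] by blast
qed

end

text \<open>A left inverse inside the set is enough, because in the group of all bijections it is
  the inverse.\<close>

lemma permutation_groupI:
  assumes "G \<subseteq> Bij \<Omega>" "(\<lambda>x\<in>\<Omega>. x) \<in> G"
    "\<And>g h. g \<in> G \<Longrightarrow> h \<in> G \<Longrightarrow> compose \<Omega> g h \<in> G"
    "\<And>g. g \<in> G \<Longrightarrow> \<exists>h\<in>G. \<forall>x\<in>\<Omega>. h (g x) = x"
  shows "permutation_group \<Omega> G"
proof (rule permutation_group.intro, rule group.subgroupI[OF group_BijGroup])
  show "G \<subseteq> carrier (BijGroup \<Omega>)" using assms(1) by (simp add: carrier_BijGroup)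
  show "G \<noteq> {}" using assms(2) by auto
  show "a \<otimes>\<^bsub>BijGroup \<Omega>\<^esub> b \<in> G" if "a \<in> G" "b \<in> G" for a b
    using that assms by (auto simp: BijGroup_mult subsetD)
  show "inv\<^bsub>BijGroup \<Omega>\<^esub> a \<in> G" if a: "a \<in> G" for a
  proof -
    obtain h where h: "h \<in> G" "\<forall>x\<in>\<Omega>. h (a x) = x" using assms(4)[OF a] by blast
    have "h \<otimes>\<^bsub>BijGroup \<Omega>\<^esub> a = \<one>\<^bsub>BijGroup \<Omega>\<^esub>"
      using a h assms(1) by (auto simp: BijGroup_mult subsetD one_BijGroup compose_def)
    then have "inv\<^bsub>BijGroup \<Omega>\<^esub> a = h"
      using a h assms(1) by (intro group.inv_equality[OF group_BijGroup]) (auto simp: carrier_BijGroup)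
    then show ?thesis using h by simp
  qed
qed

context permutation_group begin

text \<open>Conjugating \<open>n\<close> by \<open>g\<close> gives \<open>n'\<close> exactly when g
  n = n' g. In this form normality is a relation between points, and no inverse has to be
  formed.\<close>

lemma normal_perm_group_iff:
  "N \<lhd> perm_group \<Omega> G \<longleftrightarrow> subgroup N (BijGroup \<Omega>) \<and> N \<subseteq> G \<and>
     (\<forall>g\<in>G. \<forall>n\<in>N. \<exists>n'\<in>N. \<forall>x\<in>\<Omega>. g (n x) = n' (g x))"
proof -
  interpret P: group "perm_group \<Omega> G" by (rule group_perm_group)
  have *: "(g \<otimes>\<^bsub>perm_group \<Omega> G\<^esub> n \<otimes>\<^bsub>perm_group \<Omega> G\<^esub> inv\<^bsub>perm_group \<Omega> G\<^esub> g \<in> N) \<longleftrightarrow>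
    (\<exists>n'\<in>N. \<forall>x\<in>\<Omega>. g (n x) = n' (g x))"
    if g: "g \<in> G" and n: "n \<in> N" and NG: "N \<subseteq> G" for g n
  proof -
    have nG: "n \<in> G" using n NG by blast
    have "(g \<otimes>\<^bsub>perm_group \<Omega> G\<^esub> n \<otimes>\<^bsub>perm_group \<Omega> G\<^esub> inv\<^bsub>perm_group \<Omega> G\<^esub> g = n') \<longleftrightarrow>
      (\<forall>x\<in>\<Omega>. g (n x) = n' (g x))" if n': "n' \<in> G" for n'
    proof -
      have "g \<in> carrier (perm_group \<Omega> G)" "n \<in> carrier (perm_group \<Omega> G)" "n' \<in> carrier (perm_group \<Omega> G)"
        using g nG n' by simp_all
      note c = this
      have "(g \<otimes>\<^bsub>perm_group \<Omega> G\<^esub> n \<otimes>\<^bsub>perm_group \<Omega> G\<^esub> inv\<^bsub>perm_group \<Omega> G\<^esub> g = n') \<longleftrightarrow>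
         g \<otimes>\<^bsub>perm_group \<Omega> G\<^esub> n = n' \<otimes>\<^bsub>perm_group \<Omega> G\<^esub> g"
        by (rule P.inv_solve_right'[OF c(3) P.m_closed[OF c(1,2)] c(1)])
      also have "\<dots> \<longleftrightarrow> compose \<Omega> g n = compose \<Omega> n' g"
        using g nG n' by (simp add: mult_eq)
      also have "\<dots> \<longleftrightarrow> (\<forall>x\<in>\<Omega>. g (n x) = n' (g x))"
        by (auto simp: compose_def fun_eq_iff restrict_def)
      finally show ?thesis .
    qed
    moreover have "g \<otimes>\<^bsub>perm_group \<Omega> G\<^esub> n \<otimes>\<^bsub>perm_group \<Omega> G\<^esub> inv\<^bsub>perm_group \<Omega> G\<^esub> g \<in> G"
      using P.m_closed[OF P.m_closed[of g n] P.inv_closed[of g]] g nG by simp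
    ultimately show ?thesis using NG by blast
  qed
  show ?thesis
    unfolding P.normal_inv_iff subgroup_perm_group_iff using * by auto
qed

end

text \<open>The block half of primitivity, for a bare set of functions. Taking images rather than an
  action lets permutations of \<Omega> be tested on any invariant subset without restricting
  them.\<close>

definition only_trivial_blocks :: "('a \<Rightarrow> 'a) set \<Rightarrow> 'a set \<Rightarrow> bool" where
  "only_trivial_blocks K \<Delta> \<longleftrightarrow>
     (\<forall>B. B \<noteq> {} \<and> B \<subseteq> \<Delta> \<and> (\<forall>g\<in>K. g ` B = B \<or> g ` B \<inter> B = {}) \<longrightarrow> (\<exists>x. B = {x}) \<or> B = \<Delta>)"

context permutation_group begin

text \<open>Invariance of \<Delta> already makes restriction a homomorphism, so only the statement
  about points remains. The case \<Delta> = \<Omega> and the suborbits are both covered.\<close>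

lemma transitive_action_iff:
  assumes \<Delta>: "\<Delta> \<subseteq> \<Omega>" "\<And>g. g \<in> G \<Longrightarrow> bij_betw g \<Delta> \<Delta>" and \<phi>: "\<And>g. g \<in> G \<Longrightarrow> \<phi> g = restrict g \<Delta>"
  shows "transitive_action (perm_group \<Omega> G) \<Delta> \<phi> \<longleftrightarrow> (\<forall>x\<in>\<Delta>. \<forall>y\<in>\<Delta>. \<exists>g\<in>G. g x = y)"
proof -
  have B: "\<phi> g \<in> Bij \<Delta>" if "g \<in> G" for g
    using that \<phi> \<Delta>(2) by (auto simp: Bij_def bij_betw_restrict_eq)
  have "\<phi> (compose \<Omega> g h) = compose \<Delta> (\<phi> g) (\<phi> h)" if "g \<in> G" "h \<in> G" for g h
    using that \<phi> \<Delta> compose_mem[OF that] bij_betwE[OF \<Delta>(2)[OF that(2)]]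
    by (auto simp: fun_eq_iff compose_def restrict_def)
  then have "\<phi> \<in> hom (perm_group \<Omega> G) (BijGroup \<Delta>)"
    using B by (intro homI) (auto simp: carrier_BijGroup mult_eq BijGroup_mult)
  then have "group_action (perm_group \<Omega> G) \<Delta> \<phi>"
    using group_perm_group group_BijGroup
    by (simp add: group_action_def group_hom_def group_hom_axioms_def)
  then show ?thesis
    using \<phi> by (auto simp: transitive_action_def transitive_action_axioms_def)
qed

lemma primitive_action_iff:
  assumes \<Delta>: "\<Delta> \<subseteq> \<Omega>" "\<And>g. g \<in> G \<Longrightarrow> bij_betw g \<Delta> \<Delta>" and \<phi>: "\<And>g. g \<in> G \<Longrightarrow> \<phi> g = restrict g \<Delta>"
  shows "primitive_action (perm_group \<Omega> G) \<Delta> \<phi> \<longleftrightarrow>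
    \<Delta> \<noteq> {} \<and> (\<forall>x\<in>\<Delta>. \<forall>y\<in>\<Delta>. \<exists>g\<in>G. g x = y) \<and> only_trivial_blocks G \<Delta>"
proof -
  have "\<phi> g ` B = g ` B" if "g \<in> G" "B \<subseteq> \<Delta>" for g B
    using that \<phi> by (auto simp: restrict_def image_iff subset_iff)
  then have "is_block (perm_group \<Omega> G) \<Delta> \<phi> B \<longleftrightarrow>
     B \<noteq> {} \<and> B \<subseteq> \<Delta> \<and> (\<forall>g\<in>G. g ` B = B \<or> g ` B \<inter> B = {})" for B
    unfolding is_block_def by (cases "B \<subseteq> \<Delta>") simp_all
  then show ?thesis
    using transitive_action_iff[OF assms]
    by (auto simp: primitive_action_def only_trivial_blocks_def)
qed

abbreviation stab :: "'a \<Rightarrow> ('a \<Rightarrow> 'a) set" where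
  "stab \<alpha> \<equiv> {g \<in> G. g \<alpha> = \<alpha>}"

lemma permutation_group_stab:
  assumes "\<alpha> \<in> \<Omega>" shows "permutation_group \<Omega> (stab \<alpha>)"
proof (rule permutation_groupI)
  show "stab \<alpha> \<subseteq> Bij \<Omega>" using elem_Bij by auto
  show "(\<lambda>x\<in>\<Omega>. x) \<in> stab \<alpha>" using id_mem assms by simp
  show "compose \<Omega> g h \<in> stab \<alpha>" if "g \<in> stab \<alpha>" "h \<in> stab \<alpha>" for g h
    using that compose_mem assms by (auto simp: compose_def)
  show "\<exists>h\<in>stab \<alpha>. \<forall>x\<in>\<Omega>. h (g x) = x" if g: "g \<in> stab \<alpha>" for g
  proof -
    have "g \<in> G" using g by simp
    then obtain h where h: "h \<in> G" "\<forall>x\<in>\<Omega>. h (g x) = x" using obtain_inverse by blast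
    have "h \<alpha> = \<alpha>" using h(2) assms g by force
    then show ?thesis using h by blast
  qed
qed

lemma orbit_bij_betw:
  assumes "x \<in> \<Omega>" "g \<in> G"
  shows "bij_betw g {h x | h. h \<in> G} {h x | h. h \<in> G}"
  unfolding bij_betw_def
proof
  show "inj_on g {h x | h. h \<in> G}"
    using assms elem_closed elem_inj by (auto simp: inj_on_def)
  obtain k where k: "k \<in> G" "\<forall>x\<in>\<Omega>. k (g x) = x" "\<forall>x\<in>\<Omega>. g (k x) = x"
    using obtain_inverse[OF assms(2)] by blast
  have "g (h x) \<in> {h x | h. h \<in> G}" if "h \<in> G" for h
    using compose_mem[OF assms(2) that] assms(1) by (auto simp: compose_def intro!: exI[of _ "compose \<Omega> g h"])
  moreover have "h x \<in> g ` {h x | h. h \<in> G}" if "h \<in> G" for h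
  proof (rule image_eqI[of _ _ "compose \<Omega> k h x"])
    show "h x = g (compose \<Omega> k h x)"
      using assms(1) k(3) elem_closed[OF that assms(1)] by (simp add: compose_def)
  qed (use compose_mem[OF k(1) that] in blast)
  ultimately show "g ` {h x | h. h \<in> G} = {h x | h. h \<in> G}" by auto
qed

lemma orbit_transitive:
  assumes "x \<in> \<Omega>" "a \<in> {h x | h. h \<in> G}" "b \<in> {h x | h. h \<in> G}"
  shows "\<exists>g\<in>G. g a = b"
proof -
  obtain h k where h: "h \<in> G" "a = h x" and k: "k \<in> G" "b = k x" using assms by blast
  obtain h' where h': "h' \<in> G" "\<forall>x\<in>\<Omega>. h' (h x) = x"
    using obtain_inverse[OF h(1)] by blast
  have "compose \<Omega> k h' a = b" using h k h' assms(1) elem_closed by (simp add: compose_def)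
  then show ?thesis using compose_mem[OF k(1) h'(1)] by blast
qed

text \<open>Orbits are transitive by nature, so each suborbit contributes only its block condition,
  and the orbit of \<beta> is the excluded singleton only for \<beta> = \<alpha>. Given
  transitivity, not being regular means that some stabiliser is nontrivial.\<close>

lemma extremely_primitive_iff:
  "extremely_primitive \<Omega> G \<longleftrightarrow>
     \<Omega> \<noteq> {} \<and> (\<forall>x\<in>\<Omega>. \<forall>y\<in>\<Omega>. \<exists>g\<in>G. g x = y) \<and> only_trivial_blocks G \<Omega> \<and>
     (\<exists>x\<in>\<Omega>. \<exists>g\<in>G. g x = x \<and> g \<noteq> (\<lambda>x\<in>\<Omega>. x)) \<and>
     (\<forall>\<alpha>\<in>\<Omega>. \<forall>\<beta>\<in>\<Omega>. \<beta> \<noteq> \<alpha> \<longrightarrow> only_trivial_blocks (stab \<alpha>) {h \<beta> | h. h \<in> stab \<alpha>})"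
proof -
  have r: "g = restrict g \<Omega>" if "g \<in> G" for g
    using elem_Bij[OF that] by (simp add: Bij_def extensional_restrict)
  have 1: "primitive_action (perm_group \<Omega> G) \<Omega> (\<lambda>g. g) \<longleftrightarrow>
    \<Omega> \<noteq> {} \<and> (\<forall>x\<in>\<Omega>. \<forall>y\<in>\<Omega>. \<exists>g\<in>G. g x = y) \<and> only_trivial_blocks G \<Omega>"
    by (rule primitive_action_iff[OF subset_refl elem_bij_betw r])
  have 2: "transitive_action (perm_group \<Omega> G) \<Omega> (\<lambda>g. g) \<longleftrightarrow> (\<forall>x\<in>\<Omega>. \<forall>y\<in>\<Omega>. \<exists>g\<in>G. g x = y)"
    by (rule transitive_action_iff[OF subset_refl elem_bij_betw r])
  have st: "stabilizer (perm_group \<Omega> G) (\<lambda>g. g) \<alpha> = stab \<alpha>" for \<alpha>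
    by (simp add: stabilizer_def)
  have 3: "(\<forall>\<Delta>\<in>orbits (perm_group \<Omega> (stab \<alpha>)) \<Omega> (\<lambda>g. g). \<Delta> \<noteq> {\<alpha>} \<longrightarrow>
             primitive_action (perm_group \<Omega> (stab \<alpha>)) \<Delta> (\<lambda>g. restrict g \<Delta>)) \<longleftrightarrow>
    (\<forall>\<beta>\<in>\<Omega>. \<beta> \<noteq> \<alpha> \<longrightarrow> only_trivial_blocks (stab \<alpha>) {h \<beta> | h. h \<in> stab \<alpha>})" if \<alpha>: "\<alpha> \<in> \<Omega>" for \<alpha>
  proof -
    interpret S: permutation_group \<Omega> "stab \<alpha>" by (rule permutation_group_stab[OF \<alpha>])
    have orb: "orbit (perm_group \<Omega> (stab \<alpha>)) (\<lambda>g. g) \<beta> = {h \<beta> | h. h \<in> stab \<alpha>}" for \<beta>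
      by (simp add: orbit_def)
    have mem: "\<beta> \<in> {h \<beta> | h. h \<in> stab \<alpha>}" if "\<beta> \<in> \<Omega>" for \<beta>
      using S.id_mem that by (intro CollectI exI[of _ "\<lambda>x\<in>\<Omega>. x"]) simp
    have ne: "{h \<beta> | h. h \<in> stab \<alpha>} = {\<alpha>} \<longleftrightarrow> \<beta> = \<alpha>" if "\<beta> \<in> \<Omega>" for \<beta>
      using mem[OF that] mem[OF \<alpha>] by auto
    have prim: "primitive_action (perm_group \<Omega> (stab \<alpha>)) {h \<beta> | h. h \<in> stab \<alpha>} (\<lambda>g. restrict g {h \<beta> | h. h \<in> stab \<alpha>})
       \<longleftrightarrow> only_trivial_blocks (stab \<alpha>) {h \<beta> | h. h \<in> stab \<alpha>}" if \<beta>: "\<beta> \<in> \<Omega>" for \<beta>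
    proof -
      have "{h \<beta> | h. h \<in> stab \<alpha>} \<subseteq> \<Omega>" using elem_closed \<beta> by auto
      moreover have "{h \<beta> | h. h \<in> stab \<alpha>} \<noteq> {}" using mem[OF \<beta>] by blast
      moreover have "\<forall>x\<in>{h \<beta> | h. h \<in> stab \<alpha>}. \<forall>y\<in>{h \<beta> | h. h \<in> stab \<alpha>}. \<exists>g\<in>stab \<alpha>. g x = y"
        using S.orbit_transitive[OF \<beta>] by blast
      ultimately show ?thesis
        using S.primitive_action_iff[of "{h \<beta> | h. h \<in> stab \<alpha>}" "\<lambda>g. restrict g {h \<beta> | h. h \<in> stab \<alpha>}",
            OF _ S.orbit_bij_betw[OF \<beta>] refl] by (auto simp only:)
    qed
    have "orbits (perm_group \<Omega> (stab \<alpha>)) \<Omega> (\<lambda>g. g) = (\<lambda>\<beta>. {h \<beta> | h. h \<in> stab \<alpha>}) ` \<Omega>"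
      unfolding orbits_def orb by (rule setcompr_eq_image[of _ "\<lambda>x. x \<in> \<Omega>", simplified Collect_mem_eq])
    then show ?thesis
      by (simp only: ball_simps) (rule ball_cong, simp_all only: ne prim)
  qed
  have stab_trivial: "stab x = {\<lambda>x\<in>\<Omega>. x} \<longleftrightarrow> (\<forall>g\<in>G. g x = x \<longrightarrow> g = (\<lambda>x\<in>\<Omega>. x))" if "x \<in> \<Omega>" for x
    using id_mem that by auto
  have one: "\<one>\<^bsub>perm_group \<Omega> G\<^esub> = (\<lambda>x\<in>\<Omega>. x)"
    by (simp add: one_BijGroup)
  have "regular_action (perm_group \<Omega> G) \<Omega> (\<lambda>g. g) \<longleftrightarrow>
      (\<forall>x\<in>\<Omega>. \<forall>y\<in>\<Omega>. \<exists>g\<in>G. g x = y) \<and> (\<forall>x\<in>\<Omega>. \<forall>g\<in>G. g x = x \<longrightarrow> g = (\<lambda>x\<in>\<Omega>. x))"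
    unfolding regular_action_def 2 st one by (simp only: stab_trivial cong: ball_cong)
  moreover have "(\<forall>\<alpha>\<in>\<Omega>. \<forall>\<Delta>\<in>orbits (perm_group \<Omega> (stab \<alpha>)) \<Omega> (\<lambda>g. g). \<Delta> \<noteq> {\<alpha>} \<longrightarrow>
             primitive_action (perm_group \<Omega> (stab \<alpha>)) \<Delta> (\<lambda>g. restrict g \<Delta>)) \<longleftrightarrow>
    (\<forall>\<alpha>\<in>\<Omega>. \<forall>\<beta>\<in>\<Omega>. \<beta> \<noteq> \<alpha> \<longrightarrow> only_trivial_blocks (stab \<alpha>) {h \<beta> | h. h \<in> stab \<alpha>})"
    using 3 by (rule ball_cong[OF refl])
  ultimately show ?thesis
    unfolding extremely_primitive_def Let_def st 1 by (simp only:) meson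
qed

end

text \<open>A block of \<open>K'\<close> is pulled back along \<open>f\<close> to a block of
  \<open>K\<close>. Partners are required only for the elements of \<open>K\<close>, so
  \<open>K'\<close> may contain further maps.\<close>

lemma only_trivial_blocks_image:
  assumes K: "only_trivial_blocks K \<Delta>" and f: "inj_on f \<Delta>"
    and closed: "\<And>g x. g \<in> K \<Longrightarrow> x \<in> \<Delta> \<Longrightarrow> g x \<in> \<Delta>"
    and rel: "\<And>g. g \<in> K \<Longrightarrow> \<exists>g'\<in>K'. \<forall>x\<in>\<Delta>. f (g x) = g' (f x)"
  shows "only_trivial_blocks K' (f ` \<Delta>)"
  unfolding only_trivial_blocks_def
proof (intro allI impI, elim conjE)
  fix B' assume B': "B' \<noteq> {}" "B' \<subseteq> f ` \<Delta>" "\<forall>g\<in>K'. g ` B' = B' \<or> g ` B' \<inter> B' = {}"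
  define B where "B = {x \<in> \<Delta>. f x \<in> B'}"
  have fB: "f ` B = B'" using B'(2) by (auto simp: B_def)
  have B\<Delta>: "B \<subseteq> \<Delta>" by (auto simp: B_def)
  have blk: "g ` B = B \<or> g ` B \<inter> B = {}" if g: "g \<in> K" for g
  proof -
    obtain g' where g': "g' \<in> K'" "\<forall>x\<in>\<Delta>. f (g x) = g' (f x)" using rel[OF g] by blast
    have "f ` (g ` B) = (\<lambda>x. f (g x)) ` B" by (simp add: image_image)
    also have "\<dots> = (\<lambda>x. g' (f x)) ` B" using g'(2) B\<Delta> by (intro image_cong) auto
    also have "\<dots> = g' ` B'" using fB by (simp add: image_image flip: fB)
    finally have im: "f ` (g ` B) = g' ` B'" .
    have gB: "g ` B \<subseteq> \<Delta>" using closed[OF g] B\<Delta> by auto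
    have "f ` (g ` B) = f ` B \<Longrightarrow> g ` B = B"
      using inj_on_image_eq_iff[OF f gB B\<Delta>] by simp
    moreover have "f ` (g ` B) \<inter> f ` B = {} \<Longrightarrow> g ` B \<inter> B = {}" by blast
    ultimately show ?thesis using B'(3) g'(1) im fB by metis
  qed
  have "B \<noteq> {}" using fB B'(1) by auto
  then have "(\<exists>x. B = {x}) \<or> B = \<Delta>"
    using K[unfolded only_trivial_blocks_def, rule_format, of B] blk B\<Delta> by simp
  then show "(\<exists>x. B' = {x}) \<or> B' = f ` \<Delta>" using fB by auto
qed

text \<open>Partners are asked for element by element, not through a homomorphism.
  \<open>rel\<close> carries block conditions and fixed points over; \<open>rel'\<close> makes the
  image of a suborbit a whole suborbit.\<close>

lemma extremely_primitive_transfer: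
  assumes G: "permutation_group \<Omega> G" and G': "permutation_group \<Omega>' G'"
    and f: "bij_betw f \<Omega> \<Omega>'"
    and rel: "\<And>g. g \<in> G \<Longrightarrow> \<exists>g'\<in>G'. \<forall>x\<in>\<Omega>. f (g x) = g' (f x)"
    and rel': "\<And>g'. g' \<in> G' \<Longrightarrow> \<exists>g\<in>G. \<forall>x\<in>\<Omega>. f (g x) = g' (f x)"
    and E: "extremely_primitive \<Omega> G"
  shows "extremely_primitive \<Omega>' G'"
proof -
  interpret G: permutation_group \<Omega> G by fact
  interpret G': permutation_group \<Omega>' G' by fact
  have im: "f ` \<Omega> = \<Omega>'" and inj: "inj_on f \<Omega>" using f by (auto simp: bij_betw_def)
  note E = E[unfolded G.extremely_primitive_iff]
  have stab: "\<exists>g'\<in>G'.stab (f a). \<forall>x\<in>\<Omega>. f (g x) = g' (f x)" if a: "a \<in> \<Omega>" and g: "g \<in> G.stab a" for a g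
  proof -
    obtain g' where g': "g' \<in> G'" "\<forall>x\<in>\<Omega>. f (g x) = g' (f x)" using rel g by blast
    then have "g' (f a) = f a" using a g by force
    then show ?thesis using g' by auto
  qed
  have stab': "\<exists>g\<in>G.stab a. \<forall>x\<in>\<Omega>. f (g x) = g' (f x)" if a: "a \<in> \<Omega>" and g: "g' \<in> G'.stab (f a)" for a g'
  proof -
    obtain g where g': "g \<in> G" "\<forall>x\<in>\<Omega>. f (g x) = g' (f x)" using rel' g by blast
    then have "f (g a) = f a" using a g by force
    then have "g a = a" using inj a G.elem_closed[OF g'(1) a] by (auto dest: inj_onD)
    then show ?thesis using g' by auto
  qed
  show ?thesis
    unfolding G'.extremely_primitive_iff
  proof (intro conjI ballI impI)
    show "\<Omega>' \<noteq> {}" using E im by blast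
    show "\<exists>g\<in>G'. g x = y" if xy: "x \<in> \<Omega>'" "y \<in> \<Omega>'" for x y
    proof -
      obtain a b where ab: "a \<in> \<Omega>" "b \<in> \<Omega>" "x = f a" "y = f b" using xy im by blast
      obtain g where g: "g \<in> G" "g a = b" using E ab by blast
      then obtain g' where "g' \<in> G'" "\<forall>x\<in>\<Omega>. f (g x) = g' (f x)" using rel by blast
      then show ?thesis using ab g by (intro bexI[of _ g']) force
    qed
    show "only_trivial_blocks G' \<Omega>'"
      unfolding im[symmetric]
      by (rule only_trivial_blocks_image[where K = G]) (use E inj G.elem_closed rel in auto)
    show "\<exists>x\<in>\<Omega>'. \<exists>g\<in>G'. g x = x \<and> g \<noteq> (\<lambda>x\<in>\<Omega>'. x)"
    proof -
      obtain a g where ag: "a \<in> \<Omega>" "g \<in> G" "g a = a" "g \<noteq> (\<lambda>x\<in>\<Omega>. x)" using E by blast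
      obtain g' where g': "g' \<in> G'.stab (f a)" "\<forall>x\<in>\<Omega>. f (g x) = g' (f x)" using stab ag by blast
      obtain b where b: "b \<in> \<Omega>" "g b \<noteq> b"
        using G.elem_eqI[OF ag(2) G.id_mem] ag(4) by auto
      then have "g' (f b) \<noteq> f b"
        using g'(2) inj G.elem_closed[OF ag(2) b(1)] by (metis inj_onD)
      then have "g' \<noteq> (\<lambda>x\<in>\<Omega>'. x)" using b(1) im by auto
      then show ?thesis using g' ag(1) im by blast
    qed
    fix x y assume xy: "x \<in> \<Omega>'" "y \<in> \<Omega>'" "y \<noteq> x"
    obtain a b where ab: "a \<in> \<Omega>" "b \<in> \<Omega>" "x = f a" "y = f b" using xy im by blast
    let ?\<Delta> = "{h b |h. h \<in> G.stab a}"
    interpret S: permutation_group \<Omega> "G.stab a" by (rule G.permutation_group_stab[OF ab(1)])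
    have \<Delta>: "?\<Delta> \<subseteq> \<Omega>" using G.elem_closed ab by auto
    have "\<forall>\<alpha>\<in>\<Omega>. \<forall>\<beta>\<in>\<Omega>. \<beta> \<noteq> \<alpha> \<longrightarrow> only_trivial_blocks (G.stab \<alpha>) {h \<beta> | h. h \<in> G.stab \<alpha>}"
      using E by (elim conjE)
    from mp[OF bspec[OF bspec[OF this ab(1)] ab(2)]]
    have "only_trivial_blocks (G.stab a) ?\<Delta>" using ab(3,4) xy(3) by blast
    then have "only_trivial_blocks (G'.stab x) (f ` ?\<Delta>)"
    proof (rule only_trivial_blocks_image)
      show "inj_on f ?\<Delta>" by (rule inj_on_subset[OF inj \<Delta>])
      show "g z \<in> ?\<Delta>" if "g \<in> G.stab a" "z \<in> ?\<Delta>" for g z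
        by (rule bspec[OF bij_betwE[OF S.orbit_bij_betw[OF ab(2) that(1)]] that(2)])
      show "\<exists>g'\<in>G'.stab x. \<forall>z\<in>?\<Delta>. f (g z) = g' (f z)" if g: "g \<in> G.stab a" for g
      proof -
        obtain g' where "g' \<in> G'.stab x" "\<forall>z\<in>\<Omega>. f (g z) = g' (f z)"
          using stab[OF ab(1) g] ab(3) by blast
        then show ?thesis using \<Delta> by (meson subsetD)
      qed
    qed
    moreover have "f ` ?\<Delta> = {h y |h. h \<in> G'.stab x}"
    proof
      show "f ` ?\<Delta> \<subseteq> {h y |h. h \<in> G'.stab x}"
      proof
        fix z assume "z \<in> f ` ?\<Delta>"
        then obtain h where h: "h \<in> G.stab a" "z = f (h b)" by blast
        obtain h' where h': "h' \<in> G'.stab x" "\<forall>x\<in>\<Omega>. f (h x) = h' (f x)"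
          using stab[OF ab(1) h(1)] ab(3) by blast
        then have "z = h' y" using h(2) ab by simp
        then show "z \<in> {h y |h. h \<in> G'.stab x}" using h'(1) by blast
      qed
      show "{h y |h. h \<in> G'.stab x} \<subseteq> f ` ?\<Delta>"
      proof
        fix z assume "z \<in> {h y |h. h \<in> G'.stab x}"
        then obtain h' where h': "h' \<in> G'.stab x" "z = h' y" by blast
        obtain h where "h \<in> G.stab a" "\<forall>x\<in>\<Omega>. f (h x) = h' (f x)" using stab'[OF ab(1)] h' ab by blast
        then have "z = f (h b)" using h' ab by simp
        then show "z \<in> f ` ?\<Delta>" using \<open>h \<in> G.stab a\<close> by blast
      qed
    qed
    ultimately show "only_trivial_blocks (G'.stab x) {h y |h. h \<in> G'.stab x}" by (simp only:)
  qed
qed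

lemma permutation_isomorphic_imp_extremely_primitive:
  assumes G: "permutation_group \<Omega> G" and G': "permutation_group \<Omega>' G'"
    and iso: "permutation_isomorphic \<Omega> G \<Omega>' G'" and E: "extremely_primitive \<Omega>' G'"
  shows "extremely_primitive \<Omega> G"
proof -
  interpret G: permutation_group \<Omega> G by fact
  interpret G': permutation_group \<Omega>' G' by fact
  obtain f \<psi> where f: "bij_betw f \<Omega> \<Omega>'" and \<psi>: "\<psi> \<in> iso (perm_group \<Omega> G) (perm_group \<Omega>' G')"
    and eq: "\<forall>g\<in>G. \<forall>x\<in>\<Omega>. f (g x) = \<psi> g (f x)"
    using iso by (auto simp: permutation_isomorphic_def)
  have \<psi>im: "\<psi> ` G = G'" using \<psi> by (auto simp: iso_def bij_betw_def)
  let ?f = "inv_into \<Omega> f"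
  have rel: "?f (\<psi> g y) = g (?f y)" if g: "g \<in> G" and y: "y \<in> \<Omega>'" for g y
  proof -
    have x: "?f y \<in> \<Omega>" "f (?f y) = y"
      using f y bij_betwE[OF bij_betw_inv_into[OF f]] by (auto simp: bij_betw_inv_into_right)
    then have "f (g (?f y)) = \<psi> g y" using eq g by simp
    then show ?thesis using f G.elem_closed[OF g x(1)] by (metis bij_betw_inv_into_left)
  qed
  show ?thesis
  proof (rule extremely_primitive_transfer[OF G' G bij_betw_inv_into[OF f] _ _ E])
    show "\<exists>g\<in>G. \<forall>x\<in>\<Omega>'. ?f (g' x) = g (?f x)" if "g' \<in> G'" for g'
      using that rel \<psi>im by (metis image_iff)
    show "\<exists>g'\<in>G'. \<forall>x\<in>\<Omega>'. ?f (g' x) = g (?f x)" if "g \<in> G" for g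
      using that rel \<psi>im by (metis image_iff)
  qed
qed

text \<open>Conjugation by \<open>f\<close>. It is needed because the field is constructed on the
  points themselves, while the theorem asks for a field whose elements are natural numbers.\<close>

lemma permutation_group_transport:
  assumes G: "permutation_group \<Omega> G" and f: "bij_betw f \<Omega> \<Omega>'"
  obtains G' where "permutation_group \<Omega>' G'" "permutation_isomorphic \<Omega> G \<Omega>' G'"
    "extremely_primitive \<Omega> G \<Longrightarrow> extremely_primitive \<Omega>' G'"
    "solvable (perm_group \<Omega> G) \<Longrightarrow> solvable (perm_group \<Omega>' G')"
proof -
  interpret G: permutation_group \<Omega> G by fact
  let ?f = "inv_into \<Omega> f"
  define \<psi> where "\<psi> g = (\<lambda>y\<in>\<Omega>'. f (g (?f y)))" for g
  have f': "bij_betw ?f \<Omega>' \<Omega>" by (rule bij_betw_inv_into[OF f])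
  have fm: "?f y \<in> \<Omega>" "f (?f y) = y" if "y \<in> \<Omega>'" for y
    using that f bij_betwE[OF f'] by (auto simp: bij_betw_inv_into_right)
  have fm': "f x \<in> \<Omega>'" "?f (f x) = x" if "x \<in> \<Omega>" for x
    using that f bij_betwE[OF f] by (auto simp: bij_betw_inv_into_left)
  have eq: "f (g x) = \<psi> g (f x)" if "x \<in> \<Omega>" for g x
    using that fm' by (simp add: \<psi>_def)
  have B: "\<psi> g \<in> Bij \<Omega>'" if "g \<in> G" for g
  proof (rule BijI)
    show "\<psi> g \<in> extensional \<Omega>'" by (simp add: \<psi>_def)
    have "bij_betw (f \<circ> g \<circ> ?f) \<Omega>' \<Omega>'"
      using f f' G.elem_bij_betw[OF that] by (blast intro: bij_betw_trans)
    then show "bij_betw (\<psi> g) \<Omega>' \<Omega>'"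
      by (rule bij_betw_cong[THEN iffD1, rotated]) (simp add: \<psi>_def)
  qed
  have comp: "\<psi> (compose \<Omega> g h) = compose \<Omega>' (\<psi> g) (\<psi> h)" if "h \<in> G" for g h
    using fm fm' G.elem_closed[OF that] by (auto simp: \<psi>_def compose_def fun_eq_iff)
  have inj: "inj_on \<psi> G"
  proof (rule inj_onI)
    fix g h assume gh: "g \<in> G" "h \<in> G" "\<psi> g = \<psi> h"
    show "g = h"
    proof (rule G.elem_eqI[OF gh(1,2)])
      fix x assume x: "x \<in> \<Omega>"
      have "f (g x) = f (h x)" using eq[OF x] gh(3) by simp
      then show "g x = h x" using fm'(2) G.elem_closed gh x by metis
    qed
  qed
  have pg: "permutation_group \<Omega>' (\<psi> ` G)"
  proof (rule permutation_groupI)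
    show "\<psi> ` G \<subseteq> Bij \<Omega>'" using B by auto
    have "\<psi> (\<lambda>x\<in>\<Omega>. x) = (\<lambda>x\<in>\<Omega>'. x)" using fm by (auto simp: \<psi>_def)
    then show "(\<lambda>x\<in>\<Omega>'. x) \<in> \<psi> ` G" using G.id_mem by (metis image_eqI)
    show "compose \<Omega>' a b \<in> \<psi> ` G" if "a \<in> \<psi> ` G" "b \<in> \<psi> ` G" for a b
      using that comp G.compose_mem by (auto simp flip: comp)
    show "\<exists>h\<in>\<psi> ` G. \<forall>x\<in>\<Omega>'. h (a x) = x" if a: "a \<in> \<psi> ` G" for a
    proof -
      obtain g where g: "g \<in> G" "a = \<psi> g" using a by blast
      obtain h where h: "h \<in> G" "\<forall>x\<in>\<Omega>. h (g x) = x" using G.obtain_inverse[OF g(1)] by blast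
      have "\<psi> h (a x) = x" if "x \<in> \<Omega>'" for x
        using that fm fm' g h G.elem_closed[OF g(1)] by (simp add: \<psi>_def)
      then show ?thesis using h by blast
    qed
  qed
  interpret G': permutation_group \<Omega>' "\<psi> ` G" by (rule pg)
  have iso: "\<psi> \<in> iso (perm_group \<Omega> G) (perm_group \<Omega>' (\<psi> ` G))"
    unfolding iso_def
  proof (intro CollectI conjI homI)
    show "bij_betw \<psi> (carrier (perm_group \<Omega> G)) (carrier (perm_group \<Omega>' (\<psi> ` G)))"
      using inj by (simp add: bij_betw_def)
  qed (simp_all add: G.mult_eq G'.mult_eq comp)
  show thesis
  proof (rule that[OF pg])
    show "permutation_isomorphic \<Omega> G \<Omega>' (\<psi> ` G)"
      unfolding permutation_isomorphic_def using f iso eq by blast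
    show "extremely_primitive \<Omega>' (\<psi> ` G)" if "extremely_primitive \<Omega> G"
      by (rule extremely_primitive_transfer[OF G pg f _ _ that]) (use eq in blast)+
    show "solvable (perm_group \<Omega>' (\<psi> ` G))" if "solvable (perm_group \<Omega> G)"
    proof (rule group_hom.surj_hom_imp_solvable[OF _ _ that])
      show "group_hom (perm_group \<Omega> G) (perm_group \<Omega>' (\<psi> ` G)) \<psi>"
        using iso G.group_perm_group G'.group_perm_group
        by (auto simp: group_hom_def group_hom_axioms_def iso_def)
    qed simp
  qed
qed

section \<open>Soluble groups\<close>

lemma (in group) exp_of_derived_is_normal:
  "(derived G ^^ n) (carrier G) \<lhd> G"
proof (induction n)
  case 0
  then show ?case by (auto intro!: normal_invI subgroup_self)
qed (simp add: derived_is_normal)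

text \<open>The last nontrivial term \<open>A\<close> of the derived series is abelian and normal.
  For a prime \<open>r\<close> dividing the order of some element of \<open>A\<close>, the elements
  of \<open>A\<close> killed by \<open>r\<close> form a nontrivial subgroup, and conjugation
  preserves it.\<close>

lemma (in group) solvable_obtain_elementary_abelian_normal:
  assumes fin: "finite (carrier G)" and sol: "solvable G" and nontriv: "carrier G \<noteq> {\<one>}"
  obtains N r where "N \<lhd> G" "N \<noteq> {\<one>}" "Factorial_Ring.prime (r::nat)"
    "\<forall>x\<in>N. \<forall>y\<in>N. x \<otimes> y = y \<otimes> x" "\<forall>x\<in>N. x [^] r = \<one>"
proof -
  have ex: "\<exists>n. (derived G ^^ n) (carrier G) = {\<one>}"
    using sol solvable_iff_trivial_derived_seq by simp
  define n where "n = (LEAST n. (derived G ^^ n) (carrier G) = {\<one>})"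
  have n: "(derived G ^^ n) (carrier G) = {\<one>}" unfolding n_def using ex by (rule LeastI_ex)
  then have "n \<noteq> 0" using nontriv by (intro notI) simp
  then obtain m where m: "n = Suc m" by (cases n) auto
  define A where "A = (derived G ^^ m) (carrier G)"
  have A1: "A \<noteq> {\<one>}" using not_less_Least[of m "\<lambda>n. (derived G ^^ n) (carrier G) = {\<one>}"] m
    unfolding n_def A_def by simp
  have dA: "derived G A = {\<one>}" using n m by (simp add: A_def)
  have AN: "A \<lhd> G" unfolding A_def by (rule exp_of_derived_is_normal)
  then interpret A: normal A G .
  have comm: "x \<otimes> y = y \<otimes> x" if xy: "x \<in> A" "y \<in> A" for x y
  proof -
    have c: "x \<in> carrier G" "y \<in> carrier G" using xy by auto
    have "x \<otimes> y \<otimes> inv x \<otimes> inv y \<in> derived G A"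
      unfolding derived_def using xy by (intro generate.incl) blast
    then have "x \<otimes> y \<otimes> inv x \<otimes> inv y = \<one>" using dA by simp
    then have "x \<otimes> y \<otimes> inv x = y" using c by (metis inv_closed inv_equality inv_inv m_closed)
    then show ?thesis using c by (metis inv_solve_right' m_closed)
  qed
  obtain x where x: "x \<in> A" "x \<noteq> \<one>" using A1 A.one_closed by blast
  have xc: "x \<in> carrier G" using x by auto
  have "ord x \<noteq> 1" using ord_eq_1 xc x by blast
  then obtain r :: nat where r: "Factorial_Ring.prime r" "r dvd ord x" using prime_factor_nat by blast
  have ox: "ord x \<ge> 1" using ord_ge_1[OF fin xc] .
  define N where "N = {y \<in> A. y [^] r = \<one>}"
  have cA: "y \<in> carrier G" if "y \<in> A" for y using that by auto
  have "subgroup N G"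
  proof (rule subgroupI)
    show "N \<subseteq> carrier G" by (auto simp: N_def)
    show "N \<noteq> {}" by (auto simp: N_def intro!: exI[of _ \<one>])
    show "inv a \<in> N" if "a \<in> N" for a
      using that by (auto simp: N_def nat_pow_inv)
    show "a \<otimes> b \<in> N" if "a \<in> N" "b \<in> N" for a b
      using that comm[of a b] by (auto simp: N_def pow_mult_distrib)
  qed
  moreover have "y \<otimes> h \<otimes> inv y \<in> N" if y: "y \<in> carrier G" and h: "h \<in> N" for y h
  proof -
    have hc: "h \<in> carrier G" "h \<in> A" using h by (auto simp: N_def)
    have "(y \<otimes> h \<otimes> inv y) [^] k = y \<otimes> h [^] k \<otimes> inv y" for k :: nat
    proof (induction k)
      case (Suc k)
      have "(y \<otimes> h \<otimes> inv y) [^] Suc k = (y \<otimes> h [^] k \<otimes> inv y) \<otimes> (y \<otimes> h \<otimes> inv y)" using Suc by simp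
      also have "\<dots> = y \<otimes> h [^] k \<otimes> (inv y \<otimes> y) \<otimes> h \<otimes> inv y"
        using y hc by (simp only: m_assoc m_closed nat_pow_closed inv_closed)
      also have "\<dots> = y \<otimes> h [^] Suc k \<otimes> inv y" using y hc by (simp add: m_assoc)
      finally show ?case .
    qed (use y in simp)
    then show ?thesis using h y hc A.inv_op_closed2[OF y hc(2)] by (simp add: N_def)
  qed
  ultimately have NG: "N \<lhd> G" by (rule normal_invI)
  have "x [^] (ord x div r) \<in> N"
  proof -
    have "x [^] k \<in> A" for k :: nat by (induction k) (use x(1) in auto)
    then have "x [^] (ord x div r) \<in> A" .
    moreover have "(x [^] (ord x div r)) [^] r = \<one>" using xc r by (simp add: nat_pow_pow)
    ultimately show ?thesis by (simp add: N_def)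
  qed
  moreover have "x [^] (ord x div r) \<noteq> \<one>"
  proof
    assume "x [^] (ord x div r) = \<one>"
    then have "ord x dvd ord x div r" using pow_eq_id xc by blast
    moreover have "ord x div r > 0" using r ox by (auto simp: div_greater_zero_iff dvd_imp_le prime_gt_0_nat)
    moreover have "ord x div r < ord x" using r ox prime_gt_1_nat by auto
    ultimately show False using dvd_imp_le by fastforce
  qed
  ultimately have "N \<noteq> {\<one>}" by blast
  then show thesis
    using NG r(1) comm by (intro that[of N r]) (auto simp: N_def)
qed

section \<open>Semilinear maps\<close>

text \<open>\<open>J\<close> is the preimage in the naturals of a subgroup of the integers modulo
  \<open>d\<close>. It will be the set of Frobenius exponents that occur in a semilinear
  group.\<close>

lemma additive_periodic_set:
  fixes J :: "nat set"
  assumes d: "d > 0" and zero: "0 \<in> J" and add: "\<And>i j. i \<in> J \<Longrightarrow> j \<in> J \<Longrightarrow> i + j \<in> J"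
    and per: "\<And>j. j + d \<in> J \<longleftrightarrow> j \<in> J"
  obtains m where "m > 0" "m dvd d" "\<And>j. j \<in> J \<longleftrightarrow> m dvd j" "card (J \<inter> {..<d}) = d div m"
proof -
  have dJ: "d \<in> J" using per[of 0] zero by simp
  define m where "m = (LEAST m. m > 0 \<and> m \<in> J)"
  have m: "m > 0" "m \<in> J"
    using LeastI_ex[of "\<lambda>m. m > 0 \<and> m \<in> J"] d dJ unfolding m_def by blast+
  have least: "m \<le> j" if "j > 0" "j \<in> J" for j
    using that unfolding m_def by (intro Least_le) simp
  have mult: "j * i \<in> J" if "j \<in> J" for i j
    using that zero by (induction i) (auto intro: add)
  have per': "j + d * i \<in> J \<longleftrightarrow> j \<in> J" for i j
  proof (induction i)
    case (Suc i)
    have "j + d * Suc i = (j + d * i) + d" by simp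
    then show ?case using per[of "j + d * i"] Suc by metis
  qed simp
  have iff: "j \<in> J \<longleftrightarrow> m dvd j" for j
  proof
    assume j: "j \<in> J"
    \<comment> \<open>Subtraction within the naturals: adding \<open>d - 1\<close> further copies of
      \<open>m * (j div m)\<close> leaves \<open>j mod m\<close> plus a multiple of
      \<open>d\<close>, and periodicity removes that multiple.\<close>
    have "j + m * (j div m) * (d - 1) \<in> J" using j m(2) mult add by (metis mult.assoc)
    also have "j + m * (j div m) * (d - 1) = j mod m + (m * (j div m) + m * (j div m) * (d - 1))" by simp
    also have "m * (j div m) + m * (j div m) * (d - 1) = d * (m * (j div m))"
      using d by (cases d) (auto simp: algebra_simps)
    finally have "j mod m \<in> J" using per' by simp
    then have "j mod m = 0" using least[of "j mod m"] m(1) by (meson linorder_not_le mod_less_divisor neq0_conv)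
    then show "m dvd j" by auto
  qed (use m(2) mult in auto)
  have md: "m dvd d" using iff dJ by simp
  then obtain c where c: "d = m * c" by blast
  then have dc: "d div m = c" using m(1) by simp
  have "J \<inter> {..<d} = (\<lambda>i. m * i) ` {..<d div m}"
  proof
    show "J \<inter> {..<d} \<subseteq> (\<lambda>i. m * i) ` {..<d div m}"
    proof
      fix j assume "j \<in> J \<inter> {..<d}"
      then obtain i where "j = m * i" "j < d" using iff by auto
      then show "j \<in> (\<lambda>i. m * i) ` {..<d div m}" unfolding dc using c by auto
    qed
    show "(\<lambda>i. m * i) ` {..<d div m} \<subseteq> J \<inter> {..<d}"
    proof
      fix j assume "j \<in> (\<lambda>i. m * i) ` {..<d div m}"
      then obtain i where i: "j = m * i" "i < c" unfolding dc by blast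
      then have "j < d" unfolding c using m(1) by simp
      moreover have "j \<in> J" unfolding iff i(1) by simp
      ultimately show "j \<in> J \<inter> {..<d}" by simp
    qed
  qed
  then have "card (J \<inter> {..<d}) = d div m" using m(1) by (simp add: card_image inj_on_def)
  then show thesis using that m(1) md iff by blast
qed

lemma (in field) ring_iso_fixes_prime_subfield:
  fixes \<sigma> :: "'a \<Rightarrow> 'a"
  assumes "\<sigma> \<in> ring_iso R R" "k \<in> prime_subfield R"
  shows "k \<in> carrier R \<and> \<sigma> k = k"
proof -
  have hom: "\<sigma> \<in> ring_hom R R" and bij: "bij_betw \<sigma> (carrier R) (carrier R)"
    using assms by (auto simp: ring_iso_def)
  interpret S: ring_hom_cring R R \<sigma> using hom by unfold_locales
  from assms(2) show ?thesis
  proof (induction rule: generate_field.induct)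
    case (m_inv h)
    then have h: "h \<in> Units R" using field_Units by auto
    then have ih: "inv h \<in> carrier R" "inv h \<otimes> h = \<one>" by auto
    have "\<sigma> (inv h) \<otimes> h = \<one>"
      using m_inv.IH ih S.hom_mult[of "inv h" h] by simp
    then show ?case using ih h m_inv.IH by (metis S.hom_closed inv_char m_comm)
  qed auto
qed

section \<open>Affine semilinear maps in terms of Frobenius exponents\<close>

context galois_field begin

lemma galois_group_prime_subfield: "galois_group R (prime_subfield R) = ring_iso R R"
  using ring_iso_fixes_prime_subfield by (auto simp: galois_group_def)

lemma frobenius_pow_ring_iso: "(\<lambda>x. x [^] (p ^ j)) \<in> ring_iso R R"
proof -
  have "(\<lambda>x. x [^] (p ^ j)) ` carrier R = carrier R"
    by (rule endo_inj_surj[OF finite_carrier _ frobenius_pow_inj_on]) auto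
  then show ?thesis
    unfolding ring_iso_def ring_hom_def bij_betw_def
    using frobenius_pow_inj_on by (auto simp: frobenius_pow_add nat_pow_distrib)
qed

text \<open>The exponent is any natural number, not reduced modulo \<open>d\<close>, so that
  composition simply adds exponents; only uniqueness of the representation needs
  \<open>j < d\<close>.\<close>

definition semilin :: "'a \<Rightarrow> nat \<Rightarrow> 'a \<Rightarrow> 'a" where
  "semilin a j = (\<lambda>x\<in>carrier R. a \<otimes> x [^] (p ^ j))"

definition transl :: "'a \<Rightarrow> 'a \<Rightarrow> 'a" where
  "transl b = (\<lambda>x\<in>carrier R. x \<oplus> b)"

lemma AGammaL1_eq:
  "AGammaL1 R = {\<lambda>x\<in>carrier R. a \<otimes> x [^] (p ^ j) \<oplus> b | a b j. a \<in> carrier R - {\<zero>} \<and> b \<in> carrier R}"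
proof
  show "AGammaL1 R \<subseteq> {\<lambda>x\<in>carrier R. a \<otimes> x [^] (p ^ j) \<oplus> b | a b j. a \<in> carrier R - {\<zero>} \<and> b \<in> carrier R}"
  proof
    fix g assume "g \<in> AGammaL1 R"
    then obtain a b s where g: "g = (\<lambda>x\<in>carrier R. a \<otimes> s x \<oplus> b)" "a \<in> carrier R - {\<zero>}" "b \<in> carrier R"
      "s \<in> ring_iso R R" unfolding AGammaL1_def galois_group_prime_subfield by blast
    obtain j where "\<And>x. x \<in> carrier R \<Longrightarrow> s x = x [^] (p ^ j)"
      using ring_iso_is_frobenius_pow[OF g(4)] by metis
    then have "g = (\<lambda>x\<in>carrier R. a \<otimes> x [^] (p ^ j) \<oplus> b)" unfolding g(1) by (intro restrict_ext) simp
    then show "g \<in> {\<lambda>x\<in>carrier R. a \<otimes> x [^] (p ^ j) \<oplus> b | a b j. a \<in> carrier R - {\<zero>} \<and> b \<in> carrier R}"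
      using g by blast
  qed
  show "{\<lambda>x\<in>carrier R. a \<otimes> x [^] (p ^ j) \<oplus> b | a b j. a \<in> carrier R - {\<zero>} \<and> b \<in> carrier R} \<subseteq> AGammaL1 R"
  proof
    fix g assume "g \<in> {\<lambda>x\<in>carrier R. a \<otimes> x [^] (p ^ j) \<oplus> b | a b j. a \<in> carrier R - {\<zero>} \<and> b \<in> carrier R}"
    then obtain a b j where g: "g = (\<lambda>x\<in>carrier R. a \<otimes> x [^] (p ^ j) \<oplus> b)" "a \<in> carrier R - {\<zero>}" "b \<in> carrier R"
      by blast
    show "g \<in> AGammaL1 R"
      unfolding AGammaL1_def galois_group_prime_subfield
      using g frobenius_pow_ring_iso[of j]
      by (intro CollectI exI[of _ a] exI[of _ b] exI[of _ "\<lambda>x. x [^] (p ^ j)"]) auto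
  qed
qed

lemma AGammaL1I:
  "a \<in> carrier R \<Longrightarrow> a \<noteq> \<zero> \<Longrightarrow> b \<in> carrier R \<Longrightarrow> (\<lambda>x\<in>carrier R. a \<otimes> x [^] (p ^ j) \<oplus> b) \<in> AGammaL1 R"
  unfolding AGammaL1_eq by blast

lemma AGammaL1E:
  assumes "g \<in> AGammaL1 R"
  obtains a b j where "g = (\<lambda>x\<in>carrier R. a \<otimes> x [^] (p ^ j) \<oplus> b)" "a \<in> carrier R" "a \<noteq> \<zero>" "b \<in> carrier R"
  using assms unfolding AGammaL1_eq by blast

lemma unit_inv:
  assumes "a \<in> carrier R" "a \<noteq> \<zero>"
  shows "inv a \<in> carrier R" "inv a \<noteq> \<zero>" "inv a \<otimes> a = \<one>" "a \<otimes> inv a = \<one>"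
proof -
  have a: "a \<in> Units R" using assms field_Units by auto
  then show "inv a \<in> carrier R" "inv a \<otimes> a = \<one>" "a \<otimes> inv a = \<one>" by auto
  then show "inv a \<noteq> \<zero>" using assms by auto
qed

lemma frobenius_pow_comp:
  "x \<in> carrier R \<Longrightarrow> (x [^] (p ^ j)) [^] (p ^ i) = x [^] (p ^ (i + j))"
  by (simp add: nat_pow_pow power_add mult.commute)

lemma frobenius_pow_period:
  "x \<in> carrier R \<Longrightarrow> x [^] (p ^ (j + d * i)) = x [^] (p ^ j)"
proof (induction i)
  case (Suc i)
  have "x [^] (p ^ (j + d * Suc i)) = (x [^] (p ^ (j + d * i))) [^] (p ^ d)"
    using Suc.prems by (simp add: frobenius_pow_comp add.assoc add.commute add.left_commute)
  then show ?case using Suc pow_card by simp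
qed simp

lemma permutation_group_AGammaL1: "permutation_group (carrier R) (AGammaL1 R)"
proof (rule permutation_groupI)
  have inv: "\<exists>h\<in>AGammaL1 R. \<forall>x\<in>carrier R. h (g x) = x" if gA: "g \<in> AGammaL1 R" for g
  proof -
    obtain a b j where g: "g = (\<lambda>x\<in>carrier R. a \<otimes> x [^] (p ^ j) \<oplus> b)" "a \<in> carrier R" "a \<noteq> \<zero>" "b \<in> carrier R"
      using AGammaL1E[OF gA] .
    \<comment> \<open>Chosen so that \<open>i + j\<close> is the multiple \<open>d * j\<close> of
      \<open>d\<close>: the \<open>p ^ i\<close>-th power then undoes the \<open>p ^ j\<close>-th
      power without assuming \<open>j < d\<close>.\<close>
    define i where "i = d * j - j"
    have ij: "i + j = 0 + d * j" using d_pos by (simp add: i_def)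
    note ia = unit_inv[OF g(2,3)]
    \<comment> \<open>Solving y = a x^(p^j) + b for x and distributing the \<open>p ^ i\<close>-th
      power over the difference.\<close>
    define h where "h = (\<lambda>x\<in>carrier R. (inv a) [^] (p ^ i) \<otimes> x [^] (p ^ i) \<oplus> (inv a \<otimes> (\<ominus> b)) [^] (p ^ i))"
    have "(inv a) [^] (p ^ i) \<noteq> \<zero>" using ia pow_eq_zeroD by blast
    then have "h \<in> AGammaL1 R" unfolding h_def using ia g by (intro AGammaL1I) auto
    moreover have "h (g x) = x" if x: "x \<in> carrier R" for x
    proof -
      let ?y = "a \<otimes> x [^] (p ^ j) \<oplus> b"
      have y: "?y \<in> carrier R" using x g by simp
      have "h (g x) = (inv a \<otimes> ?y \<oplus> inv a \<otimes> (\<ominus> b)) [^] (p ^ i)"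
        using x g ia y by (simp add: h_def frobenius_pow_add nat_pow_distrib)
      also have "inv a \<otimes> ?y \<oplus> inv a \<otimes> (\<ominus> b) = (inv a \<otimes> a) \<otimes> x [^] (p ^ j)"
        using x g ia(1) by (simp add: r_distr m_assoc r_minus a_assoc r_neg)
      also have "\<dots> = x [^] (p ^ j)" using ia x by simp
      also have "(x [^] (p ^ j)) [^] (p ^ i) = x"
        using x frobenius_pow_period[OF x, of 0 j] by (simp add: frobenius_pow_comp ij)
      finally show ?thesis .
    qed
    ultimately show ?thesis by blast
  qed
  then show "\<exists>h\<in>AGammaL1 R. \<forall>x\<in>carrier R. h (g x) = x" if "g \<in> AGammaL1 R" for g using that .
  have closed: "g x \<in> carrier R" if "g \<in> AGammaL1 R" "x \<in> carrier R" for g x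
    using that by (auto elim!: AGammaL1E)
  show "AGammaL1 R \<subseteq> Bij (carrier R)"
  proof
    fix g assume g: "g \<in> AGammaL1 R"
    obtain h where "\<forall>x\<in>carrier R. h (g x) = x" using inv[OF g] by blast
    then have inj: "inj_on g (carrier R)" by (metis inj_onI)
    have "g ` carrier R = carrier R"
      by (rule endo_inj_surj[OF finite_carrier _ inj]) (use closed[OF g] in auto)
    moreover have "g \<in> extensional (carrier R)" using g by (auto elim!: AGammaL1E)
    ultimately show "g \<in> Bij (carrier R)" using inj by (simp add: Bij_def bij_betw_def)
  qed
  show "(\<lambda>x\<in>carrier R. x) \<in> AGammaL1 R"
  proof -
    have "(\<lambda>x\<in>carrier R. x) = (\<lambda>x\<in>carrier R. \<one> \<otimes> x [^] (p ^ 0) \<oplus> \<zero>)" by (intro restrict_ext) simp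
    also have "\<dots> \<in> AGammaL1 R" by (rule AGammaL1I) auto
    finally show ?thesis .
  qed
  show "compose (carrier R) g h \<in> AGammaL1 R" if gh: "g \<in> AGammaL1 R" "h \<in> AGammaL1 R" for g h
  proof -
    obtain a b j where g: "g = (\<lambda>x\<in>carrier R. a \<otimes> x [^] (p ^ j) \<oplus> b)" "a \<in> carrier R" "a \<noteq> \<zero>" "b \<in> carrier R"
      using AGammaL1E[OF gh(1)] .
    obtain a' b' j' where h: "h = (\<lambda>x\<in>carrier R. a' \<otimes> x [^] (p ^ j') \<oplus> b')" "a' \<in> carrier R" "a' \<noteq> \<zero>" "b' \<in> carrier R"
      using AGammaL1E[OF gh(2)] .
    have "compose (carrier R) g h = (\<lambda>x\<in>carrier R. (a \<otimes> a' [^] (p ^ j)) \<otimes> x [^] (p ^ (j + j')) \<oplus> (a \<otimes> b' [^] (p ^ j) \<oplus> b))"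
      unfolding compose_def
    proof (rule restrict_ext)
      fix x assume x: "x \<in> carrier R"
      have "g (h x) = a \<otimes> (a' [^] (p ^ j) \<otimes> x [^] (p ^ (j + j')) \<oplus> b' [^] (p ^ j)) \<oplus> b"
        using x g h by (simp add: frobenius_pow_add nat_pow_distrib frobenius_pow_comp)
      then show "g (h x) = (a \<otimes> a' [^] (p ^ j)) \<otimes> x [^] (p ^ (j + j')) \<oplus> (a \<otimes> b' [^] (p ^ j) \<oplus> b)"
        using x g h by (simp add: r_distr m_assoc a_assoc)
    qed
    moreover have "a \<otimes> a' [^] (p ^ j) \<noteq> \<zero>" using g h pow_eq_zeroD by (metis integral nat_pow_closed)
    ultimately show ?thesis using g h by (metis AGammaL1I a_closed m_closed nat_pow_closed)
  qed
qed

lemma semilin_apply: "x \<in> carrier R \<Longrightarrow> semilin a j x = a \<otimes> x [^] (p ^ j)"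
  by (simp add: semilin_def)

lemma semilin_one: "a \<in> carrier R \<Longrightarrow> semilin a j \<one> = a"
  by (simp add: semilin_def)

lemma transl_apply: "x \<in> carrier R \<Longrightarrow> transl b x = x \<oplus> b"
  by (simp add: transl_def)

lemma semilin_AGammaL1: "a \<in> carrier R \<Longrightarrow> a \<noteq> \<zero> \<Longrightarrow> semilin a j \<in> AGammaL1 R"
proof -
  assume a: "a \<in> carrier R" "a \<noteq> \<zero>"
  have "semilin a j = (\<lambda>x\<in>carrier R. a \<otimes> x [^] (p ^ j) \<oplus> \<zero>)"
    unfolding semilin_def using a by (intro restrict_ext) simp
  also have "\<dots> \<in> AGammaL1 R" using a by (intro AGammaL1I) auto
  finally show ?thesis .
qed

lemma transl_AGammaL1: "b \<in> carrier R \<Longrightarrow> transl b \<in> AGammaL1 R"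
proof -
  assume b: "b \<in> carrier R"
  have "transl b = (\<lambda>x\<in>carrier R. \<one> \<otimes> x [^] (p ^ 0) \<oplus> b)"
    unfolding transl_def using b by (intro restrict_ext) simp
  also have "\<dots> \<in> AGammaL1 R" using b by (intro AGammaL1I) auto
  finally show ?thesis .
qed

lemma translation_group_eq: "translation_group R = transl ` carrier R"
  by (auto simp: translation_group_def transl_def)

lemma GammaL1_eq: "GammaL1 R = {semilin a j | a j. a \<in> carrier R \<and> a \<noteq> \<zero>}"
proof
  show "GammaL1 R \<subseteq> {semilin a j | a j. a \<in> carrier R \<and> a \<noteq> \<zero>}"
  proof
    fix g assume "g \<in> GammaL1 R"
    then have g: "g \<in> AGammaL1 R" "g \<zero> = \<zero>" by (auto simp: GammaL1_def stabilizer_def)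
    obtain a b j where ab: "g = (\<lambda>x\<in>carrier R. a \<otimes> x [^] (p ^ j) \<oplus> b)" "a \<in> carrier R" "a \<noteq> \<zero>" "b \<in> carrier R"
      using AGammaL1E[OF g(1)] .
    have "\<zero> [^] (p ^ j) = \<zero>" using p_gt_1 by (intro nat_pow_zero) simp
    then have "b = \<zero>" using g(2) ab by simp
    then have "g = semilin a j" unfolding ab(1) semilin_def using ab(2) by (intro restrict_ext) simp
    then show "g \<in> {semilin a j | a j. a \<in> carrier R \<and> a \<noteq> \<zero>}" using ab by blast
  qed
  have "semilin a j \<zero> = \<zero>" if "a \<in> carrier R" for a j
    using that p_gt_1 nat_pow_zero[of "p ^ j"] by (simp add: semilin_def)
  then show "{semilin a j | a j. a \<in> carrier R \<and> a \<noteq> \<zero>} \<subseteq> GammaL1 R"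
    using semilin_AGammaL1 by (auto simp: GammaL1_def stabilizer_def)
qed

lemma GL1_eq: "GL1 R = {semilin a 0 | a. a \<in> carrier R \<and> a \<noteq> \<zero>}"
proof -
  have "(\<lambda>x\<in>carrier R. a \<otimes> x) = semilin a 0" for a
    unfolding semilin_def by (intro restrict_ext) simp
  then show ?thesis by (auto simp: GL1_def)
qed

lemma permutation_group_GammaL1: "permutation_group (carrier R) (GammaL1 R)"
proof -
  have "GammaL1 R = {g \<in> AGammaL1 R. g \<zero> = \<zero>}" by (auto simp: GammaL1_def stabilizer_def)
  then show ?thesis
    using permutation_group.permutation_group_stab[OF permutation_group_AGammaL1 zero_closed] by simp
qed

lemma semilin_period: "semilin a (j + d) = semilin a j"
  unfolding semilin_def using frobenius_pow_period[of _ j 1] by (intro restrict_ext) simp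

lemma compose_semilin:
  assumes "a \<in> carrier R" "b \<in> carrier R"
  shows "compose (carrier R) (semilin a i) (semilin b j) = semilin (a \<otimes> b [^] (p ^ i)) (i + j)"
  unfolding compose_def
proof -
  show "(\<lambda>x\<in>carrier R. semilin a i (semilin b j x)) = semilin (a \<otimes> b [^] (p ^ i)) (i + j)"
    unfolding semilin_def[of "a \<otimes> b [^] (p ^ i)"]
    using assms
    by (intro restrict_ext) (simp add: semilin_apply nat_pow_distrib frobenius_pow_comp m_assoc)
qed

text \<open>The value at one recovers the coefficient. If two exponents gave the same map, the power
  map for their difference would be the identity, which forces the difference to be 0 or at least
  \<open>d\<close>.\<close>

lemma semilin_eq_iff:
  assumes "a \<in> carrier R" "b \<in> carrier R" "a \<noteq> \<zero>" "i < d" "j < d"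
  shows "semilin a i = semilin b j \<longleftrightarrow> a = b \<and> i = j"
proof -
  have eq: "i = j" if le: "i \<le> j" "j < d" "a \<in> carrier R" "a \<noteq> \<zero>" "semilin a i = semilin a j" for i j a
  proof (rule ccontr)
    assume ne: "i \<noteq> j"
    have "x [^] (p ^ (j - i)) = x" if x: "x \<in> carrier R" for x
    proof -
      have "a \<otimes> x [^] (p ^ i) = a \<otimes> x [^] (p ^ j)" using fun_cong[OF le(5), of x] x semilin_apply by simp
      then have "x [^] (p ^ i) = x [^] (p ^ j)" using le(3,4) x m_lcancel by simp
      also have "\<dots> = (x [^] (p ^ (j - i))) [^] (p ^ i)" using x le(1) by (simp add: frobenius_pow_comp)
      finally show ?thesis
        using inj_onD[OF frobenius_pow_inj_on[of i], of x "x [^] (p ^ (j - i))"] x by simp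
    qed
    then have "d \<le> j - i" using frobenius_pow_id_imp_ge[of "j - i"] ne le(1) by simp
    then show False using le(2) by simp
  qed
  show ?thesis
  proof
    assume e: "semilin a i = semilin b j"
    then have ab: "a = b" using semilin_one assms by metis
    then have "i = j" using eq[of i j a] eq[of j i a] e assms by (metis nat_le_linear)
    then show "a = b \<and> i = j" using ab by simp
  qed simp
qed

end

section \<open>Sizes of blocks, and extreme primitivity tested at one point\<close>

context permutation_group begin

text \<open>The translates of \<open>B\<close> have equal size and partition \<Delta>: if two of
  them meet, the quotient of the two permutations moves \<open>B\<close> to a set meeting
  \<open>B\<close>, hence fixes it.\<close>

lemma block_card_dvd:
  assumes fin: "finite \<Delta>" and \<Delta>: "\<Delta> \<subseteq> \<Omega>" and closed: "\<And>g x. g \<in> G \<Longrightarrow> x \<in> \<Delta> \<Longrightarrow> g x \<in> \<Delta>"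
    and trans: "\<And>x y. x \<in> \<Delta> \<Longrightarrow> y \<in> \<Delta> \<Longrightarrow> \<exists>g\<in>G. g x = y"
    and B: "B \<noteq> {}" "B \<subseteq> \<Delta>" "\<forall>g\<in>G. g ` B = B \<or> g ` B \<inter> B = {}"
  shows "card B dvd card \<Delta>"
proof -
  define C where "C = (\<lambda>g. g ` B) ` G"
  have B\<Omega>: "B \<subseteq> \<Omega>" using B \<Delta> by blast
  have un: "\<Union>C = \<Delta>"
  proof
    show "\<Union>C \<subseteq> \<Delta>" using closed B(2) by (auto simp: C_def)
    show "\<Delta> \<subseteq> \<Union>C"
    proof
      fix y assume "y \<in> \<Delta>"
      moreover obtain b where "b \<in> B" using B(1) by blast
      ultimately obtain g where "g \<in> G" "g b = y" using trans B(2) by blast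
      then show "y \<in> \<Union>C" using \<open>b \<in> B\<close> by (auto simp: C_def)
    qed
  qed
  have fC: "finite C" using un fin by (metis finite_UnionD)
  have cards: "card c = card B" if cC: "c \<in> C" for c
  proof -
    obtain g where g: "g \<in> G" "c = g ` B" using cC unfolding C_def by blast
    have "inj_on g B" using elem_inj[OF g(1)] B\<Omega> by (auto simp: inj_on_def subset_iff)
    then show ?thesis using g(2) card_image by blast
  qed
  have disj: "c \<inter> c' = {}" if cc: "c \<in> C" "c' \<in> C" "c \<noteq> c'" for c c'
  proof (rule ccontr)
    assume ne: "c \<inter> c' \<noteq> {}"
    obtain g where g: "g \<in> G" "c = g ` B" using cc(1) unfolding C_def by blast
    obtain h where h: "h \<in> G" "c' = h ` B" using cc(2) unfolding C_def by blast
    obtain h' where h': "h' \<in> G" "\<forall>x\<in>\<Omega>. h' (h x) = x" "\<forall>x\<in>\<Omega>. h (h' x) = x" using obtain_inverse[OF h(1)] by blast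
    let ?k = "compose \<Omega> h' g"
    have k: "?k \<in> G" by (rule compose_mem[OF h'(1) g(1)])
    obtain x y where xy: "x \<in> B" "y \<in> B" "g x = h y" using ne g h by auto
    have "?k x = y" using xy h'(2) B\<Omega> by (auto simp: compose_def)
    then have "?k ` B \<inter> B \<noteq> {}" using xy by blast
    then have kB: "?k ` B = B" using B(3) k by blast
    have "h ` B = h ` (?k ` B)" using kB by simp
    also have "\<dots> = g ` B"
    proof -
      have "h (?k x) = g x" if "x \<in> B" for x
        using that B\<Omega> h'(3) elem_closed[OF g(1)] by (auto simp: compose_def)
      then show ?thesis unfolding image_image by (intro image_cong) auto
    qed
    finally show False using cc(3) g h by simp
  qed
  have "card B * card C = card (\<Union>C)"
    by (rule card_partition[OF fC]) (use un fin cards disj in auto)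
  then show ?thesis unfolding un by (metis dvd_triv_left)
qed

lemma prime_card_only_trivial_blocks:
  assumes "Factorial_Ring.prime (card \<Delta>)" "\<Delta> \<subseteq> \<Omega>" "\<And>g x. g \<in> G \<Longrightarrow> x \<in> \<Delta> \<Longrightarrow> g x \<in> \<Delta>"
    "\<And>x y. x \<in> \<Delta> \<Longrightarrow> y \<in> \<Delta> \<Longrightarrow> \<exists>g\<in>G. g x = y"
  shows "only_trivial_blocks G \<Delta>"
  unfolding only_trivial_blocks_def
proof (intro allI impI, elim conjE)
  have fin: "finite \<Delta>" using assms(1) by (metis card.infinite not_prime_0)
  fix B assume B: "B \<noteq> {}" "B \<subseteq> \<Delta>" "\<forall>g\<in>G. g ` B = B \<or> g ` B \<inter> B = {}"
  have "card B dvd card \<Delta>" by (rule block_card_dvd[OF fin assms(2)]) (use assms(3,4) B in auto)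
  then have "card B = 1 \<or> card B = card \<Delta>" using assms(1) by (metis prime_nat_iff)
  then show "(\<exists>x. B = {x}) \<or> B = \<Delta>"
    using card_subset_eq[OF fin B(2)] by (metis card_1_singletonE)
qed

text \<open>An element taking \<open>o'\<close> to \<alpha> conjugates the stabiliser of
  \<open>o'\<close> to that of \<alpha> and carries suborbits along, so one base point is
  enough.\<close>

lemma extremely_primitiveI:
  assumes o: "o' \<in> \<Omega>" and trans: "\<And>x. x \<in> \<Omega> \<Longrightarrow> \<exists>g\<in>G. g o' = x"
    and prim: "only_trivial_blocks G \<Omega>" and nreg: "\<exists>g\<in>stab o'. g \<noteq> (\<lambda>x\<in>\<Omega>. x)"
    and orb: "\<And>\<beta>. \<beta> \<in> \<Omega> \<Longrightarrow> \<beta> \<noteq> o' \<Longrightarrow> only_trivial_blocks (stab o') {h \<beta> | h. h \<in> stab o'}"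
  shows "extremely_primitive \<Omega> G"
  unfolding extremely_primitive_iff
proof (intro conjI ballI impI)
  show "\<Omega> \<noteq> {}" using o by blast
  have all: "x \<in> {h o' |h. h \<in> G}" if "x \<in> \<Omega>" for x using trans[OF that] by blast
  show "\<exists>g\<in>G. g x = y" if "x \<in> \<Omega>" "y \<in> \<Omega>" for x y
    by (rule orbit_transitive[OF o all[OF that(1)] all[OF that(2)]])
  show "only_trivial_blocks G \<Omega>" by fact
  show "\<exists>x\<in>\<Omega>. \<exists>g\<in>G. g x = x \<and> g \<noteq> (\<lambda>x\<in>\<Omega>. x)" using nreg o by blast
  fix \<alpha> \<beta> assume \<alpha>\<beta>: "\<alpha> \<in> \<Omega>" "\<beta> \<in> \<Omega>" "\<beta> \<noteq> \<alpha>"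
  obtain g where g: "g \<in> G" "g o' = \<alpha>" using trans[OF \<alpha>\<beta>(1)] by blast
  obtain g' where g': "g' \<in> G" "\<forall>x\<in>\<Omega>. g' (g x) = x" "\<forall>x\<in>\<Omega>. g (g' x) = x" using obtain_inverse[OF g(1)] by blast
  have conj: "compose \<Omega> g (compose \<Omega> h g') \<in> stab \<alpha>" "\<forall>x\<in>\<Omega>. g (h x) = compose \<Omega> g (compose \<Omega> h g') (g x)"
    if h: "h \<in> stab o'" for h
  proof -
    have hG: "h \<in> G" "h o' = o'" using h by auto
    show *: "\<forall>x\<in>\<Omega>. g (h x) = compose \<Omega> g (compose \<Omega> h g') (g x)"
      using g' elem_closed[OF g(1)] by (simp add: compose_def)
    have "compose \<Omega> g (compose \<Omega> h g') \<in> G" using compose_mem g(1) g'(1) hG(1) by blast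
    moreover have "compose \<Omega> g (compose \<Omega> h g') \<alpha> = \<alpha>" using * o g(2) hG(2) by metis
    ultimately show "compose \<Omega> g (compose \<Omega> h g') \<in> stab \<alpha>" by simp
  qed
  let ?b = "g' \<beta>"
  have b: "?b \<in> \<Omega>" "g ?b = \<beta>" using g' elem_closed \<alpha>\<beta>(2) by auto
  have bo: "?b \<noteq> o'" using b(2) g(2) \<alpha>\<beta>(3) by auto
  let ?\<Delta> = "{h ?b | h. h \<in> stab o'}"
  interpret S: permutation_group \<Omega> "stab o'" by (rule permutation_group_stab[OF o])
  have \<Delta>: "?\<Delta> \<subseteq> \<Omega>" using elem_closed b(1) by auto
  have "only_trivial_blocks (stab \<alpha>) (g ` ?\<Delta>)"
  proof (rule only_trivial_blocks_image[where K = "stab o'"])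
    show "only_trivial_blocks (stab o') ?\<Delta>" by (rule orb[OF b(1) bo])
    show "inj_on g ?\<Delta>" by (rule inj_on_subset[OF bij_betw_imp_inj_on[OF elem_bij_betw[OF g(1)]] \<Delta>])
    show "k z \<in> ?\<Delta>" if "k \<in> stab o'" "z \<in> ?\<Delta>" for k z
      by (rule bspec[OF bij_betwE[OF S.orbit_bij_betw[OF b(1) that(1)]] that(2)])
    show "\<exists>k'\<in>stab \<alpha>. \<forall>x\<in>?\<Delta>. g (k x) = k' (g x)" if "k \<in> stab o'" for k
      using conj[OF that] \<Delta> by (meson subsetD)
  qed
  moreover have "g ` ?\<Delta> = {h \<beta> | h. h \<in> stab \<alpha>}"
  proof
    show "g ` ?\<Delta> \<subseteq> {h \<beta> | h. h \<in> stab \<alpha>}"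
    proof
      fix z assume "z \<in> g ` ?\<Delta>"
      then obtain h where h: "h \<in> stab o'" "z = g (h ?b)" by blast
      have "z = compose \<Omega> g (compose \<Omega> h g') \<beta>" using conj(2)[OF h(1)] h(2) b by metis
      then show "z \<in> {h \<beta> | h. h \<in> stab \<alpha>}" using conj(1)[OF h(1)] by blast
    qed
    show "{h \<beta> | h. h \<in> stab \<alpha>} \<subseteq> g ` ?\<Delta>"
    proof
      fix z assume "z \<in> {h \<beta> | h. h \<in> stab \<alpha>}"
      then obtain k where k: "k \<in> G" "k \<alpha> = \<alpha>" "z = k \<beta>" by blast
      let ?h = "compose \<Omega> g' (compose \<Omega> k g)"
      have hG: "?h \<in> G" using compose_mem g(1) g'(1) k(1) by blast
      have "?h o' = g' (g o')" using o g(2) k(2) by (simp add: compose_def)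
      then have "?h o' = o'" using g'(2) o by simp
      moreover have "g (?h ?b) = k \<beta>" using b g'(3) elem_closed[OF k(1) \<alpha>\<beta>(2)] by (simp add: compose_def)
      ultimately show "z \<in> g ` ?\<Delta>" using hG k(3) by (intro image_eqI[of _ _ "?h ?b"]) auto
    qed
  qed
  ultimately show "only_trivial_blocks (stab \<alpha>) {h \<beta> | h. h \<in> stab \<alpha>}" by (simp only:)
qed

end

section \<open>Scalars and Frobenius exponents of a semilinear group\<close>

locale semilinear_group = galois_field R p d + permutation_group "carrier R" H
  for R (structure) and p d and H +
  assumes H_GammaL1: "H \<subseteq> GammaL1 R"
begin

text \<open>The group \<open>H \<inter> GL1 R\<close> read as a subgroup of the multiplicative
  group, so that counting of roots applies to it.\<close>

definition scalars :: "'a set" where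
  "scalars = {a \<in> carrier R. a \<noteq> \<zero> \<and> semilin a 0 \<in> H}"

lemma obtain_semilin:
  assumes "h \<in> H"
  obtains a j where "a \<in> carrier R" "a \<noteq> \<zero>" "h = semilin a j"
  using assms H_GammaL1 unfolding GammaL1_eq by blast

lemma semilin_zero_id: "semilin \<one> 0 = (\<lambda>x\<in>carrier R. x)"
  unfolding semilin_def by (intro restrict_ext) simp

lemma one_scalars: "\<one> \<in> scalars"
  using id_mem by (simp add: scalars_def semilin_zero_id)

lemma semilin_mult_mem:
  assumes "\<tau> \<in> scalars" "a \<in> carrier R" "semilin a j \<in> H"
  shows "semilin (\<tau> \<otimes> a) j \<in> H"
  using compose_mem[of "semilin \<tau> 0" "semilin a j"] assms compose_semilin[of \<tau> a 0 j]
  by (simp add: scalars_def)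

text \<open>Two elements of \<open>H\<close> with the same Frobenius exponent differ by an element
  of exponent 0.\<close>

lemma semilin_div_mem:
  assumes a: "a \<in> carrier R" "a \<noteq> \<zero>" "semilin a j \<in> H" and b: "b \<in> carrier R" "b \<noteq> \<zero>" "semilin b j \<in> H"
  shows "b \<otimes> inv a \<in> scalars"
proof -
  note ia = unit_inv[OF a(1,2)]
  obtain h where h: "h \<in> H" "\<forall>x\<in>carrier R. semilin a j (h x) = x"
    using obtain_inverse[OF a(3)] by metis
  \<comment> \<open>The inverse \<open>h\<close> is never put into semilinear form: only the
    \<open>p ^ j\<close>-th power of \<open>h y\<close> enters, and that is
    \<open>inv a \<otimes> y\<close>.\<close>
  have "compose (carrier R) (semilin b j) h = semilin (b \<otimes> inv a) 0"
    unfolding compose_def semilin_def[of "b \<otimes> inv a"]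
  proof (rule restrict_ext)
    fix y assume y: "y \<in> carrier R"
    let ?x = "h y [^] (p ^ j)"
    have hy: "h y \<in> carrier R" using elem_closed[OF h(1) y] .
    have "a \<otimes> ?x = y" using h(2) y hy semilin_apply by metis
    then have "inv a \<otimes> y = (inv a \<otimes> a) \<otimes> ?x" using a(1) ia(1) hy m_assoc by (metis nat_pow_closed)
    then have "?x = inv a \<otimes> y" using ia hy by simp
    then show "semilin b j (h y) = b \<otimes> inv a \<otimes> y [^] p ^ 0"
      using hy y ia b a by (simp add: semilin_apply m_assoc)
  qed
  then have "semilin (b \<otimes> inv a) 0 \<in> H" using compose_mem[OF b(3) h(1)] by simp
  moreover have "b \<otimes> inv a \<noteq> \<zero>" using b ia integral by blast
  ultimately show ?thesis using b ia by (simp add: scalars_def)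
qed

lemma scalars_mult: "a \<in> scalars \<Longrightarrow> b \<in> scalars \<Longrightarrow> a \<otimes> b \<in> scalars"
  using semilin_mult_mem[of a b 0] integral by (auto simp: scalars_def)

lemma scalars_inv: "a \<in> scalars \<Longrightarrow> inv a \<in> scalars"
  using semilin_div_mem[of a 0 \<one>] one_scalars unit_inv[of a] by (auto simp: scalars_def)

lemma finite_scalars: "finite scalars"
  using finite_carrier by (simp add: scalars_def)

lemma card_scalars_pos: "card scalars > 0"
  using one_scalars finite_scalars card_gt_0_iff by blast

lemma scalars_pow_card: "a \<in> scalars \<Longrightarrow> a [^] card scalars = \<one>"
proof -
  assume a: "a \<in> scalars"
  have sub: "subgroup scalars (Multiplicative_Group.mult_of R)"
  proof (rule group.subgroupI[OF group_mult])
    show "scalars \<subseteq> carrier (Multiplicative_Group.mult_of R)" by (auto simp: scalars_def)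
    show "scalars \<noteq> {}" using one_scalars by blast
    show "inv\<^bsub>Multiplicative_Group.mult_of R\<^esub> x \<in> scalars" if "x \<in> scalars" for x
      using that scalars_inv[OF that] m_inv_mult_of[of x] by (simp add: scalars_def)
  qed (simp add: scalars_mult)
  then interpret S: group "(Multiplicative_Group.mult_of R)\<lparr>carrier := scalars\<rparr>"
    by (rule subgroup.subgroup_is_group[OF _ group_mult])
  have "a [^]\<^bsub>(Multiplicative_Group.mult_of R)\<lparr>carrier := scalars\<rparr>\<^esub> card scalars = \<one>"
    using S.pow_order_eq_1[of a] a by (simp add: order_def)
  then show ?thesis
    by (simp add: nat_pow_def)
qed

text \<open>A group of n scalars consists of n roots of X^n - 1, and there are no more. The scalars
  are therefore determined by their number.\<close>

lemma scalars_eq: "scalars = {x \<in> carrier R. x [^] card scalars = \<one>}"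
proof (rule card_seteq)
  show "finite {x \<in> carrier R. x [^] card scalars = \<one>}" using finite_carrier by simp
  show "scalars \<subseteq> {x \<in> carrier R. x [^] card scalars = \<one>}"
    using scalars_pow_card by (auto simp: scalars_def)
  show "card {x \<in> carrier R. x [^] card scalars = \<one>} \<le> card scalars"
    using num_roots_le_deg[OF finite_carrier, of "card scalars"] card_scalars_pos by simp
qed

lemma H_Int_GL1: "H \<inter> GL1 R = (\<lambda>a. semilin a 0) ` scalars"
  by (auto simp: GL1_eq scalars_def)

lemma card_H_Int_GL1: "card (H \<inter> GL1 R) = card scalars"
proof -
  have "inj_on (\<lambda>a. semilin a 0) scalars"
  proof (rule inj_onI)
    fix a b assume ab: "a \<in> scalars" "b \<in> scalars" "semilin a 0 = semilin b 0"
    have "a = semilin a 0 \<one>" using ab(1) by (simp add: semilin_one scalars_def)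
    also have "\<dots> = b" unfolding ab(3) using ab(2) by (simp add: semilin_one scalars_def)
    finally show "a = b" .
  qed
  then show ?thesis unfolding H_Int_GL1 by (rule card_image)
qed

text \<open>The exponents occurring in \<open>H\<close> are the multiples of a divisor
  \<open>m\<close> of \<open>d\<close>, and above each of the \<open>d div m\<close> exponents below
  \<open>d\<close> lies one coset of the scalars. Thus \<open>d div m\<close> is the order of the
  group of field automorphisms induced by \<open>H\<close>.\<close>

lemma frobenius_exponents:
  obtains m where "m > 0" "m dvd d" "card H = card scalars * (d div m)"
    "\<And>j. (\<exists>a\<in>carrier R. a \<noteq> \<zero> \<and> semilin a j \<in> H) \<longleftrightarrow> m dvd j"
proof -
  define J where "J = {j. \<exists>a\<in>carrier R. a \<noteq> \<zero> \<and> semilin a j \<in> H}"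
  have "0 \<in> J" using one_scalars unfolding J_def scalars_def by blast
  moreover have "i + j \<in> J" if ij: "i \<in> J" "j \<in> J" for i j
  proof -
    obtain a where a: "a \<in> carrier R" "a \<noteq> \<zero>" "semilin a i \<in> H" using ij(1) by (auto simp: J_def)
    obtain b where b: "b \<in> carrier R" "b \<noteq> \<zero>" "semilin b j \<in> H" using ij(2) by (auto simp: J_def)
    have "semilin (a \<otimes> b [^] (p ^ i)) (i + j) \<in> H"
      using compose_mem[OF a(3) b(3)] compose_semilin a b by simp
    moreover have "a \<otimes> b [^] (p ^ i) \<noteq> \<zero>" using a b pow_eq_zeroD by (metis integral nat_pow_closed)
    moreover have "a \<otimes> b [^] (p ^ i) \<in> carrier R" using a b by simp
    ultimately show ?thesis unfolding J_def by blast
  qed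
  moreover have "j + d \<in> J \<longleftrightarrow> j \<in> J" for j by (simp add: J_def semilin_period)
  ultimately obtain m where m: "m > 0" "m dvd d" "\<And>j. j \<in> J \<longleftrightarrow> m dvd j" "card (J \<inter> {..<d}) = d div m"
    using additive_periodic_set[OF d_pos, of J] by metis
  \<comment> \<open>\<open>c j\<close> is the coefficient of one chosen element of exponent
    \<open>j\<close>; multiplying it by the scalars gives all the others.\<close>
  define c where "c j = (SOME a. a \<in> carrier R \<and> a \<noteq> \<zero> \<and> semilin a j \<in> H)" for j
  have c: "c j \<in> carrier R" "c j \<noteq> \<zero>" "semilin (c j) j \<in> H" if "j \<in> J" for j
    using someI_ex[of "\<lambda>a. a \<in> carrier R \<and> a \<noteq> \<zero> \<and> semilin a j \<in> H"] that unfolding c_def J_def by blast+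
  define F where "F = (\<lambda>(j, \<tau>). semilin (\<tau> \<otimes> c j) j)"
  have "bij_betw F ((J \<inter> {..<d}) \<times> scalars) H"
    unfolding bij_betw_def
  proof
    show "inj_on F ((J \<inter> {..<d}) \<times> scalars)"
    proof (rule inj_onI, clarify)
      fix i a j b assume as: "a \<in> scalars" "b \<in> scalars" "i \<in> J" "i < d" "j \<in> J" "j < d" "F (i, a) = F (j, b)"
      have ab: "a \<in> carrier R" "b \<in> carrier R" "a \<noteq> \<zero>" using as by (auto simp: scalars_def)
      have "a \<otimes> c i \<noteq> \<zero>" using ab c[OF as(3)] integral by blast
      then have e: "a \<otimes> c i = b \<otimes> c j" "i = j"
        using as(7) semilin_eq_iff[of "a \<otimes> c i" "b \<otimes> c j" i j] ab c[OF as(3)] c[OF as(5)] as(4,6) by (auto simp: F_def)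
      then have "a = b" using m_rcancel[of "c j" a b] c[OF as(5)] ab by simp
      then show "i = j \<and> a = b" using e by simp
    qed
    show "F ` ((J \<inter> {..<d}) \<times> scalars) = H"
    proof
      show "F ` ((J \<inter> {..<d}) \<times> scalars) \<subseteq> H" using semilin_mult_mem c by (auto simp: F_def)
      show "H \<subseteq> F ` ((J \<inter> {..<d}) \<times> scalars)"
      proof
        fix h assume h: "h \<in> H"
        obtain a i where a: "a \<in> carrier R" "a \<noteq> \<zero>" "h = semilin a i" using obtain_semilin[OF h] .
        define j where "j = i mod d"
        have "semilin a i = semilin a (j + d * (i div d))" by (simp add: j_def)
        also have "\<dots> = semilin a j"
          unfolding semilin_def using frobenius_pow_period[of _ j "i div d"] by (intro restrict_ext) simp
        finally have hj: "h = semilin a j" using a(3) by simp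
        have j: "j \<in> J" "j < d" using h hj a d_pos unfolding J_def j_def by auto
        have ac: "a \<otimes> inv (c j) \<in> scalars"
          using semilin_div_mem[OF c[OF j(1)] a(1,2)] h hj by simp
        have "a \<otimes> inv (c j) \<otimes> c j = a"
          using unit_inv[OF c(1,2)[OF j(1)]] a c(1)[OF j(1)] by (simp add: m_assoc)
        then have "h = F (j, a \<otimes> inv (c j))" using hj by (simp add: F_def)
        then show "h \<in> F ` ((J \<inter> {..<d}) \<times> scalars)" using j ac by blast
      qed
    qed
  qed
  then have "card H = card ((J \<inter> {..<d}) \<times> scalars)" by (metis bij_betw_same_card)
  then have "card H = card scalars * (d div m)" using m(4) by (simp add: card_cartesian_product)
  then show thesis using that m(1-3) unfolding J_def by blast
qed

end

section \<open>The affine semilinear groups are extremely primitive\<close>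

lemma geometric_sum_nat:
  fixes q :: nat
  assumes "q \<ge> 1" shows "q ^ n = (q - 1) * (\<Sum>i<n. q ^ i) + 1"
proof (induction n)
  case (Suc n)
  obtain c where c: "q = Suc c" using assms by (cases q) auto
  have "q ^ Suc n = q ^ n + (q - 1) * q ^ n" by (simp add: c)
  then show ?case using Suc by (simp add: c algebra_simps)
qed simp

lemma geometric_sum_Suc:
  fixes q :: nat shows "(\<Sum>i<Suc n. q ^ i) = 1 + (\<Sum>i<n. q ^ i) * q"
proof (induction n)
  case (Suc n)
  have "(\<Sum>i<Suc (Suc n). q ^ i) = (\<Sum>i<Suc n. q ^ i) + q ^ Suc n" by simp
  also have "\<dots> = 1 + (\<Sum>i<n. q ^ i) * q + q ^ n * q" unfolding Suc by simp
  also have "\<dots> = 1 + (\<Sum>i<Suc n. q ^ i) * q" by (simp add: algebra_simps)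
  finally show ?case .
qed simp

section \<open>Orbits under the numerical conditions\<close>

context semilinear_group begin

text \<open>The n-fold iterate of \<open>semilin a m\<close>, whose coefficient is the product of
  the powers of \<open>a\<close> with exponents \<open>(p ^ m) ^ i\<close>. For
  \<open>n = d div m\<close> this is the norm of \<open>a\<close> to the subfield with
  \<open>p ^ m\<close> elements.\<close>

lemma semilin_pow_mem:
  assumes a: "a \<in> carrier R" "semilin a m \<in> H"
  shows "semilin (a [^] (\<Sum>i<n. (p ^ m) ^ i)) (m * n) \<in> H"
proof (induction n)
  case 0
  then show ?case using one_scalars by (simp add: scalars_def)
next
  case (Suc n)
  let ?s = "\<Sum>i<n. (p ^ m) ^ i"
  have "semilin (a \<otimes> (a [^] ?s) [^] (p ^ m)) (m + m * n) \<in> H"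
    using compose_mem[OF a(2) Suc] compose_semilin[OF a(1), of "a [^] ?s" m "m * n"] a(1) by simp
  moreover have "a \<otimes> (a [^] ?s) [^] (p ^ m) = a [^] (1 + ?s * p ^ m)"
    using a(1) nat_pow_mult[OF a(1), of 1 "?s * p ^ m"] by (simp add: nat_pow_pow)
  ultimately show ?case using geometric_sum_Suc[of "p ^ m" n] by simp
qed

lemma coprime_pow_eq_one:
  assumes x: "x \<in> carrier R" and e: "x [^] (m::nat) = \<one>" "x [^] (n::nat) = \<one>" "coprime m n" "m > 0"
  shows "x = \<one>"
proof -
  interpret M: group "Multiplicative_Group.mult_of R" by (rule group_mult)
  have x0: "x \<noteq> \<zero>" using e(1,4) nat_pow_zero[of m] by auto
  let ?o = "group.ord (Multiplicative_Group.mult_of R) x"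
  have "?o dvd m" "?o dvd n"
    using M.pow_eq_id[of x m] M.pow_eq_id[of x n] x x0 e by (simp_all add: Multiplicative_Group.nat_pow_mult_of)
  then have "?o = 1" using e(3) by (metis coprime_common_divisor nat_dvd_1_iff_1)
  then show ?thesis using M.ord_eq_1[of x] x x0 by simp
qed

text \<open>An invariant of \<open>H\<close>-orbits: it confines each nonzero orbit to a coset of
  the t-th roots of unity. Both the coefficient and the Frobenius part of \<open>h\<close> must
  disappear under the t-th power.\<close>

lemma orbit_pow_invariant:
  assumes t: "t = card scalars" and ppd: "primitive_prime_divisor t p d"
    and cH: "card H = t * e"
    and e: "e = 1 \<or> Factorial_Ring.prime e \<and> e dvd d \<and> t = (p ^ d - 1) div (p ^ (d div e) - 1)"
    and h: "h \<in> H" and v: "v \<in> carrier R" "v \<noteq> \<zero>"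
  shows "(h v) [^] t = v [^] t"
proof -
  have tp: "Factorial_Ring.prime t" using ppd by (simp add: primitive_prime_divisor_def)
  then have t0: "t > 0" using prime_gt_0_nat by blast
  obtain m where m: "m > 0" "m dvd d" "card H = card scalars * (d div m)"
    "\<And>j. (\<exists>a\<in>carrier R. a \<noteq> \<zero> \<and> semilin a j \<in> H) \<longleftrightarrow> m dvd j"
    using frobenius_exponents by metis
  \<comment> \<open>The order of \<open>H\<close> is \<open>t * e\<close> by hypothesis and
    \<open>t * (d div m)\<close> by the count of exponents.\<close>
  have edm: "e = d div m" using m(3) cH t t0 by simp
  then have dme: "d = m * e" using m(2) by simp
  obtain b j where b: "b \<in> carrier R" "b \<noteq> \<zero>" "h = semilin b j" using obtain_semilin[OF h] .
  have "m dvd j" using m(4)[of j] b h by blast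
  then obtain i where i: "j = m * i" by blast
  have "b [^] t = \<one> \<and> (v [^] (p ^ j)) [^] t = v [^] t"
  proof (cases "e = 1")
    case True
    then have "j = 0 + d * i" using i dme by simp
    then have fr: "x [^] (p ^ j) = x" if "x \<in> carrier R" for x
      using frobenius_pow_period[OF that, of 0 i] that by simp
    then have "semilin b j = semilin b 0" unfolding semilin_def by (intro restrict_ext) simp
    then have "b \<in> scalars" using b h by (simp add: scalars_def)
    then show ?thesis using scalars_pow_card[of b] t fr v by simp
  next
    case False
    then have ep: "Factorial_Ring.prime e" and te: "t = (p ^ d - 1) div (p ^ (d div e) - 1)" using e by auto
    have e1: "e > 1" using ep prime_gt_1_nat by blast
    have dm: "d div e = m" using dme e1 by simp
    define q where "q = p ^ m"
    have q: "q > 1" unfolding q_def by (rule one_less_power[OF p_gt_1 m(1)])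
    have pd: "p ^ d = q ^ e" by (simp add: q_def dme power_mult)
    have g: "p ^ d - 1 = (q - 1) * (\<Sum>i<e. q ^ i)" using geometric_sum_nat[of q e] q pd by simp
    then have ts: "t = (\<Sum>i<e. q ^ i)" using te dm q by (simp add: q_def)
    have tq: "p ^ d - 1 = t * (q - 1)" using g ts by simp
    obtain a where a: "a \<in> carrier R" "a \<noteq> \<zero>" "semilin a m \<in> H" using m(4)[of m] by auto
    \<comment> \<open>The e-fold iterate of \<open>semilin a m\<close>: the sum of powers of
      \<open>q\<close> is \<open>t\<close>, and the exponent \<open>m * e\<close> is
      \<open>d\<close>, which acts like 0.\<close>
    have "semilin (a [^] t) d \<in> H"
      using semilin_pow_mem[OF a(1,3), of e] ts by (simp add: q_def dme)
    then have "semilin (a [^] t) 0 \<in> H" using semilin_period[of "a [^] t" 0] by simp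
    moreover have "a [^] t \<noteq> \<zero>" using a pow_eq_zeroD by blast
    ultimately have "a [^] t \<in> scalars" using a by (simp add: scalars_def)
    then have at: "(a [^] t) [^] t = \<one>" using scalars_pow_card t by simp
    have "(a [^] t) [^] (q - 1) = \<one>"
      using pow_card_minus_one[OF a(1,2)] tq nat_pow_pow[OF a(1), of t "q - 1"] by simp
    \<comment> \<open>Here \<open>e > 1\<close> matters: it makes \<open>m\<close> smaller than
      \<open>d\<close>, so that a primitive prime divisor cannot divide
      \<open>p ^ m - 1\<close>.\<close>
    moreover have "coprime t (q - 1)"
    proof -
      have "m \<le> d - 1" using dme e1 m(1) by (metis One_nat_def Suc_leI d_pos diff_Suc_1 less_Suc_eq_le
            n_less_m_mult_n mult.commute Suc_pred)
      then have "\<not> t dvd q - 1" using ppd m(1) by (simp add: primitive_prime_divisor_def q_def)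
      then show ?thesis using tp prime_imp_coprime by blast
    qed
    ultimately have at1: "a [^] t = \<one>" using coprime_pow_eq_one[OF _ at] a t0 by simp
    \<comment> \<open>The coefficient of the i-th iterate of \<open>semilin a m\<close>. This
      iterate lies in \<open>H\<close> with the same exponent \<open>j\<close> as \<open>h\<close>,
      so \<open>b\<close> differs from \<open>?a\<close> by a scalar.\<close>
    let ?a = "a [^] (\<Sum>k<i. q ^ k)"
    have aH: "semilin ?a j \<in> H" using semilin_pow_mem[OF a(1,3), of i] by (simp add: i q_def)
    have a': "?a \<in> carrier R" "?a \<noteq> \<zero>" using a pow_eq_zeroD by auto
    have a't: "?a [^] t = \<one>"
    proof -
      have "?a [^] t = (a [^] t) [^] (\<Sum>k<i. q ^ k)" using a(1) by (simp add: nat_pow_pow mult.commute)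
      then show ?thesis using at1 by simp
    qed
    have "b \<otimes> inv ?a \<in> scalars" using semilin_div_mem[OF a' aH b(1,2)] b(3) h by simp
    then have "(b \<otimes> inv ?a) [^] t = \<one>" using scalars_pow_card t by simp
    moreover have "b = (b \<otimes> inv ?a) \<otimes> ?a" using b(1) unit_inv[OF a'] a'(1) by (simp add: m_assoc)
    ultimately have "b [^] t = \<one>"
      using a't b(1) unit_inv(1)[OF a'] a'(1) nat_pow_distrib[of "b \<otimes> inv ?a" ?a t] by simp
    moreover have "(v [^] (p ^ j)) [^] t = v [^] t"
    proof -
      have "p ^ j = (q - 1) * (\<Sum>k<i. q ^ k) + 1"
        using geometric_sum_nat[of q i] q by (simp add: i q_def power_mult)
      \<comment> \<open>Since \<open>t * (q - 1)\<close> is \<open>p ^ d - 1\<close>, the exponents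
        \<open>p ^ j * t\<close> and \<open>t\<close> agree modulo the order of the multiplicative
        group.\<close>
      then have "p ^ j * t = (t * (q - 1)) * (\<Sum>k<i. q ^ k) + t"
        by (simp only: distrib_left distrib_right mult_1 mult_1_right mult.commute mult.left_commute)
      then have "p ^ j * t = (p ^ d - 1) * (\<Sum>k<i. q ^ k) + t"
        unfolding tq .
      then have "(v [^] (p ^ j)) [^] t = v [^] ((p ^ d - 1) * (\<Sum>k<i. q ^ k) + t)"
        using v(1) by (simp add: nat_pow_pow)
      also have "\<dots> = (v [^] (p ^ d - 1)) [^] (\<Sum>k<i. q ^ k) \<otimes> v [^] t"
        using v(1) by (simp add: nat_pow_pow nat_pow_mult)
      also have "\<dots> = v [^] t" using pow_card_minus_one[OF v] v(1) by simp
      finally show ?thesis .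
    qed
    ultimately show ?thesis by simp
  qed
  moreover have "h v = b \<otimes> v [^] (p ^ j)" using b(3) v(1) semilin_apply by simp
  ultimately show ?thesis using b(1) v(1) by (simp add: nat_pow_distrib)
qed

end

lemma (in group) card_semidirect_product:
  assumes "semidirect_product G N K"
  shows "card (carrier G) = card N * card K"
proof -
  have N: "subgroup N G" and K: "subgroup K G" and NK: "N \<inter> K = {\<one>}" and prod: "N <#> K = carrier G"
    using assms normal_imp_subgroup by (auto simp: semidirect_product_def)
  interpret N: subgroup N G by fact
  interpret K: subgroup K G by fact
  have "bij_betw (\<lambda>(n, k). n \<otimes> k) (N \<times> K) (carrier G)"
    unfolding bij_betw_def
  proof
    show "inj_on (\<lambda>(n, k). n \<otimes> k) (N \<times> K)"
    proof (rule inj_onI, clarify)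
      fix n k n' k' assume as: "n \<in> N" "k \<in> K" "n' \<in> N" "k' \<in> K" "n \<otimes> k = n' \<otimes> k'"
      have c: "n \<in> carrier G" "k \<in> carrier G" "n' \<in> carrier G" "k' \<in> carrier G" using as by auto
      have "inv n' \<otimes> n = inv n' \<otimes> (n \<otimes> k) \<otimes> inv k" using c by (simp add: m_assoc)
      also have "\<dots> = inv n' \<otimes> (n' \<otimes> k') \<otimes> inv k" using as(5) by simp
      also have "\<dots> = k' \<otimes> inv k" using c by (simp add: m_assoc[symmetric])
      finally have e: "inv n' \<otimes> n = k' \<otimes> inv k" .
      have "inv n' \<otimes> n \<in> N" "k' \<otimes> inv k \<in> K" using as by auto
      then have "inv n' \<otimes> n = \<one>" "k' \<otimes> inv k = \<one>" using e NK by auto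
      then show "n = n' \<and> k = k'" using c by (metis inv_closed inv_equality inv_inv)
    qed
    show "(\<lambda>(n, k). n \<otimes> k) ` (N \<times> K) = carrier G"
      unfolding prod[symmetric] by (auto simp: set_mult_def)
  qed
  then show ?thesis by (metis bij_betw_same_card card_cartesian_product)
qed

lemma card_iso_integer_mod_group:
  assumes "A \<cong> integer_mod_group n" "n > 0"
  shows "card (carrier A) = n"
proof -
  obtain f where "f \<in> iso A (integer_mod_group n)" using assms(1) by (auto simp: is_iso_def)
  then have "bij_betw f (carrier A) (carrier (integer_mod_group n))" by (simp add: iso_def)
  then have "card (carrier A) = card (carrier (integer_mod_group n))" by (rule bij_betw_same_card)
  then show ?thesis using assms(2) by (simp add: carrier_integer_mod_group)
qed

text \<open>From the abstract shape of \<open>H\<close> the converse extracts its order; together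
  with the number of scalars this determines the field automorphisms in \<open>H\<close>.\<close>

lemma (in group) card_iso_cyclic_semidirect:
  assumes "iso_cyclic_semidirect G t e" "t > 0" "e > 0"
  shows "card (carrier G) = t * e"
proof -
  obtain N K where NK: "semidirect_product G N K"
    "G\<lparr>carrier := N\<rparr> \<cong> integer_mod_group t" "G\<lparr>carrier := K\<rparr> \<cong> integer_mod_group e"
    using assms(1) by (auto simp: iso_cyclic_semidirect_def)
  have "card N = t" using card_iso_integer_mod_group[OF NK(2) assms(2)] by simp
  moreover have "card K = e" using card_iso_integer_mod_group[OF NK(3) assms(3)] by simp
  ultimately show ?thesis using card_semidirect_product[OF NK(1)] by simp
qed


context galois_field begin

text \<open>Multiplication by scalars is semiregular on nonzero elements, so
  \<open>B - {\<zero>}\<close> is a disjoint union of cosets of the scalars.\<close>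

lemma additive_orbits_dvd:
  assumes T: "permutation_group (carrier R) H" "H \<subseteq> GammaL1 R"
    and B: "B \<subseteq> carrier R" "\<And>a x. a \<in> semilinear_group.scalars R p H \<Longrightarrow> x \<in> B \<Longrightarrow> a \<otimes> x \<in> B"
  shows "card (semilinear_group.scalars R p H) dvd card (B - {\<zero>})"
proof -
  interpret semilinear_group R p d H
    using T by (simp add: semilinear_group_def semilinear_group_axioms_def galois_field_axioms)
  define C where "C = (\<lambda>x. (\<lambda>a. a \<otimes> x) ` scalars) ` (B - {\<zero>})"
  have sc: "a \<in> carrier R" "a \<noteq> \<zero>" if "a \<in> scalars" for a using that by (auto simp: scalars_def)
  have fB: "finite B" using B(1) finite_carrier finite_subset by blast
  have un: "\<Union>C = B - {\<zero>}"
  proof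
    show "\<Union>C \<subseteq> B - {\<zero>}"
    proof
      fix y assume "y \<in> \<Union>C"
      then obtain x a where xa: "x \<in> B" "x \<noteq> \<zero>" "a \<in> scalars" "y = a \<otimes> x" by (auto simp: C_def)
      then have "y \<in> B" using B(2) by blast
      moreover have "y \<noteq> \<zero>" using xa sc[OF xa(3)] B(1) integral_iff by (simp add: subset_iff)
      ultimately show "y \<in> B - {\<zero>}" by simp
    qed
    show "B - {\<zero>} \<subseteq> \<Union>C"
    proof
      fix x assume x: "x \<in> B - {\<zero>}"
      have "x = \<one> \<otimes> x" using x B(1) by auto
      then have "x \<in> (\<lambda>a. a \<otimes> x) ` scalars" using one_scalars by (rule image_eqI)
      then show "x \<in> \<Union>C" unfolding C_def using x by blast
    qed
  qed
  have "card scalars * card C = card (\<Union>C)"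
  proof (rule card_partition)
    show "finite C" using fB by (simp add: C_def)
    show "finite (\<Union>C)" using un fB by simp
    show "card c = card scalars" if cC: "c \<in> C" for c
    proof -
      obtain x where x: "x \<in> B" "x \<noteq> \<zero>" "c = (\<lambda>a. a \<otimes> x) ` scalars" using cC by (auto simp: C_def)
      have xc: "x \<in> carrier R" using x B(1) by blast
      have "inj_on (\<lambda>a. a \<otimes> x) scalars"
        by (rule inj_onI) (use m_rcancel[of x] x(2) xc sc in auto)
      then show ?thesis using x(3) card_image by blast
    qed
    show "c \<inter> c' = {}" if cc: "c \<in> C" "c' \<in> C" "c \<noteq> c'" for c c'
    proof (rule ccontr)
      assume ne: "c \<inter> c' \<noteq> {}"
      obtain x where x: "x \<in> B" "x \<noteq> \<zero>" "c = (\<lambda>a. a \<otimes> x) ` scalars" using cc(1) by (auto simp: C_def)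
      obtain y where y: "y \<in> B" "y \<noteq> \<zero>" "c' = (\<lambda>a. a \<otimes> y) ` scalars" using cc(2) by (auto simp: C_def)
      have sub: "(\<lambda>a. a \<otimes> x) ` scalars \<subseteq> (\<lambda>a. a \<otimes> y) ` scalars"
        if xy: "x \<in> carrier R" "y \<in> carrier R" "a \<in> scalars" "b \<in> scalars" "a \<otimes> x = b \<otimes> y" for x y a b
      proof
        fix z assume "z \<in> (\<lambda>a. a \<otimes> x) ` scalars"
        then obtain k where k: "k \<in> scalars" "z = k \<otimes> x" by blast
        note ia = unit_inv[OF sc[OF xy(3)]]
        have "inv a \<otimes> (a \<otimes> x) = (inv a \<otimes> a) \<otimes> x" using m_assoc[OF ia(1) sc(1)[OF xy(3)] xy(1)] by simp
        then have "x = inv a \<otimes> (b \<otimes> y)" using ia(3) xy(1,5) by simp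
        then have "z = (k \<otimes> (inv a \<otimes> b)) \<otimes> y"
          using k xy ia sc by (simp add: m_assoc)
        moreover have "k \<otimes> (inv a \<otimes> b) \<in> scalars" using k xy scalars_mult scalars_inv by blast
        ultimately show "z \<in> (\<lambda>a. a \<otimes> y) ` scalars" by blast
      qed
      obtain a b where ab: "a \<in> scalars" "b \<in> scalars" "a \<otimes> x = b \<otimes> y" using ne x y by auto
      have c: "x \<in> carrier R" "y \<in> carrier R" using x y B(1) by auto
      have "c = c'" unfolding x(3) y(3)
        using sub[OF c ab] sub[OF c(2,1) ab(2,1) ab(3)[symmetric]] by (rule subset_antisym)
      then show False using cc(3) by simp
    qed
  qed
  then show ?thesis unfolding un by (metis dvd_triv_left)
qed

text \<open>Suborbits have prime size \<open>t\<close>, which leaves no proper blocks in them. A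
  block of \<open>G\<close> through zero is a subgroup of some order \<open>p ^ i\<close> closed
  under scalars, so \<open>t\<close> divides \<open>p ^ i - 1\<close>.\<close>

theorem affine_extremely_primitive:
  assumes G: "subgroup G (perm_group (carrier R) (AGammaL1 R))"
    and sd: "semidirect_product (perm_group (carrier R) G) (translation_group R) H"
    and H: "subgroup H (perm_group (carrier R) (GammaL1 R))"
    and iso: "iso_cyclic_semidirect (perm_group (carrier R) H) t e"
    and t: "t = card (H \<inter> GL1 R)" and ppd: "primitive_prime_divisor t p d"
    and e: "e = 1 \<or> Factorial_Ring.prime e \<and> e dvd d \<and> t = (p ^ d - 1) div (p ^ (d div e) - 1)"
  shows "extremely_primitive (carrier R) G"
proof -
  interpret A: permutation_group "carrier R" "AGammaL1 R" by (rule permutation_group_AGammaL1)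
  interpret GL: permutation_group "carrier R" "GammaL1 R" by (rule permutation_group_GammaL1)
  have GB: "subgroup G (BijGroup (carrier R))" "G \<subseteq> AGammaL1 R" using G A.subgroup_perm_group_iff by auto
  interpret G: permutation_group "carrier R" G by (rule permutation_group.intro[OF GB(1)])
  have HB: "subgroup H (BijGroup (carrier R))" "H \<subseteq> GammaL1 R" using H GL.subgroup_perm_group_iff by auto
  interpret H: permutation_group "carrier R" H by (rule permutation_group.intro[OF HB(1)])
  interpret H: semilinear_group R p d H
    using HB H.permutation_group_axioms by (simp add: semilinear_group_def semilinear_group_axioms_def galois_field_axioms)
  have ts: "t = card H.scalars" using t H.card_H_Int_GL1 by simp
  have tp: "Factorial_Ring.prime t" using ppd by (simp add: primitive_prime_divisor_def)
  have t0: "t > 0" using tp prime_gt_0_nat by blast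
  have e0: "e > 0" using e prime_gt_0_nat by auto
  have cH: "card H = t * e"
    using group.card_iso_cyclic_semidirect[OF H.group_perm_group iso t0 e0] by simp
  note inv = H.orbit_pow_invariant[OF ts ppd cH e]
  have trG: "transl b \<in> G" if "b \<in> carrier R" for b
  proof -
    have "translation_group R \<lhd> perm_group (carrier R) G" using sd by (simp only: semidirect_product_def)
    from subgroup.subset[OF normal_imp_subgroup[OF this]] have "translation_group R \<subseteq> G" by simp
    then show ?thesis using that translation_group_eq by blast
  qed
  have "subgroup H (perm_group (carrier R) G)" using sd by (simp only: semidirect_product_def)
  from subgroup.subset[OF this] have HG: "H \<subseteq> G" by simp
  have h0: "h \<zero> = \<zero>" if "h \<in> H" for h
    using that HB(2) by (auto simp: GammaL1_def stabilizer_def)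
  \<comment> \<open>Elements of \<open>H\<close> fix zero, so an element of \<open>G\<close> fixing
    zero has trivial translation part.\<close>
  have stab: "G.stab \<zero> = H"
  proof
    show "H \<subseteq> G.stab \<zero>" using HG h0 by auto
    show "G.stab \<zero> \<subseteq> H"
    proof
      fix g assume g: "g \<in> G.stab \<zero>"
      have "g \<in> translation_group R <#>\<^bsub>perm_group (carrier R) G\<^esub> H"
        using g sd by (simp add: semidirect_product_def)
      then obtain b h where bh: "b \<in> carrier R" "h \<in> H" "g = transl b \<otimes>\<^bsub>BijGroup (carrier R)\<^esub> h"
        unfolding set_mult_def translation_group_eq by auto
      then have gc: "g = compose (carrier R) (transl b) h"
        using G.mult_eq trG HG by (simp add: subset_iff)
      then have "g \<zero> = \<zero> \<oplus> b" using h0[OF bh(2)] by (simp add: compose_def transl_apply)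
      then have b0: "b = \<zero>" using g bh(1) by simp
      have "g = h"
      proof (rule G.elem_eqI)
        show "g \<in> G" "h \<in> G" using g bh HG by auto
        show "g x = h x" if "x \<in> carrier R" for x
          using that gc b0 H.elem_closed[OF bh(2) that] by (simp add: compose_def transl_apply)
      qed
      then show "g \<in> H" using bh by simp
    qed
  qed
  have quot: "w \<otimes> inv v \<in> H.scalars" "w = (w \<otimes> inv v) \<otimes> v"
    if v: "v \<in> carrier R" "v \<noteq> \<zero>" and w: "w \<in> {w \<in> carrier R. w [^] t = v [^] t}" for v w
  proof -
    note iv = unit_inv[OF v]
    have "(w \<otimes> inv v) [^] t = w [^] t \<otimes> inv v [^] t" using w iv(1) by (simp add: nat_pow_distrib)
    also have "\<dots> = (v \<otimes> inv v) [^] t" using w v(1) iv(1) by (simp only: nat_pow_distrib mem_Collect_eq)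
    also have "\<dots> = \<one>" using iv(4) by simp
    finally show "w \<otimes> inv v \<in> H.scalars" using w iv(1) H.scalars_eq ts by auto
    show "w = (w \<otimes> inv v) \<otimes> v" using v w iv by (simp add: m_assoc)
  qed
  have orbit: "{h v | h. h \<in> H} = {w \<in> carrier R. w [^] t = v [^] t}" if v: "v \<in> carrier R" "v \<noteq> \<zero>" for v
  proof
    show "{h v | h. h \<in> H} \<subseteq> {w \<in> carrier R. w [^] t = v [^] t}"
      using inv[OF _ v] H.elem_closed v by auto
    show "{w \<in> carrier R. w [^] t = v [^] t} \<subseteq> {h v | h. h \<in> H}"
    proof
      fix w assume w: "w \<in> {w \<in> carrier R. w [^] t = v [^] t}"
      then have "semilin (w \<otimes> inv v) 0 \<in> H" using quot[OF v] by (simp add: H.scalars_def)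
      moreover have "semilin (w \<otimes> inv v) 0 v = w"
        using v w quot(2)[OF v, of w] by (simp add: semilin_apply)
      ultimately show "w \<in> {h v | h. h \<in> H}" by (metis (mono_tags, lifting) mem_Collect_eq)
    qed
  qed
  have card_orbit: "card {h v | h. h \<in> H} = t" if v: "v \<in> carrier R" "v \<noteq> \<zero>" for v
  proof -
    have "bij_betw (\<lambda>a. a \<otimes> v) H.scalars {w \<in> carrier R. w [^] t = v [^] t}"
      unfolding bij_betw_def
    proof
      show "inj_on (\<lambda>a. a \<otimes> v) H.scalars"
        by (rule inj_onI) (use m_rcancel[of v] v in \<open>auto simp: H.scalars_def\<close>)
      show "(\<lambda>a. a \<otimes> v) ` H.scalars = {w \<in> carrier R. w [^] t = v [^] t}"
      proof
        show "(\<lambda>a. a \<otimes> v) ` H.scalars \<subseteq> {w \<in> carrier R. w [^] t = v [^] t}"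
        proof
          fix w assume "w \<in> (\<lambda>a. a \<otimes> v) ` H.scalars"
          then obtain a where a: "a \<in> H.scalars" "w = a \<otimes> v" by blast
          then show "w \<in> {w \<in> carrier R. w [^] t = v [^] t}"
            using H.scalars_pow_card[OF a(1)] v by (simp add: ts H.scalars_def nat_pow_distrib)
        qed
        show "{w \<in> carrier R. w [^] t = v [^] t} \<subseteq> (\<lambda>a. a \<otimes> v) ` H.scalars"
        proof
          fix w assume w: "w \<in> {w \<in> carrier R. w [^] t = v [^] t}"
          show "w \<in> (\<lambda>a. a \<otimes> v) ` H.scalars" using quot[OF v w] by (rule rev_image_eqI)
        qed
      qed
    qed
    then have "card H.scalars = card {w \<in> carrier R. w [^] t = v [^] t}" by (rule bij_betw_same_card)
    then show ?thesis unfolding orbit[OF v] by (simp only: ts[symmetric])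
  qed
  have blocks: "only_trivial_blocks G (carrier R)"
    unfolding only_trivial_blocks_def
  proof (intro allI impI, elim conjE)
    fix B assume B: "B \<noteq> {}" "B \<subseteq> carrier R" "\<forall>g\<in>G. g ` B = B \<or> g ` B \<inter> B = {}"
    obtain b where b: "b \<in> B" using B(1) by blast
    then have bc: "b \<in> carrier R" using B(2) by blast
    \<comment> \<open>The block is translated so that it passes through zero.\<close>
    define B0 where "B0 = {x \<in> carrier R. x \<oplus> b \<in> B}"
    have B0c: "B0 \<subseteq> carrier R" by (auto simp: B0_def)
    have z: "\<zero> \<in> B0" using b bc by (simp add: B0_def)
    have imB: "transl b ` B0 = B"
    proof
      show "transl b ` B0 \<subseteq> B" by (auto simp: B0_def transl_apply)
      show "B \<subseteq> transl b ` B0"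
      proof
        fix y assume y: "y \<in> B"
        then have yc: "y \<in> carrier R" using B(2) by blast
        then have "y \<ominus> b \<oplus> b = y" using bc by (simp add: a_minus_def a_assoc l_neg)
        then show "y \<in> transl b ` B0"
          using y yc bc by (intro image_eqI[of _ _ "y \<ominus> b"]) (auto simp: B0_def transl_apply)
      qed
    qed
    have injb: "inj_on (transl b) B0"
      using bij_betw_imp_inj_on[OF G.elem_bij_betw[OF trG[OF bc]]] B0c by (rule inj_on_subset)
    have gB0: "g x \<in> B0" if g: "g \<in> G" and g0: "g \<zero> \<in> B0" and x: "x \<in> B0" for g x
    proof -
      obtain k where k: "k \<in> G" "\<forall>x\<in>carrier R. k (transl b x) = x" using G.obtain_inverse[OF trG[OF bc]] by metis
      \<comment> \<open>\<open>u\<close> is \<open>g\<close> conjugated by the translation by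
        \<open>b\<close>, which converts the block property of \<open>B\<close> into one of
        \<open>B0\<close>: if \<open>g\<close> keeps zero in \<open>B0\<close>, it keeps all of
        \<open>B0\<close>.\<close>
      define u where "u = compose (carrier R) (transl b) (compose (carrier R) g k)"
      have uG: "u \<in> G" unfolding u_def using G.compose_mem trG bc g k(1) by blast
      have ub: "u (transl b y) = transl b (g y)" if "y \<in> carrier R" for y
        using that k(2) G.elem_closed[OF trG[OF bc] that] by (simp add: u_def compose_def)
      have "u (transl b \<zero>) \<in> u ` B" using z imB by blast
      moreover have "u (transl b \<zero>) \<in> B" unfolding ub[OF zero_closed] using g0 imB by blast
      ultimately have uB: "u ` B = B" using B(3) uG by blast
      have xc: "x \<in> carrier R" using x B0c by blast
      have "u (transl b x) \<in> B" using uB x imB by blast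
      then have "transl b (g x) \<in> B" using ub[OF xc] by simp
      then show ?thesis using G.elem_closed[OF g xc] by (simp add: B0_def transl_apply)
    qed
    have add: "x \<oplus> y \<in> B0" if xy: "x \<in> B0" "y \<in> B0" for x y
    proof -
      have c: "x \<in> carrier R" "y \<in> carrier R" using xy B0c by auto
      have "transl y x \<in> B0" using gB0[OF trG[OF c(2)] _ xy(1)] xy(2) c by (simp add: transl_apply)
      then show ?thesis using c by (simp add: transl_apply)
    qed
    have mlt: "a \<otimes> x \<in> B0" if ax: "a \<in> H.scalars" "x \<in> B0" for a x
    proof -
      have sH: "semilin a 0 \<in> H" using ax by (simp add: H.scalars_def)
      then have sG: "semilin a 0 \<in> G" using HG by blast
      have "semilin a 0 \<zero> \<in> B0" using h0[OF sH] z by simp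
      then have "semilin a 0 x \<in> B0" using gB0[OF sG _ ax(2)] by blast
      then show ?thesis using ax B0c by (simp add: semilin_apply subset_iff)
    qed
    have npow: "add_pow R (n::nat) x \<in> B0" if "x \<in> B0" for n x
      by (induction n) (use z add that B0c in \<open>auto simp: subset_iff\<close>)
    have minus: "\<ominus> x \<in> B0" if x: "x \<in> B0" for x
    proof -
      have xc: "x \<in> carrier R" using x B0c by blast
      \<comment> \<open>The negative of \<open>x\<close> is its (p - 1)-fold multiple, so closure
        under addition suffices.\<close>
      obtain c where c: "p = Suc c" using p_gt_1 by (cases p) auto
      have "add_pow R p x = add_pow R p \<one> \<otimes> x" using xc add_pow_ldistr[of \<one> x p] by simp
      then have "add_pow R c x \<oplus> x = \<zero>" using add_pow_p_one xc c by simp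
      then have "\<ominus> x = add_pow R c x" using xc by (metis add.nat_pow_closed minus_equality)
      then show ?thesis using npow[OF x] by simp
    qed
    have "subgroup B0 (add_monoid R)"
    proof (rule group.subgroupI[OF add.is_group])
      show "inv\<^bsub>add_monoid R\<^esub> x \<in> B0" if "x \<in> B0" for x using minus[OF that] by (simp add: a_inv_def)
    qed (use B0c z add in auto)
    from group.lagrange[OF add.is_group this]
    have "card (rcosets\<^bsub>add_monoid R\<^esub> B0) * card B0 = p ^ d" using card_R by (simp add: order_def)
    then have "card B0 dvd p ^ d" by (metis dvd_triv_right)
    then obtain i where i: "i \<le> d" "card B0 = p ^ i" using prime_p divides_primepow_nat by blast
    have cB: "card B = card B0" using card_image[OF injb] imB by simp
    have fB0: "finite B0" using B0c finite_carrier finite_subset by blast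
    \<comment> \<open>This rules out every \<open>i\<close> strictly between 0 and \<open>d\<close>;
      for \<open>i = 0\<close> the divisibility is vacuous and the block is a point.\<close>
    have "t dvd card (B0 - {\<zero>})"
      using additive_orbits_dvd[OF H.permutation_group_axioms HB(2) B0c mlt] ts by simp
    then have "t dvd p ^ i - 1" using i z fB0 by simp
    then have "\<not> (1 \<le> i \<and> i \<le> d - 1)" using ppd by (auto simp: primitive_prime_divisor_def)
    then have "i = 0 \<or> i = d" using i(1) by auto
    then show "(\<exists>x. B = {x}) \<or> B = carrier R"
    proof
      assume "i = 0"
      then have "card B = 1" using i cB by simp
      then show ?thesis by (metis card_1_singletonE)
    next
      assume "i = d"
      then have "card B = card (carrier R)" using i cB card_R by simp
      then show ?thesis using card_subset_eq[OF finite_carrier B(2)] by simp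
    qed
  qed
  show ?thesis
  proof (rule G.extremely_primitiveI[of \<zero>])
    show "\<exists>g\<in>G. g \<zero> = x" if "x \<in> carrier R" for x
      using trG[OF that] that by (intro bexI[of _ "transl x"]) (auto simp: transl_apply)
    show "only_trivial_blocks G (carrier R)" by (rule blocks)
    have "card H.scalars \<noteq> 1" using tp ts by auto
    then have "H.scalars \<noteq> {\<one>}" by auto
    then obtain a where a: "a \<in> H.scalars" "a \<noteq> \<one>" using H.one_scalars by blast
    then have "semilin a 0 \<in> H" "a \<in> carrier R" by (auto simp: H.scalars_def)
    moreover from this have "semilin a 0 \<noteq> (\<lambda>x\<in>carrier R. x)" using a(2) semilin_one[of a 0] by auto
    ultimately show "\<exists>g\<in>G.stab \<zero>. g \<noteq> (\<lambda>x\<in>carrier R. x)" unfolding stab by blast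
    fix v assume v: "v \<in> carrier R" "v \<noteq> \<zero>"
    show "only_trivial_blocks (G.stab \<zero>) {h v |h. h \<in> G.stab \<zero>}"
      unfolding stab
    proof (rule H.prime_card_only_trivial_blocks)
      show "Factorial_Ring.prime (card {h v |h. h \<in> H})" using card_orbit[OF v] tp by simp
      show "{h v |h. h \<in> H} \<subseteq> carrier R" using H.elem_closed v by auto
      show "g x \<in> {h v |h. h \<in> H}" if "g \<in> H" "x \<in> {h v |h. h \<in> H}" for g x
        by (rule bspec[OF bij_betwE[OF H.orbit_bij_betw[OF v(1) that(1)]] that(2)])
      show "\<exists>g\<in>H. g x = y" if "x \<in> {h v |h. h \<in> H}" "y \<in> {h v |h. h \<in> H}" for x y
        by (rule H.orbit_transitive[OF v(1) that])
    qed
  qed simp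
qed

end

section \<open>Semilinear groups whose orbits are the scalar orbits\<close>

text \<open>Letting \<open>f\<close> run over all naturals keeps the homomorphism law free of
  reductions; period \<open>n\<close> follows from the value at \<open>n\<close>.\<close>

lemma iso_integer_mod_groupI:
  fixes f :: "nat \<Rightarrow> 'b"
  assumes A: "group A" and n: "n > 0"
    and hom: "\<And>i j. f (i + j) = f i \<otimes>\<^bsub>A\<^esub> f j" and fn: "f n = \<one>\<^bsub>A\<^esub>"
    and bij: "bij_betw f {..<n} (carrier A)"
  shows "A \<cong> integer_mod_group n"
proof -
  interpret A: group A by fact
  have fc0: "f i \<in> carrier A" if "i < n" for i using bij that by (auto simp: bij_betw_def)
  have mult: "f (n * k) = \<one>\<^bsub>A\<^esub>" for k
  proof (induction k)
    case 0
    have "f 0 \<otimes>\<^bsub>A\<^esub> f 0 = f 0" using hom[of 0 0] by simp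
    then show ?case using fc0[OF n] A.l_cancel_one by simp
  next
    case (Suc k)
    then show ?case using hom[of n "n * k"] fn by simp
  qed
  have fmod: "f i = f (i mod n)" for i
    using hom[of "n * (i div n)" "i mod n"] mult fc0[of "i mod n"] n by simp
  define \<phi> where "\<phi> = (\<lambda>i::int. f (nat i))"
  have car: "carrier (integer_mod_group n) = {0..<int n}" using n by (simp add: carrier_integer_mod_group)
  have "\<phi> \<in> iso (integer_mod_group n) A"
    unfolding iso_def
  proof (intro CollectI conjI homI)
    show "\<phi> x \<in> carrier A" if "x \<in> carrier (integer_mod_group n)" for x
      using that fc0[of "nat x"] by (auto simp: car \<phi>_def)
    show "\<phi> (x \<otimes>\<^bsub>integer_mod_group n\<^esub> y) = \<phi> x \<otimes>\<^bsub>A\<^esub> \<phi> y"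
      if xy: "x \<in> carrier (integer_mod_group n)" "y \<in> carrier (integer_mod_group n)" for x y
    proof -
      have "nat ((x + y) mod int n) = (nat x + nat y) mod n"
        using xy by (simp add: car nat_mod_distrib nat_add_distrib)
      then have "\<phi> (x \<otimes>\<^bsub>integer_mod_group n\<^esub> y) = f ((nat x + nat y) mod n)" by (simp add: \<phi>_def)
      also have "\<dots> = f (nat x + nat y)" using fmod[of "nat x + nat y"] by simp
      finally show ?thesis by (simp add: hom \<phi>_def)
    qed
    have "bij_betw nat {0..<int n} {..<n}"
      by (rule bij_betwI[where g = int]) auto
    then have "bij_betw (f \<circ> nat) {0..<int n} (carrier A)" using bij by (rule bij_betw_trans)
    then show "bij_betw \<phi> (carrier (integer_mod_group n)) (carrier A)"
      unfolding car \<phi>_def comp_def .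
  qed
  then show ?thesis using group.iso_sym[OF group_integer_mod_group] is_isoI by blast
qed

lemma geometric_sum_gt_1:
  fixes q :: nat assumes "q \<ge> 1" "n \<ge> 2" shows "(\<Sum>i<n. q ^ i) > 1"
proof -
  obtain k where n: "n = Suc (Suc k)" using that[of "n - 2"] assms(2) by simp
  have "(\<Sum>i<Suc k. q ^ i) \<ge> 1" using geometric_sum_Suc[of q k] by simp
  then have "(\<Sum>i<Suc k. q ^ i) * q \<ge> 1" using mult_le_mono[OF _ assms(1), of 1] by simp
  then show ?thesis using geometric_sum_Suc[of q "Suc k"] by (simp add: n)
qed

text \<open>For n = a b the sum factors into the sum of the first a powers of q and the sum of the
  first b powers of q^a. The identity is obtained by multiplying with \<open>q - 1\<close> and
  cancelling; both factors exceed one when a and b do.\<close>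

lemma geometric_sum_prime_imp_prime_length:
  fixes q :: nat assumes q: "q > 1" and pr: "Factorial_Ring.prime (\<Sum>i<n. q ^ i)"
  shows "Factorial_Ring.prime n"
proof -
  have n1: "n > 1"
  proof (rule ccontr)
    assume "\<not> n > 1"
    then have "n = 0 \<or> n = 1" by auto
    then have "(\<Sum>i<n. q ^ i) \<le> 1" by auto
    then show False using prime_gt_1_nat[OF pr] by simp
  qed
  show ?thesis
  proof (rule ccontr)
    assume "\<not> Factorial_Ring.prime n"
    then obtain a where a: "a dvd n" "a \<noteq> 1" "a \<noteq> n" using n1 by (auto simp: prime_nat_iff)
    then obtain b where b: "n = a * b" by blast
    have a2: "a \<ge> 2" using a b n1 by (cases a; cases "a - 1") auto
    have b2: "b \<ge> 2" using a b n1 by (cases b; cases "b - 1") auto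
    have qa: "q ^ a \<ge> 1" using q by simp
    have "(q - 1) * (\<Sum>i<n. q ^ i) + 1 = q ^ n" using geometric_sum_nat[of q n] q by simp
    also have "\<dots> = (q ^ a - 1) * (\<Sum>i<b. (q ^ a) ^ i) + 1"
      using geometric_sum_nat[OF qa, of b] by (simp add: b power_mult)
    also have "q ^ a - 1 = (q - 1) * (\<Sum>i<a. q ^ i)" using geometric_sum_nat[of q a] q by simp
    finally have "(q - 1) * (\<Sum>i<n. q ^ i) = (q - 1) * ((\<Sum>i<a. q ^ i) * (\<Sum>i<b. (q ^ a) ^ i))"
      by (simp only: mult.assoc add_right_cancel)
    then have "(\<Sum>i<n. q ^ i) = (\<Sum>i<a. q ^ i) * (\<Sum>i<b. (q ^ a) ^ i)"
      using q by simp
    then have "(\<Sum>i<a. q ^ i) = 1 \<or> (\<Sum>i<b. (q ^ a) ^ i) = 1"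
      using pr prime_product by metis
    then show False using geometric_sum_gt_1[of q a] geometric_sum_gt_1[of "q ^ a" b] a2 b2 q qa by auto
  qed
qed

section \<open>Arithmetic and structure forced by scalar orbits\<close>

context semilinear_group begin

text \<open>The information available once the field is known: the scalars will come from
  \<open>M\<close>, which has the same orbits as \<open>H\<close> on nonzero vectors and is
  irreducible.\<close>

context
  assumes prime_card: "Factorial_Ring.prime (card scalars)"
    and orbits_scalar: "\<And>h v. h \<in> H \<Longrightarrow> v \<in> carrier R \<Longrightarrow> v \<noteq> \<zero> \<Longrightarrow> \<exists>a\<in>scalars. h v = a \<otimes> v"
    and irreducible: "\<And>W. W \<subseteq> carrier R \<Longrightarrow> \<zero> \<in> W \<Longrightarrow> W \<noteq> {\<zero>} \<Longrightarrow>
       (\<And>x y. x \<in> W \<Longrightarrow> y \<in> W \<Longrightarrow> x \<oplus> y \<in> W) \<Longrightarrow> (\<And>a x. a \<in> scalars \<Longrightarrow> x \<in> W \<Longrightarrow> a \<otimes> x \<in> W) \<Longrightarrow>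
       W = carrier R"
begin

lemma obtain_nontrivial_scalar:
  obtains a where "a \<in> scalars" "a \<noteq> \<one>"
proof -
  have "card scalars \<noteq> 1" using prime_card by auto
  then have "scalars \<noteq> {\<one>}" by auto
  then show thesis using that one_scalars by blast
qed

lemma scalars_carrier: "a \<in> scalars \<Longrightarrow> a \<in> carrier R" "a \<in> scalars \<Longrightarrow> a \<noteq> \<zero>"
  by (auto simp: scalars_def)

lemma card_scalars_dvd_iff:
  assumes "a \<in> scalars" "a \<noteq> \<one>" shows "a [^] (n::nat) = \<one> \<longleftrightarrow> card scalars dvd n"
proof
  assume "a [^] n = \<one>"
  then have "\<not> coprime (card scalars) n"
    using coprime_pow_eq_one[OF scalars_carrier(1)[OF assms(1)] scalars_pow_card[OF assms(1)], of n]
      card_scalars_pos assms(2) by blast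
  then show "card scalars dvd n" using prime_card prime_imp_coprime by blast
next
  assume "card scalars dvd n"
  then obtain k where "n = card scalars * k" by blast
  then show "a [^] n = \<one>"
    using scalars_pow_card[OF assms(1)] nat_pow_pow[OF scalars_carrier(1)[OF assms(1)], of "card scalars" k] by simp
qed

text \<open>If the number of scalars divided \<open>p ^ i - 1\<close>, all scalars would lie in the
  subfield fixed by the \<open>p ^ i\<close>-th power. That subfield is then closed under the
  scalars, hence everything, which forces \<open>d \<le> i\<close>.\<close>

lemma card_scalars_primitive: "primitive_prime_divisor (card scalars) p d"
  unfolding primitive_prime_divisor_def
proof (intro conjI allI impI notI)
  show "Factorial_Ring.prime (card scalars)" by (rule prime_card)
  obtain a where a: "a \<in> scalars" "a \<noteq> \<one>" by (rule obtain_nontrivial_scalar)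
  show "card scalars dvd p ^ d - 1"
    using card_scalars_dvd_iff[OF a] pow_card_minus_one[OF scalars_carrier(1,2)[OF a(1)]] by simp
  fix i assume i: "1 \<le> i \<and> i \<le> d - 1" and dv: "card scalars dvd p ^ i - 1"
  have pi: "Suc (p ^ i - 1) = p ^ i" using p_gt_1 by simp
  define W where "W = {x \<in> carrier R. x [^] (p ^ i) = x}"
  have fix_scalar: "a [^] (p ^ i) = a" if a: "a \<in> scalars" for a
  proof -
    have "a [^] (p ^ i - 1) = \<one>" using card_scalars_dvd_iff[OF a] dv by (cases "a = \<one>") auto
    then have "a [^] (Suc (p ^ i - 1)) = a" using scalars_carrier(1)[OF a] by simp
    then show ?thesis unfolding pi .
  qed
  have "W = carrier R"
  proof (rule irreducible)
    show "W \<subseteq> carrier R" by (auto simp: W_def)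
    show "\<zero> \<in> W" using p_gt_1 nat_pow_zero[of "p ^ i"] by (simp add: W_def)
    have "\<one> \<in> W" by (simp add: W_def)
    then show "W \<noteq> {\<zero>}" by auto
    show "x \<oplus> y \<in> W" if "x \<in> W" "y \<in> W" for x y using that by (simp add: W_def frobenius_pow_add)
    show "b \<otimes> x \<in> W" if "b \<in> scalars" "x \<in> W" for b x
      using that fix_scalar[OF that(1)] scalars_carrier(1)[OF that(1)] by (simp add: W_def nat_pow_distrib)
  qed
  then have "d \<le> i" using frobenius_pow_id_imp_ge[of i] i unfolding W_def by auto
  then show False using i d_pos by simp
qed

text \<open>The coefficient is the image of one, hence itself a scalar. Dividing by it leaves a pure
  field automorphism in \<open>H\<close>, which is what makes the extension split.\<close>

lemma semilin_scalar:
  assumes "a \<in> carrier R" "a \<noteq> \<zero>" "semilin a j \<in> H"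
  shows "a \<in> scalars" "semilin \<one> j \<in> H"
proof -
  obtain b where b: "b \<in> scalars" "semilin a j \<one> = b \<otimes> \<one>" using orbits_scalar[OF assms(3), of \<one>] by auto
  then show a: "a \<in> scalars" using semilin_one[OF assms(1)] scalars_carrier(1) by simp
  show "semilin \<one> j \<in> H"
    using semilin_mult_mem[OF scalars_inv[OF a] assms(1,3)] unit_inv(3)[OF assms(1,2)] by simp
qed

lemma GL1_part_iso: "BijGroup (carrier R)\<lparr>carrier := H \<inter> GL1 R\<rparr> \<cong> integer_mod_group (card scalars)"
  and GL1_part_normal: "H \<inter> GL1 R \<lhd> perm_group (carrier R) H"
proof -
  let ?N = "H \<inter> GL1 R"
  have N: "permutation_group (carrier R) ?N"
  proof (rule permutation_groupI)
    show "?N \<subseteq> Bij (carrier R)" using elem_Bij by blast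
    show "(\<lambda>x\<in>carrier R. x) \<in> ?N"
      unfolding H_Int_GL1 semilin_zero_id[symmetric] using one_scalars by blast
    show "compose (carrier R) g h \<in> ?N" if gh: "g \<in> ?N" "h \<in> ?N" for g h
    proof -
      obtain a b where ab: "a \<in> scalars" "b \<in> scalars" "g = semilin a 0" "h = semilin b 0"
        using gh unfolding H_Int_GL1 by blast
      then have "compose (carrier R) g h = semilin (a \<otimes> b) 0"
        using compose_semilin[of a b 0 0] scalars_carrier(1) by simp
      then show ?thesis unfolding H_Int_GL1 using scalars_mult[OF ab(1,2)] by blast
    qed
    show "\<exists>h\<in>?N. \<forall>x\<in>carrier R. h (g x) = x" if gN: "g \<in> ?N" for g
    proof -
      obtain a where a: "a \<in> scalars" "g = semilin a 0" using gN unfolding H_Int_GL1 by blast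
      note c = scalars_carrier[OF a(1)]
      have "semilin (inv a) 0 (g x) = x" if "x \<in> carrier R" for x
      proof -
        have "inv a \<otimes> (a \<otimes> x) = (inv a \<otimes> a) \<otimes> x" using m_assoc[OF unit_inv(1)[OF c] c(1) that] by simp
        then show ?thesis using that c a(2) unit_inv[OF c] by (simp add: semilin_apply)
      qed
      moreover have "semilin (inv a) 0 \<in> ?N" unfolding H_Int_GL1 using scalars_inv[OF a(1)] by blast
      ultimately show ?thesis by blast
    qed
  qed
  interpret N: permutation_group "carrier R" ?N by (rule N)
  show "?N \<lhd> perm_group (carrier R) H"
    unfolding normal_perm_group_iff
  proof (intro conjI ballI)
    show "subgroup ?N (BijGroup (carrier R))" by (rule N.subgroup_Bij)
    show "?N \<subseteq> H" by blast
    fix g n assume g: "g \<in> H" and n: "n \<in> ?N"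
    obtain a where a: "a \<in> scalars" "n = semilin a 0" using n unfolding H_Int_GL1 by blast
    obtain b j where b: "b \<in> carrier R" "b \<noteq> \<zero>" "g = semilin b j" using obtain_semilin[OF g] .
    have pw: "a [^] (k::nat) \<in> scalars" for k
      by (induction k) (use one_scalars a scalars_mult in auto)
    note ac = scalars_carrier(1)[OF a(1)]
    \<comment> \<open>Conjugation by an element of exponent \<open>j\<close> raises a scalar to its
      \<open>p ^ j\<close>-th power.\<close>
    have "g (n x) = semilin (a [^] (p ^ j)) 0 (g x)" if "x \<in> carrier R" for x
      using that a(2) b ac by (simp add: semilin_apply nat_pow_distrib m_lcomm)
    then show "\<exists>n'\<in>?N. \<forall>x\<in>carrier R. g (n x) = n' (g x)"
      unfolding H_Int_GL1 using pw[of "p ^ j"] by blast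
  qed
  \<comment> \<open>The scalars have prime order, so any nontrivial one generates them.\<close>
  obtain a where a: "a \<in> scalars" "a \<noteq> \<one>" by (rule obtain_nontrivial_scalar)
  note ac = scalars_carrier[OF a(1)]
  have pw: "a [^] (k::nat) \<in> scalars" for k
    by (induction k) (use one_scalars a scalars_mult in auto)
  define f where "f k = semilin (a [^] (k::nat)) 0" for k
  have fN: "f k \<in> ?N" for k unfolding H_Int_GL1 f_def using pw by blast
  show "BijGroup (carrier R)\<lparr>carrier := ?N\<rparr> \<cong> integer_mod_group (card scalars)"
  proof (rule iso_integer_mod_groupI[where f = f])
    show "group (perm_group (carrier R) ?N)" by (rule N.group_perm_group)
    show "card scalars > 0" by (rule card_scalars_pos)
    show "f (i + j) = f i \<otimes>\<^bsub>perm_group (carrier R) ?N\<^esub> f j" for i j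
      using N.mult_eq[OF fN fN] compose_semilin[of "a [^] i" "a [^] j" 0 0] ac
      by (simp add: f_def nat_pow_mult)
    show "f (card scalars) = \<one>\<^bsub>perm_group (carrier R) ?N\<^esub>"
      using scalars_pow_card[OF a(1)] by (simp add: f_def semilin_zero_id one_BijGroup)
    have inj: "inj_on f {..<card scalars}"
    proof (rule linorder_inj_onI)
      fix i j :: nat assume ij: "i < j" "i \<in> {..<card scalars}" "j \<in> {..<card scalars}"
      show "f i \<noteq> f j"
      proof
        assume "f i = f j"
        then have "a [^] i = a [^] j" using semilin_one[of "a [^] i" 0] semilin_one[of "a [^] j" 0] ac by (metis f_def nat_pow_closed)
        also have "\<dots> = a [^] (j - i) \<otimes> a [^] i" using ij(1) ac nat_pow_mult[OF ac(1), of "j - i" i] by simp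
        finally have "\<one> \<otimes> a [^] i = a [^] (j - i) \<otimes> a [^] i" using ac by simp
        moreover have "a [^] i \<noteq> \<zero>" using ac pow_eq_zeroD by blast
        ultimately have "a [^] (j - i) = \<one>" using m_rcancel[of "a [^] i" \<one> "a [^] (j - i)"] ac by simp
        then have "card scalars dvd j - i" using card_scalars_dvd_iff[OF a] by simp
        then show False using ij by (auto dest: dvd_imp_le)
      qed
    qed auto
    moreover have "f ` {..<card scalars} = ?N"
    proof (rule card_subset_eq)
      show "finite ?N" using finite_scalars H_Int_GL1 by simp
      show "f ` {..<card scalars} \<subseteq> ?N" using fN by blast
      show "card (f ` {..<card scalars}) = card ?N" using card_image[OF inj] card_H_Int_GL1 by simp
    qed
    ultimately show "bij_betw f {..<card scalars} (carrier (perm_group (carrier R) ?N))"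
      by (simp add: bij_betw_def)
  qed
qed

text \<open>The complement to the scalars is the stabiliser of one, consisting of the pure Frobenius
  maps in \<open>H\<close>; it is cyclic, generated by the \<open>p ^ m\<close>-th power
  map.\<close>

theorem semilinear_group_structure:
  "\<exists>e. iso_cyclic_semidirect (perm_group (carrier R) H) (card scalars) e \<and>
     (e = 1 \<or> Factorial_Ring.prime e \<and> e dvd d \<and> card scalars = (p ^ d - 1) div (p ^ (d div e) - 1))"
proof -
  obtain m where m: "m > 0" "m dvd d" "card H = card scalars * (d div m)"
    "\<And>j. (\<exists>a\<in>carrier R. a \<noteq> \<zero> \<and> semilin a j \<in> H) \<longleftrightarrow> m dvd j"
    using frobenius_exponents by metis
  have m1: "semilin \<one> j \<in> H \<longleftrightarrow> m dvd j" for j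
  proof
    assume "semilin \<one> j \<in> H"
    then show "m dvd j" using m(4)[of j] one_closed zero_not_one by metis
  next
    assume "m dvd j"
    then obtain a where "a \<in> carrier R" "a \<noteq> \<zero>" "semilin a j \<in> H" using m(4)[of j] by auto
    then show "semilin \<one> j \<in> H" by (rule semilin_scalar(2))
  qed
  define e where "e = d div m"
  have dme: "d = m * e" using m(2) by (simp add: e_def)
  have e0: "e > 0" using dme d_pos by (cases e) auto
  let ?N = "H \<inter> GL1 R" and ?K = "stab \<one>"
  interpret K: permutation_group "carrier R" ?K by (rule permutation_group_stab) simp
  have Kmem: "h \<in> ?K \<longleftrightarrow> (\<exists>i. h = semilin \<one> (m * i))" for h
  proof
    assume h: "h \<in> ?K"
    obtain b j where b: "b \<in> carrier R" "b \<noteq> \<zero>" "h = semilin b j" using obtain_semilin[of h] h by auto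
    then have "b = \<one>" using h semilin_one[OF b(1)] by auto
    then have "m dvd j" using m1[of j] b h by simp
    then show "\<exists>i. h = semilin \<one> (m * i)" using b \<open>b = \<one>\<close> by blast
  next
    assume "\<exists>i. h = semilin \<one> (m * i)"
    then show "h \<in> ?K" using m1 semilin_one[OF one_closed] by auto
  qed
  have "iso_cyclic_semidirect (perm_group (carrier R) H) (card scalars) e"
    unfolding iso_cyclic_semidirect_def
  proof (intro exI conjI)
    show "semidirect_product (perm_group (carrier R) H) ?N ?K"
      unfolding semidirect_product_def
    proof (intro conjI)
      show "?N \<lhd> perm_group (carrier R) H" by (rule GL1_part_normal)
      show "subgroup ?K (perm_group (carrier R) H)"
        unfolding subgroup_perm_group_iff using K.subgroup_Bij by blast
      show "?N \<inter> ?K = {\<one>\<^bsub>perm_group (carrier R) H\<^esub>}"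
      proof
        show "?N \<inter> ?K \<subseteq> {\<one>\<^bsub>perm_group (carrier R) H\<^esub>}"
        proof
          fix h assume h: "h \<in> ?N \<inter> ?K"
          then have "h \<in> (\<lambda>a. semilin a 0) ` scalars" using H_Int_GL1 by blast
          then obtain a where a: "a \<in> scalars" "h = semilin a 0" by blast
          then have "a = \<one>" using h semilin_one[OF scalars_carrier(1)[OF a(1)]] by auto
          then show "h \<in> {\<one>\<^bsub>perm_group (carrier R) H\<^esub>}" using a by (simp add: semilin_zero_id one_BijGroup)
        qed
        have "(\<lambda>x\<in>carrier R. x) \<in> ?N"
          unfolding H_Int_GL1 semilin_zero_id[symmetric] using one_scalars by blast
        then show "{\<one>\<^bsub>perm_group (carrier R) H\<^esub>} \<subseteq> ?N \<inter> ?K" using K.id_mem by (simp add: one_BijGroup)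
      qed
      show "?N <#>\<^bsub>perm_group (carrier R) H\<^esub> ?K = carrier (perm_group (carrier R) H)"
      proof
        show "?N <#>\<^bsub>perm_group (carrier R) H\<^esub> ?K \<subseteq> carrier (perm_group (carrier R) H)"
          using compose_mem mult_eq by (auto simp: set_mult_def)
        show "carrier (perm_group (carrier R) H) \<subseteq> ?N <#>\<^bsub>perm_group (carrier R) H\<^esub> ?K"
        proof
          fix h assume "h \<in> carrier (perm_group (carrier R) H)"
          then have h: "h \<in> H" by simp
          obtain a j where a: "a \<in> carrier R" "a \<noteq> \<zero>" "h = semilin a j" using obtain_semilin[OF h] .
          have s: "a \<in> scalars" "semilin \<one> j \<in> H" using semilin_scalar[OF a(1,2)] a(3) h by auto
          have nN: "semilin a 0 \<in> ?N" unfolding H_Int_GL1 using s by blast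
          have kK: "semilin \<one> j \<in> ?K" using s semilin_one[OF one_closed] by simp
          have "semilin a 0 \<otimes>\<^bsub>perm_group (carrier R) H\<^esub> semilin \<one> j = h"
            using mult_eq[of "semilin a 0" "semilin \<one> j"] nN s compose_semilin[of a \<one> 0 j] a by simp
          then show "h \<in> ?N <#>\<^bsub>perm_group (carrier R) H\<^esub> ?K" unfolding set_mult_def using nN kK by blast
        qed
      qed
    qed
    show "perm_group (carrier R) H\<lparr>carrier := ?N\<rparr> \<cong> integer_mod_group (card scalars)"
      using GL1_part_iso by simp
    define f where "f i = semilin \<one> (m * i)" for i
    have fK: "f i \<in> ?K" for i using Kmem f_def by blast
    have "perm_group (carrier R) ?K \<cong> integer_mod_group e"
    proof (rule iso_integer_mod_groupI[where f = f])
      show "group (perm_group (carrier R) ?K)" by (rule K.group_perm_group)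
      show "e > 0" by (rule e0)
      show "f (i + j) = f i \<otimes>\<^bsub>perm_group (carrier R) ?K\<^esub> f j" for i j
        using K.mult_eq[OF fK fK] compose_semilin[of \<one> \<one> "m * i" "m * j"]
        by (simp add: f_def distrib_left)
      show "f e = \<one>\<^bsub>perm_group (carrier R) ?K\<^esub>"
        using semilin_period[of \<one> 0] by (simp add: f_def dme[symmetric] semilin_zero_id one_BijGroup)
      show "bij_betw f {..<e} (carrier (perm_group (carrier R) ?K))"
        unfolding bij_betw_def
      proof
        show "inj_on f {..<e}"
        proof (rule inj_onI)
          fix i j assume ij: "i \<in> {..<e}" "j \<in> {..<e}" "f i = f j"
          have "m * i < d" "m * j < d" using ij m(1) by (auto simp: dme)
          then have "m * i = m * j"
            using semilin_eq_iff[of \<one> \<one> "m * i" "m * j"] ij(3) by (simp add: f_def)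
          then show "i = j" using m(1) by simp
        qed
        show "f ` {..<e} = carrier (perm_group (carrier R) ?K)"
        proof
          show "f ` {..<e} \<subseteq> carrier (perm_group (carrier R) ?K)" using fK by auto
          show "carrier (perm_group (carrier R) ?K) \<subseteq> f ` {..<e}"
          proof
            fix h assume "h \<in> carrier (perm_group (carrier R) ?K)"
            then have "h \<in> ?K" by simp
            then obtain i where i: "h = semilin \<one> (m * i)" using Kmem by blast
            have "m * i = m * (i mod e + e * (i div e))" by simp
            also have "\<dots> = m * (i mod e) + d * (i div e)" by (simp only: distrib_left dme mult.assoc)
            finally have "h = semilin \<one> (m * (i mod e) + d * (i div e))" using i by simp
            also have "\<dots> = semilin \<one> (m * (i mod e))"
              unfolding semilin_def using frobenius_pow_period[of _ "m * (i mod e)" "i div e"]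
              by (intro restrict_ext) simp
            finally show "h \<in> f ` {..<e}" using e0 by (auto simp: f_def)
          qed
        qed
      qed
    qed
    then show "perm_group (carrier R) H\<lparr>carrier := ?K\<rparr> \<cong> integer_mod_group e" by simp
  qed
  moreover have "Factorial_Ring.prime e \<and> e dvd d \<and> card scalars = (p ^ d - 1) div (p ^ (d div e) - 1)" if e1: "e \<noteq> 1"
  proof -
    have e2: "e \<ge> 2" using e0 e1 by simp
    have dm: "d div e = m" using dme e0 by simp
    define q where "q = p ^ m"
    have q: "q > 1" unfolding q_def by (rule one_less_power[OF p_gt_1 m(1)])
    have pd: "p ^ d = q ^ e" by (simp add: q_def dme power_mult)
    have g: "p ^ d - 1 = (q - 1) * (\<Sum>i<e. q ^ i)" using geometric_sum_nat[of q e] q pd by simp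
    obtain \<gamma> where \<gamma>: "\<gamma> \<in> carrier R" "\<gamma> \<noteq> \<zero>" "\<And>i. \<gamma> [^] i = \<one> \<longleftrightarrow> (p ^ d - 1) dvd i"
      using obtain_mult_generator by metis
    have mH: "semilin \<one> m \<in> H" using m1 by simp
    obtain c where c: "c \<in> scalars" "semilin \<one> m \<gamma> = c \<otimes> \<gamma>" using orbits_scalar[OF mH \<gamma>(1,2)] by blast
    have qq: "Suc (q - 1) = q" using q by simp
    have "\<gamma> [^] q = c \<otimes> \<gamma>" using c(2) \<gamma>(1) by (simp add: semilin_apply q_def)
    then have "\<gamma> [^] (Suc (q - 1)) = c \<otimes> \<gamma>" unfolding qq .
    then have "\<gamma> [^] (q - 1) = c"
      using m_rcancel[of \<gamma> "\<gamma> [^] (q - 1)" c] \<gamma>(1,2) scalars_carrier(1)[OF c(1)] by simp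
    then have "(\<gamma> [^] (q - 1)) [^] card scalars = \<one>" using scalars_pow_card[OF c(1)] by simp
    then have "\<gamma> [^] ((q - 1) * card scalars) = \<one>" using \<gamma>(1) by (simp add: nat_pow_pow)
    \<comment> \<open>The order of \<gamma> is \<open>p ^ d - 1\<close>, written as
      \<open>q - 1\<close> times the sum. After cancelling, the sum divides a prime and is not one,
      so it equals that prime.\<close>
    then have "(q - 1) * (\<Sum>i<e. q ^ i) dvd (q - 1) * card scalars" using \<gamma>(3) g by metis
    then have "(\<Sum>i<e. q ^ i) dvd card scalars" using q by simp
    moreover have "(\<Sum>i<e. q ^ i) \<noteq> 1" using geometric_sum_gt_1[of q e] q e2 by simp
    ultimately have s: "card scalars = (\<Sum>i<e. q ^ i)" using prime_card by (metis prime_nat_iff)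
    then have "Factorial_Ring.prime e"
      using geometric_sum_prime_imp_prime_length[OF q, of e] prime_card by simp
    moreover have "card scalars = (p ^ d - 1) div (p ^ (d div e) - 1)"
      unfolding g s dm using q by (simp add: q_def)
    moreover have "e dvd d" using dme by simp
    ultimately show ?thesis by blast
  qed
  ultimately show ?thesis by blast
qed

end

end

section \<open>Soluble primitive groups are affine\<close>

context permutation_group begin

lemma nat_pow_apply:
  assumes "g \<in> G" "x \<in> \<Omega>"
  shows "g [^]\<^bsub>perm_group \<Omega> G\<^esub> (k::nat) \<in> G" "(g [^]\<^bsub>perm_group \<Omega> G\<^esub> k) x = (g ^^ k) x"
proof -
  interpret P: group "perm_group \<Omega> G" by (rule group_perm_group)
  show pow: "g [^]\<^bsub>perm_group \<Omega> G\<^esub> k \<in> G" for k :: nat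
    using P.nat_pow_closed[of g k] assms(1) by simp
  show "(g [^]\<^bsub>perm_group \<Omega> G\<^esub> k) x = (g ^^ k) x"
    using assms(2)
  proof (induction k arbitrary: x)
    case 0
    then show ?case by (simp add: one_BijGroup)
  next
    case (Suc k)
    have "(g [^]\<^bsub>perm_group \<Omega> G\<^esub> Suc k) x = compose \<Omega> (g [^]\<^bsub>perm_group \<Omega> G\<^esub> k) g x"
      using mult_eq[OF pow assms(1)] by simp
    also have "\<dots> = (g ^^ k) (g x)"
      using Suc.IH[OF elem_closed[OF assms(1) Suc.prems]] Suc.prems by (simp add: compose_def)
    finally show ?case by (simp add: funpow_swap1)
  qed
qed

text \<open>All properties are stated at points of \<Omega>. The lemma is applied to
  \<open>G\<close> for the translations and to a point stabiliser for \<open>M\<close>.\<close>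

lemma obtain_elementary_abelian_normal:
  assumes fin: "finite \<Omega>" and sol: "solvable (perm_group \<Omega> G)" and nontriv: "g \<in> G" "g \<noteq> (\<lambda>x\<in>\<Omega>. x)"
  obtains N r where "permutation_group \<Omega> N" "N \<subseteq> G" "\<exists>n\<in>N. n \<noteq> (\<lambda>x\<in>\<Omega>. x)" "Factorial_Ring.prime (r::nat)"
    "\<forall>g\<in>G. \<forall>n\<in>N. \<exists>n'\<in>N. \<forall>x\<in>\<Omega>. g (n x) = n' (g x)"
    "\<forall>m\<in>N. \<forall>n\<in>N. \<forall>x\<in>\<Omega>. m (n x) = n (m x)" "\<forall>n\<in>N. \<forall>x\<in>\<Omega>. (n ^^ r) x = x"
proof -
  interpret P: group "perm_group \<Omega> G" by (rule group_perm_group)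
  have "finite (carrier (perm_group \<Omega> G))" using finite_elems[OF fin] by simp
  moreover have "carrier (perm_group \<Omega> G) \<noteq> {\<one>\<^bsub>perm_group \<Omega> G\<^esub>}" using nontriv by (auto simp: one_BijGroup)
  ultimately obtain N r where N: "N \<lhd> perm_group \<Omega> G" "N \<noteq> {\<one>\<^bsub>perm_group \<Omega> G\<^esub>}" "Factorial_Ring.prime (r::nat)"
    "\<forall>x\<in>N. \<forall>y\<in>N. x \<otimes>\<^bsub>perm_group \<Omega> G\<^esub> y = y \<otimes>\<^bsub>perm_group \<Omega> G\<^esub> x"
    "\<forall>x\<in>N. x [^]\<^bsub>perm_group \<Omega> G\<^esub> r = \<one>\<^bsub>perm_group \<Omega> G\<^esub>"
    using P.solvable_obtain_elementary_abelian_normal[OF _ sol] by metis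
  have sub: "subgroup N (BijGroup \<Omega>)" and NG: "N \<subseteq> G"
    and nrm: "\<forall>g\<in>G. \<forall>n\<in>N. \<exists>n'\<in>N. \<forall>x\<in>\<Omega>. g (n x) = n' (g x)"
    using N(1) unfolding normal_perm_group_iff by auto
  interpret N: permutation_group \<Omega> N by (rule permutation_group.intro[OF sub])
  show thesis
  proof (rule that[OF N.permutation_group_axioms NG _ N(3) nrm])
    show "\<exists>n\<in>N. n \<noteq> (\<lambda>x\<in>\<Omega>. x)" using N(2) N.id_mem by (auto simp: one_BijGroup)
    show "\<forall>m\<in>N. \<forall>n\<in>N. \<forall>x\<in>\<Omega>. m (n x) = n (m x)"
    proof (intro ballI)
      fix m n x assume as: "m \<in> N" "n \<in> N" "x \<in> \<Omega>"
      have "compose \<Omega> m n = compose \<Omega> n m" using N(4) as N.mult_eq by simp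
      from fun_cong[OF this, of x] show "m (n x) = n (m x)" using as(3) by (simp add: compose_def)
    qed
    show "\<forall>n\<in>N. \<forall>x\<in>\<Omega>. (n ^^ r) x = x"
    proof (intro ballI)
      fix n x assume as: "n \<in> N" "x \<in> \<Omega>"
      have "(n ^^ r) x = (n [^]\<^bsub>perm_group \<Omega> G\<^esub> r) x" using nat_pow_apply(2)[of n x r] as NG by auto
      then show "(n ^^ r) x = x" using N(5) as by (simp add: one_BijGroup)
    qed
  qed
qed

lemma solvable_stab:
  assumes "\<alpha> \<in> \<Omega>" "solvable (perm_group \<Omega> G)"
  shows "solvable (perm_group \<Omega> (stab \<alpha>))"
proof (rule group_hom.inj_hom_imp_solvable[OF _ _ assms(2)])
  interpret S: permutation_group \<Omega> "stab \<alpha>" by (rule permutation_group_stab[OF assms(1)])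
  show "group_hom (perm_group \<Omega> (stab \<alpha>)) (perm_group \<Omega> G) (\<lambda>g. g)"
    using S.group_perm_group group_perm_group
    by (auto simp: group_hom_def group_hom_axioms_def hom_def)
  show "inj_on (\<lambda>g. g) (carrier (perm_group \<Omega> (stab \<alpha>)))" by (rule inj_on_id2)
qed

text \<open>Orbits of a normal subgroup are blocks. The set \<Delta> is kept general, since the
  lemma is applied to \<open>N\<close> on all points and to \<open>M\<close> on the suborbits of the
  stabiliser.\<close>

lemma normal_orbit_cases:
  assumes N: "permutation_group \<Omega> N" "N \<subseteq> G" "\<forall>g\<in>G. \<forall>n\<in>N. \<exists>n'\<in>N. \<forall>x\<in>\<Omega>. g (n x) = n' (g x)"
    and \<Delta>: "\<Delta> \<subseteq> \<Omega>" "\<And>g y. g \<in> G \<Longrightarrow> y \<in> \<Delta> \<Longrightarrow> g y \<in> \<Delta>" "only_trivial_blocks G \<Delta>" and x: "x \<in> \<Delta>"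
  shows "{n x | n. n \<in> N} = {x} \<or> {n x | n. n \<in> N} = \<Delta>"
proof -
  interpret N: permutation_group \<Omega> N by fact
  let ?B = "{n x | n. n \<in> N}"
  have x\<Omega>: "x \<in> \<Omega>" using x \<Delta>(1) by blast
  have xB: "x \<in> ?B" using N.id_mem x\<Omega> by (intro CollectI exI[of _ "\<lambda>x\<in>\<Omega>. x"]) simp
  have sub: "?B \<subseteq> \<Delta>" using \<Delta>(2)[OF _ x] N(2) by auto
  have blk: "g ` ?B = ?B \<or> g ` ?B \<inter> ?B = {}" if g: "g \<in> G" for g
  proof (rule disjCI)
    assume "g ` ?B \<inter> ?B \<noteq> {}"
    then obtain n k where nk: "n \<in> N" "k \<in> N" "g (n x) = k x" by blast
    have "g (m x) \<in> ?B" if m: "m \<in> N" for m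
    proof -
      \<comment> \<open>Write m = (m n^-1) n; normality moves \<open>g\<close> past the first
        factor, and g n x is already the known point k x.\<close>
      obtain n' where n': "n' \<in> N" "\<forall>y\<in>\<Omega>. n' (n y) = y" using N.obtain_inverse[OF nk(1)] by metis
      have "compose \<Omega> m n' \<in> N" by (rule N.compose_mem[OF m n'(1)])
      then obtain l where l: "l \<in> N" "\<forall>y\<in>\<Omega>. g (compose \<Omega> m n' y) = l (g y)" using N(3) g by blast
      have nx: "n x \<in> \<Omega>" by (rule N.elem_closed[OF nk(1) x\<Omega>])
      have "g (m x) = g (compose \<Omega> m n' (n x))" using n'(2) x\<Omega> nx by (simp add: compose_def)
      also have "\<dots> = l (k x)" using l(2) nx nk(3) by simp
      also have "\<dots> = compose \<Omega> l k x" using x\<Omega> by (simp add: compose_def)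
      finally show ?thesis using N.compose_mem[OF l(1) nk(2)] by blast
    qed
    then have le: "g ` ?B \<subseteq> ?B" by blast
    \<comment> \<open>No finiteness is assumed here, so the reverse inclusion repeats the argument
      with the inverse of \<open>g\<close> instead of counting.\<close>
    obtain g' where g': "g' \<in> G" "\<forall>y\<in>\<Omega>. g' (g y) = y" "\<forall>y\<in>\<Omega>. g (g' y) = y" using obtain_inverse[OF g] by metis
    have "y \<in> g ` ?B" if yB: "y \<in> ?B" for y
    proof -
      obtain m where m: "m \<in> N" "y = m x" using yB by blast
      obtain n' where n': "n' \<in> N" "\<forall>y\<in>\<Omega>. n' (k y) = y" using N.obtain_inverse[OF nk(2)] by metis
      obtain l where l: "l \<in> N" "\<forall>y\<in>\<Omega>. g' (compose \<Omega> m n' y) = l (g' y)"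
        using N(3) g'(1) N.compose_mem[OF m(1) n'(1)] by blast
      have kx: "k x \<in> \<Omega>" by (rule N.elem_closed[OF nk(2) x\<Omega>])
      have nx: "n x \<in> \<Omega>" by (rule N.elem_closed[OF nk(1) x\<Omega>])
      have y\<Omega>: "y \<in> \<Omega>" using N.elem_closed[OF m(1) x\<Omega>] m(2) by simp
      have "g' y = g' (compose \<Omega> m n' (k x))" using n'(2) x\<Omega> kx m(2) by (simp add: compose_def)
      also have "\<dots> = l (g' (k x))" using l(2) kx by simp
      also have "g' (k x) = n x" using g'(2) nk(3) nx by force
      also have "l (n x) = compose \<Omega> l n x" using x\<Omega> by (simp add: compose_def)
      finally have "g' y \<in> ?B" using N.compose_mem[OF l(1) nk(1)] by blast
      moreover have "y = g (g' y)" using g'(3) y\<Omega> by simp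
      ultimately show ?thesis by (rule rev_image_eqI)
    qed
    then show "g ` ?B = ?B" using le by blast
  qed
  have "?B \<noteq> {}" using xB by blast
  then have "(\<exists>y. ?B = {y}) \<or> ?B = \<Delta>"
    using \<Delta>(3)[unfolded only_trivial_blocks_def, rule_format, of ?B] blk sub by blast
  moreover have "?B = {x}" if y: "?B = {y}" for y
  proof -
    have "x = y" using xB unfolding y by simp
    then show ?thesis using y by (simp only:)
  qed
  ultimately show ?thesis by blast
qed

end

text \<open>An abelian transitive \<open>N\<close> is regular. With \<open>z\<close> as origin, each
  point corresponds to the element of \<open>N\<close> taking \<open>z\<close> to it, and the group
  structure of \<open>N\<close> becomes the addition of points.\<close>

locale affine_action = permutation_group \<Omega> G for \<Omega> :: "'a set" and G +
  fixes z :: 'a and N :: "('a \<Rightarrow> 'a) set" and p :: nat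
  assumes fin: "finite \<Omega>" and z: "z \<in> \<Omega>"
    and N_pg: "permutation_group \<Omega> N" and N_G: "N \<subseteq> G" and prime_p: "Factorial_Ring.prime p"
    and N_normal: "\<forall>g\<in>G. \<forall>n\<in>N. \<exists>n'\<in>N. \<forall>x\<in>\<Omega>. g (n x) = n' (g x)"
    and N_comm: "\<forall>m\<in>N. \<forall>n\<in>N. \<forall>x\<in>\<Omega>. m (n x) = n (m x)"
    and N_exp: "\<forall>n\<in>N. \<forall>x\<in>\<Omega>. (n ^^ p) x = x"
    and N_trans: "\<And>x. x \<in> \<Omega> \<Longrightarrow> \<exists>n\<in>N. n z = x"
begin

sublocale N: permutation_group \<Omega> N by (rule N_pg)

text \<open>Every point is k z for some \<open>k\<close> in \<open>N\<close>, and \<open>k\<close>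
  commutes with both maps, so agreement at \<open>z\<close> spreads to all points.\<close>

lemma N_eqI:
  assumes "m \<in> N" "n \<in> N" "m z = n z" shows "m = n"
proof (rule N.elem_eqI[OF assms(1,2)])
  fix x assume "x \<in> \<Omega>"
  then obtain k where k: "k \<in> N" "k z = x" using N_trans by blast
  have "m (k z) = k (m z)" "n (k z) = k (n z)" using N_comm assms k(1) z by blast+
  then show "m x = n x" using k(2) assms(3) by simp
qed

definition tau :: "'a \<Rightarrow> 'a \<Rightarrow> 'a" where "tau x = (SOME n. n \<in> N \<and> n z = x)"

lemma tau: assumes "x \<in> \<Omega>" shows "tau x \<in> N" "tau x z = x"
  using someI_ex[of "\<lambda>n. n \<in> N \<and> n z = x"] N_trans[OF assms] unfolding tau_def by blast+

lemma tau_eqI: "n \<in> N \<Longrightarrow> n z = x \<Longrightarrow> x \<in> \<Omega> \<Longrightarrow> tau x = n"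
  using N_eqI tau by metis

definition plus :: "'a \<Rightarrow> 'a \<Rightarrow> 'a" (infixl "\<boxplus>" 65) where "x \<boxplus> y = tau x y"

lemma plus_closed: "x \<in> \<Omega> \<Longrightarrow> y \<in> \<Omega> \<Longrightarrow> x \<boxplus> y \<in> \<Omega>"
  unfolding plus_def using tau(1) N.elem_closed by blast

lemma plus_comm: assumes "x \<in> \<Omega>" "y \<in> \<Omega>" shows "x \<boxplus> y = y \<boxplus> x"
proof -
  have "tau x (tau y z) = tau y (tau x z)" using N_comm tau(1)[OF assms(1)] tau(1)[OF assms(2)] z by blast
  then show ?thesis using tau(2) assms by (simp add: plus_def)
qed

lemma tau_plus: assumes "x \<in> \<Omega>" "y \<in> \<Omega>" shows "tau (x \<boxplus> y) = compose \<Omega> (tau x) (tau y)"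
proof (rule tau_eqI)
  show "compose \<Omega> (tau x) (tau y) \<in> N" using N.compose_mem tau(1) assms by blast
  show "compose \<Omega> (tau x) (tau y) z = x \<boxplus> y" using z tau(2)[OF assms(2)] by (simp add: compose_def plus_def)
qed (use plus_closed assms in blast)

lemma plus_assoc: "x \<in> \<Omega> \<Longrightarrow> y \<in> \<Omega> \<Longrightarrow> w \<in> \<Omega> \<Longrightarrow> (x \<boxplus> y) \<boxplus> w = x \<boxplus> (y \<boxplus> w)"
  using tau_plus[of x y] by (simp add: plus_def compose_def)

lemma zero_plus: "x \<in> \<Omega> \<Longrightarrow> z \<boxplus> x = x"
proof -
  assume x: "x \<in> \<Omega>"
  have "tau z = (\<lambda>x\<in>\<Omega>. x)" using tau_eqI[OF N.id_mem _ z] z by simp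
  then show ?thesis using x by (simp add: plus_def)
qed

lemma plus_zero: "x \<in> \<Omega> \<Longrightarrow> x \<boxplus> z = x"
  using plus_comm zero_plus z by simp

lemma plus_inverse: assumes "x \<in> \<Omega>" shows "\<exists>y\<in>\<Omega>. y \<boxplus> x = z"
proof -
  obtain n where n: "n \<in> N" "\<forall>y\<in>\<Omega>. n (tau x y) = y" using N.obtain_inverse[OF tau(1)[OF assms]] by metis
  have nz: "n z \<in> \<Omega>" by (rule N.elem_closed[OF n(1) z])
  have "tau (n z) = n" by (rule tau_eqI[OF n(1) refl nz])
  moreover have "n x = z" using n(2) z tau(2)[OF assms] by force
  ultimately have "n z \<boxplus> x = z" by (simp only: plus_def)
  then show ?thesis using nz by blast
qed

abbreviation H where "H \<equiv> stab z"

sublocale H: permutation_group \<Omega> H by (rule permutation_group_stab[OF z])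

text \<open>Conjugating \<open>tau x\<close> by \<open>h\<close> gives an element of
  \<open>N\<close> taking \<open>z\<close> to \<open>h x\<close>, that is
  \<open>tau (h x)\<close>.\<close>

lemma H_plus:
  assumes h: "h \<in> H" and xy: "x \<in> \<Omega>" "y \<in> \<Omega>" shows "h (x \<boxplus> y) = h x \<boxplus> h y"
proof -
  obtain n where n: "n \<in> N" "\<forall>w\<in>\<Omega>. h (tau x w) = n (h w)" using N_normal h tau(1)[OF xy(1)] by blast
  have "n z = h x" using n(2) z tau(2)[OF xy(1)] h by force
  then have "tau (h x) = n" using tau_eqI n(1) H.elem_closed[OF h xy(1)] by blast
  then show ?thesis using n(2) xy(2) by (simp add: plus_def)
qed

lemma multiples_mem:
  assumes W: "z \<in> W" "W \<subseteq> \<Omega>" "\<And>x y. x \<in> W \<Longrightarrow> y \<in> W \<Longrightarrow> x \<boxplus> y \<in> W" and x: "x \<in> W"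
  shows "(tau x ^^ k) z \<in> W"
  by (induction k) (use W x in \<open>auto simp: plus_def\<close>)

text \<open>Because \<open>N\<close> has exponent \<open>p\<close>, the (p - 1)-fold multiple is the
  negative; sets that contain \<open>z\<close> and are closed under addition are subgroups.\<close>

lemma opposite_mem:
  assumes W: "z \<in> W" "W \<subseteq> \<Omega>" "\<And>x y. x \<in> W \<Longrightarrow> y \<in> W \<Longrightarrow> x \<boxplus> y \<in> W" and x: "x \<in> W"
  obtains y where "y \<in> W" "x \<boxplus> y = z"
proof (rule that)
  show "(tau x ^^ (p - 1)) z \<in> W" by (rule multiples_mem[OF W x])
  have "Suc (p - 1) = p" using prime_gt_0_nat[OF prime_p] by simp
  then have "x \<boxplus> (tau x ^^ (p - 1)) z = (tau x ^^ p) z" unfolding plus_def by (metis funpow.simps(2) comp_apply)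
  also have "\<dots> = z" using N_exp tau(1)[of x] x W(2) z by blast
  finally show "x \<boxplus> (tau x ^^ (p - 1)) z = z" .
qed

lemma decompose:
  assumes g: "g \<in> G" obtains h where "h \<in> H" "\<forall>x\<in>\<Omega>. g x = g z \<boxplus> h x"
proof -
  have gz: "g z \<in> \<Omega>" by (rule elem_closed[OF g z])
  obtain n where n: "n \<in> N" "\<forall>y\<in>\<Omega>. n (tau (g z) y) = y" "\<forall>y\<in>\<Omega>. tau (g z) (n y) = y"
    using N.obtain_inverse[OF tau(1)[OF gz]] by metis
  have hG: "compose \<Omega> n g \<in> G" using compose_mem g n(1) N_G by blast
  have "compose \<Omega> n g z = z" using n(2) z tau(2)[OF gz] by (force simp: compose_def)
  moreover have "\<forall>x\<in>\<Omega>. g x = g z \<boxplus> compose \<Omega> n g x"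
    using n(3) elem_closed[OF g] by (simp add: plus_def compose_def)
  ultimately show thesis using that[of "compose \<Omega> n g"] hG by blast
qed

text \<open>An \<open>H\<close>-invariant subgroup is a block of \<open>G\<close>: if
  \<open>w\<close> and \<open>g w\<close> lie in it, subtracting the linear part \<open>h w\<close>
  shows that \<open>g z\<close> does, and then \<open>g\<close> preserves it.\<close>

lemma invariant_subgroup_trivial:
  assumes prim: "only_trivial_blocks G \<Omega>"
    and W: "z \<in> W" "W \<subseteq> \<Omega>" "\<And>x y. x \<in> W \<Longrightarrow> y \<in> W \<Longrightarrow> x \<boxplus> y \<in> W"
    and inv: "\<And>h x. h \<in> H \<Longrightarrow> x \<in> W \<Longrightarrow> h x \<in> W"
  shows "W = {z} \<or> W = \<Omega>"
proof -
  have blk: "g ` W = W \<or> g ` W \<inter> W = {}" if g: "g \<in> G" for g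
  proof (rule disjCI)
    assume "g ` W \<inter> W \<noteq> {}"
    then obtain w where w: "w \<in> W" "g w \<in> W" by blast
    obtain h where h: "h \<in> H" "\<forall>x\<in>\<Omega>. g x = g z \<boxplus> h x" using decompose[OF g] .
    have gz: "g z \<in> \<Omega>" by (rule elem_closed[OF g z])
    have hw: "h w \<in> W" by (rule inv[OF h(1) w(1)])
    obtain y where y: "y \<in> W" "h w \<boxplus> y = z" using opposite_mem[OF W hw] .
    have c: "h w \<in> \<Omega>" "y \<in> \<Omega>" "w \<in> \<Omega>" using hw y w W(2) by auto
    have "g w \<boxplus> y = g z \<boxplus> (h w \<boxplus> y)" using h(2) c plus_assoc[OF gz c(1,2)] by simp
    then have "g w \<boxplus> y = g z" using y(2) plus_zero gz by simp
    then have gzW: "g z \<in> W" using W(3)[OF w(2) y(1)] by simp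
    have le: "g ` W \<subseteq> W"
    proof
      fix v assume "v \<in> g ` W"
      then obtain y where y: "y \<in> W" "v = g y" by blast
      then have "v = g z \<boxplus> h y" using h(2) W(2) by blast
      then show "v \<in> W" using W(3)[OF gzW inv[OF h(1) y(1)]] by simp
    qed
    have "inj_on g W" by (rule inj_on_subset[OF bij_betw_imp_inj_on[OF elem_bij_betw[OF g]] W(2)])
    then have "card (g ` W) = card W" by (rule card_image)
    then show "g ` W = W" using card_subset_eq[OF finite_subset[OF W(2) fin] le] by simp
  qed
  have "W \<noteq> {}" using W(1) by blast
  then have "(\<exists>y. W = {y}) \<or> W = \<Omega>"
    using prim[unfolded only_trivial_blocks_def, rule_format, of W] blk W(2) by blast
  then show ?thesis using W(1) by blast
qed

end

section \<open>The field of an irreducible abelian normal subgroup of the stabiliser\<close>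

text \<open>The nonzero vector \<open>u\<close> is arbitrary; it will be the one of the field, as
  \<open>z\<close> is its zero.\<close>

locale irreducible_pair = affine_action \<Omega> G z N p for \<Omega> :: "'a set" and G and z and N and p +
  fixes M :: "('a \<Rightarrow> 'a) set" and u :: 'a
  assumes u: "u \<in> \<Omega>" "u \<noteq> z" and M_pg: "permutation_group \<Omega> M" and M_H: "M \<subseteq> H"
    and M_normal: "\<forall>h\<in>H. \<forall>m\<in>M. \<exists>m'\<in>M. \<forall>x\<in>\<Omega>. h (m x) = m' (h x)"
    and M_comm: "\<forall>m\<in>M. \<forall>n\<in>M. \<forall>x\<in>\<Omega>. m (n x) = n (m x)"
    and M_irreducible: "\<And>W. W \<subseteq> \<Omega> \<Longrightarrow> z \<in> W \<Longrightarrow> W \<noteq> {z} \<Longrightarrow>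
      (\<And>x y. x \<in> W \<Longrightarrow> y \<in> W \<Longrightarrow> x \<boxplus> y \<in> W) \<Longrightarrow> (\<And>m x. m \<in> M \<Longrightarrow> x \<in> W \<Longrightarrow> m x \<in> W) \<Longrightarrow> W = \<Omega>"
begin

sublocale M: permutation_group \<Omega> M by (rule M_pg)

text \<open>Nothing is demanded outside \<Omega>, so sums and compositions need no restriction; in
  return, endomorphisms are compared only at points of \<Omega>.\<close>

definition additive :: "('a \<Rightarrow> 'a) \<Rightarrow> bool" where
  "additive f \<longleftrightarrow> (\<forall>x\<in>\<Omega>. f x \<in> \<Omega>) \<and> (\<forall>x\<in>\<Omega>. \<forall>y\<in>\<Omega>. f (x \<boxplus> y) = f x \<boxplus> f y)"

definition centralizing :: "('a \<Rightarrow> 'a) \<Rightarrow> bool" where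
  "centralizing f \<longleftrightarrow> additive f \<and> (\<forall>m\<in>M. \<forall>x\<in>\<Omega>. f (m x) = m (f x))"

text \<open>The double centralizer of \<open>M\<close> is commutative because \<open>M\<close> is, and irreducibility of \<open>M\<close> makes it act
  regularly on the nonzero vectors; it is the field.\<close>

definition bicentralizing :: "('a \<Rightarrow> 'a) \<Rightarrow> bool" where
  "bicentralizing f \<longleftrightarrow> additive f \<and> (\<forall>c. centralizing c \<longrightarrow> (\<forall>x\<in>\<Omega>. f (c x) = c (f x)))"

lemma additive_closed: "additive f \<Longrightarrow> x \<in> \<Omega> \<Longrightarrow> f x \<in> \<Omega>"
  by (simp add: additive_def)

lemma additive_plus: "additive f \<Longrightarrow> x \<in> \<Omega> \<Longrightarrow> y \<in> \<Omega> \<Longrightarrow> f (x \<boxplus> y) = f x \<boxplus> f y"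
  by (simp add: additive_def)

lemma H_additive: "h \<in> H \<Longrightarrow> additive h"
  unfolding additive_def by (intro conjI ballI) (rule H.elem_closed H_plus; assumption)+

lemma M_centralizing: "m \<in> M \<Longrightarrow> centralizing m"
  unfolding centralizing_def using H_additive[of m] M_H M_comm by (simp add: subset_iff)

lemma bicentralizing_imp_centralizing: "bicentralizing f \<Longrightarrow> centralizing f"
  unfolding bicentralizing_def centralizing_def[of f] using M_centralizing by simp

lemma M_bicentralizing: "m \<in> M \<Longrightarrow> bicentralizing m"
  unfolding bicentralizing_def centralizing_def using H_additive[of m] M_H by (simp add: subset_iff)

lemma bicentralizing_additive: "bicentralizing f \<Longrightarrow> additive f"
  by (simp add: bicentralizing_def)

lemma bicentralizing_commute:
  "bicentralizing f \<Longrightarrow> bicentralizing g \<Longrightarrow> x \<in> \<Omega> \<Longrightarrow> f (g x) = g (f x)"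
  unfolding bicentralizing_def[of f] by (simp add: bicentralizing_imp_centralizing)

lemma additive_zero: assumes "additive f" shows "f z = z"
proof -
  have fz: "f z \<in> \<Omega>" by (rule additive_closed[OF assms z])
  have e: "f z \<boxplus> f z = f z" using additive_plus[OF assms z z] zero_plus[OF z] by simp
  obtain y where y: "y \<in> \<Omega>" "y \<boxplus> f z = z" using plus_inverse[OF fz] by blast
  have "y \<boxplus> (f z \<boxplus> f z) = z \<boxplus> f z" using plus_assoc[OF y(1) fz fz] y(2) by simp
  then show ?thesis using e y(2) zero_plus[OF fz] by simp
qed

lemma bicentralizing_comp:
  assumes f: "bicentralizing f" and g: "bicentralizing g"
  shows "bicentralizing (\<lambda>x. f (g x))"
  unfolding bicentralizing_def
proof (intro conjI allI impI ballI)
  note af = bicentralizing_additive[OF f] and ag = bicentralizing_additive[OF g]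
  show "additive (\<lambda>x. f (g x))" using af ag unfolding additive_def by simp
  fix c x assume c: "centralizing c" and x: "x \<in> \<Omega>"
  have "g (c x) = c (g x)" using g c x by (simp add: bicentralizing_def)
  moreover have "f (c (g x)) = c (f (g x))" using f c additive_closed[OF ag x] by (simp add: bicentralizing_def)
  ultimately show "f (g (c x)) = c (f (g x))" by simp
qed

lemma plus_interchange:
  assumes "a \<in> \<Omega>" "b \<in> \<Omega>" "c \<in> \<Omega>" "e \<in> \<Omega>"
  shows "(a \<boxplus> b) \<boxplus> (c \<boxplus> e) = (a \<boxplus> c) \<boxplus> (b \<boxplus> e)"
proof -
  have "(a \<boxplus> b) \<boxplus> (c \<boxplus> e) = a \<boxplus> (b \<boxplus> (c \<boxplus> e))" using assms plus_closed plus_assoc by simp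
  also have "b \<boxplus> (c \<boxplus> e) = c \<boxplus> (b \<boxplus> e)" using assms plus_assoc plus_comm by metis
  finally show ?thesis using assms plus_closed plus_assoc by simp
qed

lemma bicentralizing_plus:
  assumes f: "bicentralizing f" and g: "bicentralizing g"
  shows "bicentralizing (\<lambda>x. f x \<boxplus> g x)"
  unfolding bicentralizing_def
proof (intro conjI allI impI ballI)
  note af = bicentralizing_additive[OF f] and ag = bicentralizing_additive[OF g]
  show "additive (\<lambda>x. f x \<boxplus> g x)"
    unfolding additive_def
  proof (intro conjI ballI)
    show "f x \<boxplus> g x \<in> \<Omega>" if "x \<in> \<Omega>" for x using plus_closed additive_closed[OF af that] additive_closed[OF ag that] .
    show "f (x \<boxplus> y) \<boxplus> g (x \<boxplus> y) = f x \<boxplus> g x \<boxplus> (f y \<boxplus> g y)" if "x \<in> \<Omega>" "y \<in> \<Omega>" for x y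
      using that additive_plus[OF af] additive_plus[OF ag] plus_interchange additive_closed[OF af] additive_closed[OF ag] by simp
  qed
  fix c x assume c: "centralizing c" and x: "x \<in> \<Omega>"
  have ac: "additive c" using c by (simp add: centralizing_def)
  have "g (c x) = c (g x)" "f (c x) = c (f x)" using f g c x by (simp_all add: bicentralizing_def)
  then show "f (c x) \<boxplus> g (c x) = c (f x \<boxplus> g x)"
    using additive_plus[OF ac additive_closed[OF af x] additive_closed[OF ag x]] by simp
qed

lemma bicentralizing_zero: "bicentralizing (\<lambda>x. z)"
  unfolding bicentralizing_def additive_def[of "\<lambda>x. z"] centralizing_def
  using z zero_plus[OF z] by (auto simp: additive_zero)

lemma bicentralizing_id: "bicentralizing (\<lambda>x. x)"
  unfolding bicentralizing_def additive_def[of "\<lambda>x. x"] by simp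

lemma M_invariant_image:
  assumes "W \<subseteq> \<Omega>" "z \<in> W" "w \<in> W" "w \<noteq> z"
    "\<And>x y. x \<in> W \<Longrightarrow> y \<in> W \<Longrightarrow> x \<boxplus> y \<in> W" "\<And>m x. m \<in> M \<Longrightarrow> x \<in> W \<Longrightarrow> m x \<in> W"
  shows "W = \<Omega>"
proof (rule M_irreducible)
  show "W \<noteq> {z}" using assms(3,4) by blast
qed (use assms in auto)

text \<open>The values at \<open>u\<close> form an \<open>M\<close>-submodule containing
  \<open>u\<close>, because sums stay in the double centralizer, and so do composites with elements
  of \<open>M\<close>.\<close>

lemma bicentralizing_transitive: "{f u | f. bicentralizing f} = \<Omega>"
proof (rule M_invariant_image[where w = u])
  have I: "v \<in> {f u | f. bicentralizing f}" if "bicentralizing f" "v = f u" for f v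
    using that unfolding mem_Collect_eq by (intro exI[of _ f] conjI)
  show "{f u | f. bicentralizing f} \<subseteq> \<Omega>" using additive_closed[OF bicentralizing_additive u(1)] by auto
  show "z \<in> {f u | f. bicentralizing f}" by (rule I[OF bicentralizing_zero]) simp
  show "u \<in> {f u | f. bicentralizing f}" by (rule I[OF bicentralizing_id]) simp
  show "u \<noteq> z" by (rule u(2))
  show "x \<boxplus> y \<in> {f u | f. bicentralizing f}" if xy: "x \<in> {f u | f. bicentralizing f}" "y \<in> {f u | f. bicentralizing f}" for x y
  proof -
    obtain f g where "bicentralizing f" "x = f u" "bicentralizing g" "y = g u" using xy unfolding mem_Collect_eq by (elim exE conjE)
    then show ?thesis by (intro I[OF bicentralizing_plus[of f g]]) auto
  qed
  show "m x \<in> {f u | f. bicentralizing f}" if mx: "m \<in> M" "x \<in> {f u | f. bicentralizing f}" for m x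
  proof -
    obtain f where "bicentralizing f" "x = f u" using mx(2) unfolding mem_Collect_eq by (elim exE conjE)
    then show ?thesis by (intro I[OF bicentralizing_comp[OF M_bicentralizing[OF mx(1)], of f]]) auto
  qed
qed

text \<open>Every point is k u with \<open>k\<close> in the commutative double centralizer, so
  agreement at \<open>u\<close> spreads as it did for \<open>N\<close> at \<open>z\<close>.\<close>

lemma bicentralizing_eq:
  assumes "bicentralizing f" "bicentralizing g" "f u = g u" "x \<in> \<Omega>"
  shows "f x = g x"
proof -
  have "x \<in> {f u | f. bicentralizing f}" unfolding bicentralizing_transitive by (rule assms(4))
  then obtain k where k: "bicentralizing k" "x = k u" unfolding mem_Collect_eq by (elim exE conjE)
  have "f (k u) = k (f u)" "g (k u) = k (g u)"
    using bicentralizing_commute[OF assms(1) k(1) u(1)] bicentralizing_commute[OF assms(2) k(1) u(1)] by auto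
  then show ?thesis using k(2) assms(3) by simp
qed

text \<open>Evaluation at \<open>u\<close> identifies the double centralizer with the points, and
  composition becomes the product; \<open>mulmap v\<close> is multiplication by
  \<open>v\<close>.\<close>

definition mulmap :: "'a \<Rightarrow> 'a \<Rightarrow> 'a" where "mulmap v = (SOME f. bicentralizing f \<and> f u = v)"

lemma mulmap: assumes "v \<in> \<Omega>" shows "bicentralizing (mulmap v)" "mulmap v u = v"
proof -
  have "v \<in> {f u | f. bicentralizing f}" unfolding bicentralizing_transitive by (rule assms)
  then have "\<exists>f. bicentralizing f \<and> f u = v" unfolding mem_Collect_eq by auto
  from someI_ex[OF this] show "bicentralizing (mulmap v)" "mulmap v u = v" unfolding mulmap_def by auto
qed

lemma mulmap_eq: "bicentralizing f \<Longrightarrow> f u = v \<Longrightarrow> v \<in> \<Omega> \<Longrightarrow> x \<in> \<Omega> \<Longrightarrow> mulmap v x = f x"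
  by (rule bicentralizing_eq[OF mulmap(1)]) (simp_all add: mulmap(2))

lemma mulmap_closed: "v \<in> \<Omega> \<Longrightarrow> w \<in> \<Omega> \<Longrightarrow> mulmap v w \<in> \<Omega>"
  by (rule additive_closed[OF bicentralizing_additive[OF mulmap(1)]])

lemma mulmap_comm:
  assumes "v \<in> \<Omega>" "w \<in> \<Omega>" shows "mulmap v w = mulmap w v"
  using bicentralizing_commute[OF mulmap(1)[OF assms(1)] mulmap(1)[OF assms(2)] u(1)] mulmap(2) assms by simp

lemma mulmap_assoc:
  assumes "v \<in> \<Omega>" "w \<in> \<Omega>" "x \<in> \<Omega>" shows "mulmap (mulmap v w) x = mulmap v (mulmap w x)"
  by (rule mulmap_eq[OF bicentralizing_comp[OF mulmap(1)[OF assms(1)] mulmap(1)[OF assms(2)]]])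
    (use assms mulmap(2) mulmap_closed in auto)

lemma mulmap_one: "x \<in> \<Omega> \<Longrightarrow> mulmap u x = x"
  by (rule mulmap_eq[OF bicentralizing_id]) (use u in auto)

lemma mulmap_plus:
  assumes "v \<in> \<Omega>" "x \<in> \<Omega>" "y \<in> \<Omega>" shows "mulmap v (x \<boxplus> y) = mulmap v x \<boxplus> mulmap v y"
  by (rule additive_plus[OF bicentralizing_additive[OF mulmap(1)[OF assms(1)]] assms(2,3)])

text \<open>Schur's argument: the image of multiplication by \<open>v\<close> is a nonzero
  \<open>M\<close>-submodule, hence contains \<open>u\<close>.\<close>

lemma mulmap_inverse:
  assumes "v \<in> \<Omega>" "v \<noteq> z" shows "\<exists>w\<in>\<Omega>. mulmap v w = u"
proof -
  note b = mulmap(1)[OF assms(1)]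
  have "mulmap v ` \<Omega> = \<Omega>"
  proof (rule M_invariant_image[where w = v])
    show "mulmap v ` \<Omega> \<subseteq> \<Omega>" by (rule image_subsetI) (rule mulmap_closed[OF assms(1)])
    show "z \<in> mulmap v ` \<Omega>" by (rule image_eqI[where x = z]) (use additive_zero[OF bicentralizing_additive[OF b]] z in simp_all)
    show "v \<in> mulmap v ` \<Omega>" by (rule image_eqI[where x = u]) (use mulmap(2)[OF assms(1)] u(1) in simp_all)
    show "v \<noteq> z" by (rule assms(2))
    show "x \<boxplus> y \<in> mulmap v ` \<Omega>" if xy: "x \<in> mulmap v ` \<Omega>" "y \<in> mulmap v ` \<Omega>" for x y
    proof -
      obtain a c where ac: "a \<in> \<Omega>" "c \<in> \<Omega>" "x = mulmap v a" "y = mulmap v c" using xy by blast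
      then have "x \<boxplus> y = mulmap v (a \<boxplus> c)" using mulmap_plus[OF assms(1)] by simp
      then show ?thesis using plus_closed[OF ac(1,2)] by blast
    qed
    show "m x \<in> mulmap v ` \<Omega>" if mx: "m \<in> M" "x \<in> mulmap v ` \<Omega>" for m x
    proof -
      obtain a where a: "a \<in> \<Omega>" "x = mulmap v a" using mx(2) by blast
      have "mulmap v (m a) = m x"
        using bicentralizing_commute[OF b M_bicentralizing[OF mx(1)] a(1)] a(2) by simp
      then show ?thesis by (intro image_eqI[where x = "m a"]) (use M.elem_closed[OF mx(1) a(1)] in simp_all)
    qed
  qed
  then have "u \<in> mulmap v ` \<Omega>" using u(1) by simp
  then obtain w where w: "u = mulmap v w" "w \<in> \<Omega>" by (rule imageE)
  show ?thesis by (rule bexI[where x = w]) (rule w(1)[symmetric], rule w(2))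
qed

definition fld :: "'a ring" where
  "fld = \<lparr>carrier = \<Omega>, monoid.mult = mulmap, one = u, ring.zero = z, ring.add = plus\<rparr>"

lemma fld_simps [simp]: "carrier fld = \<Omega>" "\<one>\<^bsub>fld\<^esub> = u" "\<zero>\<^bsub>fld\<^esub> = z"
  "x \<otimes>\<^bsub>fld\<^esub> y = mulmap x y" "x \<oplus>\<^bsub>fld\<^esub> y = x \<boxplus> y"
  by (simp_all add: fld_def)

lemma field_fld: "field fld"
proof -
  have "abelian_group fld"
  proof (rule abelian_groupI)
    show "\<exists>y\<in>carrier fld. y \<oplus>\<^bsub>fld\<^esub> x = \<zero>\<^bsub>fld\<^esub>" if "x \<in> carrier fld" for x
      using plus_inverse[of x] that by simp
  qed (simp_all add: plus_closed plus_assoc z zero_plus, rule plus_comm)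
  moreover have "comm_monoid fld"
    by (rule comm_monoidI) (simp_all add: mulmap_closed u mulmap_assoc mulmap_one, rule mulmap_comm)
  moreover have "mulmap (x \<boxplus> y) w = mulmap x w \<boxplus> mulmap y w" if "x \<in> \<Omega>" "y \<in> \<Omega>" "w \<in> \<Omega>" for x y w
    using that mulmap_comm[OF plus_closed[OF that(1,2)] that(3)] mulmap_plus[OF that(3,1,2)]
      mulmap_comm[OF that(1,3)] mulmap_comm[OF that(2,3)] by simp
  ultimately interpret cring fld by (intro cringI) simp_all
  show ?thesis
  proof (rule cring_fieldI)
    show "Units fld = carrier fld - {\<zero>\<^bsub>fld\<^esub>}"
    proof
      show "Units fld \<subseteq> carrier fld - {\<zero>\<^bsub>fld\<^esub>}"
      proof
        fix x assume x: "x \<in> Units fld"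
        have "x \<noteq> \<zero>\<^bsub>fld\<^esub>"
        proof
          assume x0: "x = \<zero>\<^bsub>fld\<^esub>"
          have "inv\<^bsub>fld\<^esub> x \<otimes>\<^bsub>fld\<^esub> x = \<one>\<^bsub>fld\<^esub>" "inv\<^bsub>fld\<^esub> x \<in> carrier fld"
            by (rule Units_l_inv[OF x], rule Units_inv_closed[OF x])
          then have "\<zero>\<^bsub>fld\<^esub> = \<one>\<^bsub>fld\<^esub>" unfolding x0 using r_null by metis
          then show False using u(2) by simp
        qed
        then show "x \<in> carrier fld - {\<zero>\<^bsub>fld\<^esub>}" using Units_closed[OF x] by blast
      qed
      show "carrier fld - {\<zero>\<^bsub>fld\<^esub>} \<subseteq> Units fld"
      proof
        fix x assume "x \<in> carrier fld - {\<zero>\<^bsub>fld\<^esub>}"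
        then have x: "x \<in> \<Omega>" "x \<noteq> z" by auto
        obtain w where w: "w \<in> \<Omega>" "mulmap x w = u" using mulmap_inverse[OF x] by blast
        then show "x \<in> Units fld" unfolding Units_def using x mulmap_comm[OF x(1) w(1)] by auto
      qed
    qed
  qed
qed

lemma add_pow_p: assumes "x \<in> \<Omega>" shows "add_pow fld p x = z"
proof -
  interpret field fld by (rule field_fld)
  have "add_pow fld k x = (tau x ^^ k) z" for k :: nat
  proof (induction k)
    case (Suc k)
    have m: "(tau x ^^ k) z \<in> \<Omega>" using multiples_mem[of \<Omega> x k] z plus_closed assms by simp
    have "add_pow fld (Suc k) x = add_pow fld k x \<oplus>\<^bsub>fld\<^esub> x" using assms by simp
    also have "\<dots> = x \<boxplus> (tau x ^^ k) z" using Suc plus_comm[OF m assms] by simp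
    finally show ?case by (simp add: plus_def)
  qed simp
  then show ?thesis using N_exp tau(1)[OF assms] z by simp
qed

text \<open>By Cauchy, taken from Sylow with exponent one, each prime divisor of the size is the
  order of some vector; all nonzero vectors have additive order \<open>p\<close>.\<close>

lemma card_prime_power: "\<exists>d. card \<Omega> = p ^ d"
proof -
  interpret field fld by (rule field_fld)
  have G: "group (add_monoid fld)" by (rule add.is_group)
  have ord: "order (add_monoid fld) = card \<Omega>" by (simp add: order_def)
  have onlyp: "q = p" if q: "Factorial_Ring.prime q" "q dvd card \<Omega>" for q
  proof -
    obtain m where "card \<Omega> = q ^ 1 * m" using q(2) by auto
    then obtain K where K: "subgroup K (add_monoid fld)" "card K = q ^ 1"
      using sylow_thm[OF q(1) G, of 1 m] ord fin by auto
    interpret K: group "(add_monoid fld)\<lparr>carrier := K\<rparr>" by (rule subgroup.subgroup_is_group[OF K(1) G])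
    have "K \<noteq> {z}" using K(2) prime_gt_1_nat[OF q(1)] by auto
    then obtain x where x: "x \<in> K" "x \<noteq> z" using subgroup.one_closed[OF K(1)] by auto
    have x\<Omega>: "x \<in> \<Omega>" using subgroup.subset[OF K(1)] x(1) by auto
    have "x [^]\<^bsub>(add_monoid fld)\<lparr>carrier := K\<rparr>\<^esub> q = \<one>\<^bsub>(add_monoid fld)\<lparr>carrier := K\<rparr>\<^esub>"
      using K.pow_order_eq_1[of x] x K(2) by (simp add: order_def)
    then have "x [^]\<^bsub>add_monoid fld\<^esub> q = z" by (simp add: nat_pow_def)
    then have "group.ord (add_monoid fld) x dvd q"
      using group.pow_eq_id[OF G, of x q] x\<Omega> by simp
    moreover have "group.ord (add_monoid fld) x dvd p"
      using group.pow_eq_id[OF G, of x p] x\<Omega> add_pow_p[OF x\<Omega>] by (simp add: add_pow_def)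
    moreover have "group.ord (add_monoid fld) x \<noteq> 1"
      using group.ord_eq_1[OF G, of x] x\<Omega> x(2) by simp
    ultimately show ?thesis using q(1) prime_p by (metis prime_nat_iff)
  qed
  have c0: "card \<Omega> \<noteq> 0" using fin z by auto
  obtain m where m: "card \<Omega> = p ^ multiplicity p (card \<Omega>) * m" "\<not> p dvd m"
    using multiplicity_decompose'[OF c0] prime_p by (metis not_prime_unit)
  have "m = 1"
  proof (rule ccontr)
    assume "m \<noteq> 1"
    then obtain q where q: "Factorial_Ring.prime q" "q dvd m" using prime_factor_nat by blast
    then have "q = p" using onlyp m(1) by (metis dvd_mult)
    then show False using q m(2) by simp
  qed
  then show ?thesis using m(1) by (metis mult_1_right)
qed

text \<open>Multiplication by \<open>x\<close>, conjugated by \<open>h\<close>, is again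
  multiplication by some field element. The factor \<open>h u\<close> on the left replaces a
  division by \<open>h u\<close>, so the law needs no inverses.\<close>

lemma H_semilinear:
  assumes h: "h \<in> H" and x: "x \<in> \<Omega>" and w: "w \<in> \<Omega>"
  shows "mulmap (h (mulmap x w)) (h u) = mulmap (h x) (h w)"
proof -
  obtain k where k: "k \<in> H" "\<forall>y\<in>\<Omega>. k (h y) = y" "\<forall>y\<in>\<Omega>. h (k y) = y" using H.obtain_inverse[OF h] .
  define f where "f = (\<lambda>y. h (mulmap x (k y)))"
  have ah: "additive h" and ak: "additive k" using H_additive h k(1) by auto
  note bx = mulmap(1)[OF x]
  note ax = bicentralizing_additive[OF bx]
  have af: "additive f"
    using ah ak ax unfolding f_def additive_def by simp
  have "bicentralizing f"
    unfolding bicentralizing_def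
  proof (intro conjI allI impI ballI)
    show "additive f" by (rule af)
    fix c y assume c: "centralizing c" and y: "y \<in> \<Omega>"
    have ac: "additive c" using c by (simp add: centralizing_def)
    \<comment> \<open>Instead of moving \<open>f\<close> past \<open>c\<close>, move multiplication
      by \<open>x\<close> past the conjugate of \<open>c\<close> by the inverse of \<open>h\<close>;
      this conjugate still centralizes \<open>M\<close> because \<open>h\<close> normalises
      \<open>M\<close>.\<close>
    define c' where "c' = (\<lambda>y. k (c (h y)))"
    have "centralizing c'"
      unfolding centralizing_def
    proof (intro conjI ballI)
      show "additive c'" using ah ak ac unfolding c'_def additive_def by simp
      fix m y assume m: "m \<in> M" and y: "y \<in> \<Omega>"
      obtain m' where m': "m' \<in> M" "\<forall>x\<in>\<Omega>. h (m x) = m' (h x)" using M_normal h m by blast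
      have hy: "h y \<in> \<Omega>" by (rule H.elem_closed[OF h y])
      have chy: "c (h y) \<in> \<Omega>" by (rule additive_closed[OF ac hy])
      have "c (m' (h y)) = m' (c (h y))" using c m'(1) hy by (simp add: centralizing_def)
      then have e: "c' (m y) = k (m' (c (h y)))" using m'(2) y by (simp add: c'_def)
      have kc: "k (c (h y)) \<in> \<Omega>" by (rule H.elem_closed[OF k(1) chy])
      have "m' (c (h y)) = h (m (k (c (h y))))" using m'(2) kc k(3) chy by simp
      then show "c' (m y) = m (c' y)" using e k(2) M.elem_closed[OF m kc] by (simp add: c'_def)
    qed
    then have cx: "mulmap x (c' v) = c' (mulmap x v)" if "v \<in> \<Omega>" for v
      using bx that by (simp add: bicentralizing_def)
    have ky: "k y \<in> \<Omega>" by (rule H.elem_closed[OF k(1) y])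
    have xky: "mulmap x (k y) \<in> \<Omega>" by (rule mulmap_closed[OF x ky])
    have "k (c y) = c' (k y)" using k(3) y by (simp add: c'_def)
    then have "f (c y) = h (c' (mulmap x (k y)))" using cx[OF ky] by (simp add: f_def)
    also have "\<dots> = c (h (mulmap x (k y)))"
      using k(3) additive_closed[OF ac H.elem_closed[OF h xky]] by (simp add: c'_def)
    finally show "f (c y) = c (f y)" by (simp add: f_def)
  qed
  moreover have fu: "f u \<in> \<Omega>" using additive_closed[OF af u(1)] .
  ultimately have f: "f y = mulmap (f u) y" if "y \<in> \<Omega>" for y using mulmap_eq[of f "f u" y] that by simp
  have hf: "h (mulmap x v) = mulmap (f u) (h v)" if v: "v \<in> \<Omega>" for v
  proof -
    have "f (h v) = h (mulmap x v)" using k(2) v by (simp add: f_def)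
    then show ?thesis using f[OF H.elem_closed[OF h v]] by simp
  qed
  have "mulmap x u = x" by (rule mulmap(2)[OF x])
  then have hx: "h x = mulmap (f u) (h u)" using hf[OF u(1)] by simp
  have c: "h u \<in> \<Omega>" "h w \<in> \<Omega>" using H.elem_closed[OF h] u(1) w by auto
  have "mulmap (h (mulmap x w)) (h u) = mulmap (f u) (mulmap (h w) (h u))"
    using hf[OF w] mulmap_assoc[OF fu c(2,1)] by simp
  also have "\<dots> = mulmap (f u) (mulmap (h u) (h w))" using mulmap_comm[OF c] by simp
  also have "\<dots> = mulmap (h x) (h w)" using hx mulmap_assoc[OF fu c] by simp
  finally show ?thesis .
qed

end

lemma (in comm_monoid) mult_mult_swap:
  assumes "a \<in> carrier G" "b \<in> carrier G" "c \<in> carrier G"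
  shows "(a \<otimes> b) \<otimes> (a \<otimes> c) = (a \<otimes> (b \<otimes> c)) \<otimes> a"
  using assms by (simp add: m_ac)

section \<open>The permutation group inside the affine semilinear group\<close>

context irreducible_pair begin

lemma fld_galois_field:
  obtains d where "galois_field fld p d"
proof -
  obtain d where "card \<Omega> = p ^ d" using card_prime_power by blast
  then have "galois_field fld p d"
    using field_fld prime_p by (simp add: galois_field_def galois_field_axioms_def)
  then show thesis by (rule that)
qed

text \<open>Dividing \<open>h\<close> by its value at one gives a map \<open>s\<close> that fixes
  one; the semilinear law then says that \<open>s\<close> is multiplicative, so it is a field
  automorphism.\<close>

lemma H_le_GammaL1:
  assumes gf: "galois_field fld p d" shows "H \<subseteq> GammaL1 fld"
proof
  interpret F: galois_field fld p d by (rule gf)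
  fix h assume h: "h \<in> H"
  have hc: "h x \<in> \<Omega>" if "x \<in> \<Omega>" for x by (rule H.elem_closed[OF h that])
  define a where "a = h u"
  have a: "a \<in> \<Omega>" unfolding a_def by (rule hc[OF u(1)])
  have "a \<noteq> z" unfolding a_def using H.elem_inj[OF h u(1) z] u(2) h by auto
  then have ia: "inv\<^bsub>fld\<^esub> a \<in> \<Omega>" "inv\<^bsub>fld\<^esub> a \<noteq> z" "mulmap (inv\<^bsub>fld\<^esub> a) a = u" "mulmap a (inv\<^bsub>fld\<^esub> a) = u"
    using F.unit_inv[of a] a by simp_all
  define s where "s = (\<lambda>x. mulmap (inv\<^bsub>fld\<^esub> a) (h x))"
  have sc: "s x \<in> \<Omega>" if "x \<in> \<Omega>" for x unfolding s_def by (rule mulmap_closed[OF ia(1) hc[OF that]])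
  have as: "mulmap a (s x) = h x" if "x \<in> \<Omega>" for x
    unfolding s_def using mulmap_assoc[OF a ia(1) hc[OF that]] ia(4) mulmap_one[OF hc[OF that]] by simp
  have "s \<in> ring_hom fld fld"
  proof (rule ring_hom_memI)
    show "s x \<in> carrier fld" if "x \<in> carrier fld" for x using sc that by simp
    show "s (x \<otimes>\<^bsub>fld\<^esub> y) = s x \<otimes>\<^bsub>fld\<^esub> s y" if "x \<in> carrier fld" "y \<in> carrier fld" for x y
    proof -
      have xy: "x \<in> \<Omega>" "y \<in> \<Omega>" using that by auto
      have xyc: "mulmap x y \<in> \<Omega>" by (rule mulmap_closed[OF xy])
      have "mulmap (h (mulmap x y)) a = mulmap (h x) (h y)"
        unfolding a_def by (rule H_semilinear[OF h xy])
      then have e: "mulmap (mulmap a (s (mulmap x y))) a = mulmap (mulmap a (s x)) (mulmap a (s y))"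
        using as xy xyc by simp
      have "mulmap (mulmap a (s x)) (mulmap a (s y)) = mulmap (mulmap a (mulmap (s x) (s y))) a"
        using F.mult_mult_swap[of a "s x" "s y"] a sc[OF xy(1)] sc[OF xy(2)] by simp
      then have "mulmap (mulmap a (s (mulmap x y))) a = mulmap (mulmap a (mulmap (s x) (s y))) a" using e by simp
      \<comment> \<open>The semilinear law carries the factor \<open>a\<close> on both sides of the
        product, so it is cancelled twice.\<close>
      then have "mulmap a (s (mulmap x y)) = mulmap a (mulmap (s x) (s y))"
        using F.m_rcancel[of a "mulmap a (s (mulmap x y))" "mulmap a (mulmap (s x) (s y))"] a \<open>a \<noteq> z\<close>
          mulmap_closed[OF a sc[OF xyc]] mulmap_closed[OF a mulmap_closed[OF sc[OF xy(1)] sc[OF xy(2)]]] by simp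
      then have "s (mulmap x y) = mulmap (s x) (s y)"
        using F.m_lcancel[of a "s (mulmap x y)" "mulmap (s x) (s y)"] a \<open>a \<noteq> z\<close>
          sc[OF xyc] mulmap_closed[OF sc[OF xy(1)] sc[OF xy(2)]] by simp
      then show ?thesis by simp
    qed
    show "s (x \<oplus>\<^bsub>fld\<^esub> y) = s x \<oplus>\<^bsub>fld\<^esub> s y" if "x \<in> carrier fld" "y \<in> carrier fld" for x y
      using that H_plus[OF h, of x y] mulmap_plus[OF ia(1) hc hc, of x y] by (simp add: s_def)
    show "s \<one>\<^bsub>fld\<^esub> = \<one>\<^bsub>fld\<^esub>" using ia(3) by (simp add: s_def a_def)
  qed
  moreover have "bij_betw s \<Omega> \<Omega>"
  proof -
    have inj: "inj_on s \<Omega>"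
    proof (rule inj_onI)
      fix x y assume xy: "x \<in> \<Omega>" "y \<in> \<Omega>" "s x = s y"
      have "h x = h y" using as[OF xy(1)] as[OF xy(2)] xy(3) by simp
      then show "x = y" using H.elem_inj[OF h xy(1,2)] by simp
    qed
    have "s ` \<Omega> = \<Omega>" by (rule endo_inj_surj[OF fin _ inj]) (use sc in blast)
    then show ?thesis using inj by (simp add: bij_betw_def)
  qed
  ultimately have si: "s \<in> ring_iso fld fld" by (simp add: ring_iso_def)
  have "h = (\<lambda>x\<in>carrier fld. a \<otimes>\<^bsub>fld\<^esub> s x \<oplus>\<^bsub>fld\<^esub> z)"
  proof (rule extensionalityI[of h \<Omega>])
    show "h \<in> extensional \<Omega>" using H.elem_Bij[OF h] by (simp add: Bij_def)
    show "h x = (\<lambda>x\<in>carrier fld. a \<otimes>\<^bsub>fld\<^esub> s x \<oplus>\<^bsub>fld\<^esub> z) x" if "x \<in> \<Omega>" for x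
      using that as[OF that] plus_zero[OF hc[OF that]] by simp
  qed simp
  then have "h \<in> AGammaL1 fld"
    unfolding AGammaL1_def F.galois_group_prime_subfield
    using a \<open>a \<noteq> z\<close> z si by (intro CollectI exI[of _ a] exI[of _ z] exI[of _ s]) simp
  then show "h \<in> GammaL1 fld" using h by (simp add: GammaL1_def stabilizer_def)
qed

text \<open>\<open>tau b\<close> adds \<open>b\<close> on the left and
  \<open>translation_group\<close> adds it on the right; commutativity reconciles them.\<close>

lemma N_eq_translation_group: "N = translation_group fld"
proof -
  have tr: "tau b = (\<lambda>x\<in>\<Omega>. x \<boxplus> b)" if "b \<in> \<Omega>" for b
  proof (rule extensionalityI[of _ \<Omega>])
    show "tau b \<in> extensional \<Omega>" using N.elem_Bij[OF tau(1)[OF that]] by (simp add: Bij_def)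
    show "tau b x = (\<lambda>x\<in>\<Omega>. x \<boxplus> b) x" if "x \<in> \<Omega>" for x
      using that plus_comm[OF \<open>b \<in> \<Omega>\<close> that] by (simp add: plus_def)
  qed simp
  show ?thesis
  proof
    show "N \<subseteq> translation_group fld"
    proof
      fix n assume n: "n \<in> N"
      have nz: "n z \<in> \<Omega>" by (rule N.elem_closed[OF n z])
      have "n = tau (n z)" using tau_eqI[OF n refl nz] by simp
      then have "n = (\<lambda>x\<in>\<Omega>. x \<boxplus> n z)" using tr[OF nz] by simp
      then show "n \<in> translation_group fld" unfolding translation_group_def
        using nz by (intro CollectI exI[of _ "n z"]) simp
    qed
    show "translation_group fld \<subseteq> N"
    proof
      fix n assume "n \<in> translation_group fld"
      then obtain b where b: "b \<in> \<Omega>" "n = (\<lambda>x\<in>\<Omega>. x \<boxplus> b)" unfolding translation_group_def by auto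
      then show "n \<in> N" using tau(1)[OF b(1)] tr[OF b(1)] by simp
    qed
  qed
qed

lemma affine_semidirect: "semidirect_product (perm_group \<Omega> G) N H"
  unfolding semidirect_product_def
proof (intro conjI)
  show "N \<lhd> perm_group \<Omega> G"
    unfolding normal_perm_group_iff using N.subgroup_Bij N_G N_normal by blast
  show "subgroup H (perm_group \<Omega> G)"
    unfolding subgroup_perm_group_iff using H.subgroup_Bij by blast
  show "N \<inter> H = {\<one>\<^bsub>perm_group \<Omega> G\<^esub>}"
  proof
    show "N \<inter> H \<subseteq> {\<one>\<^bsub>perm_group \<Omega> G\<^esub>}"
    proof
      fix n assume "n \<in> N \<inter> H"
      then have "n \<in> N" "n z = z" by auto
      then have "n = (\<lambda>x\<in>\<Omega>. x)" using N_eqI[OF _ N.id_mem] z by simp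
      then show "n \<in> {\<one>\<^bsub>perm_group \<Omega> G\<^esub>}" by (simp add: one_BijGroup)
    qed
    show "{\<one>\<^bsub>perm_group \<Omega> G\<^esub>} \<subseteq> N \<inter> H" using N.id_mem H.id_mem by (simp add: one_BijGroup)
  qed
  show "N <#>\<^bsub>perm_group \<Omega> G\<^esub> H = carrier (perm_group \<Omega> G)"
  proof
    show "N <#>\<^bsub>perm_group \<Omega> G\<^esub> H \<subseteq> carrier (perm_group \<Omega> G)"
    proof
      fix g assume "g \<in> N <#>\<^bsub>perm_group \<Omega> G\<^esub> H"
      then obtain n h where nh: "n \<in> N" "h \<in> H" "g = n \<otimes>\<^bsub>BijGroup \<Omega>\<^esub> h" unfolding set_mult_def by auto
      have "n \<in> G" "h \<in> G" using nh N_G by auto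
      then show "g \<in> carrier (perm_group \<Omega> G)" using nh(3) mult_eq compose_mem by simp
    qed
    show "carrier (perm_group \<Omega> G) \<subseteq> N <#>\<^bsub>perm_group \<Omega> G\<^esub> H"
    proof
      fix g assume "g \<in> carrier (perm_group \<Omega> G)"
      then have g: "g \<in> G" by simp
      obtain h where h: "h \<in> H" "\<forall>x\<in>\<Omega>. g x = g z \<boxplus> h x" using decompose[OF g] .
      have t: "tau (g z) \<in> N" by (rule tau(1)[OF elem_closed[OF g z]])
      have tG: "tau (g z) \<in> G" "h \<in> G" using t N_G h(1) by auto
      have "g = compose \<Omega> (tau (g z)) h"
      proof (rule elem_eqI[OF g compose_mem[OF tG]])
        show "g x = compose \<Omega> (tau (g z)) h x" if "x \<in> \<Omega>" for x
          using that h(2) by (simp add: compose_def plus_def)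
      qed
      then have "g = tau (g z) \<otimes>\<^bsub>perm_group \<Omega> G\<^esub> h" using mult_eq[OF tG] by simp
      then show "g \<in> N <#>\<^bsub>perm_group \<Omega> G\<^esub> H" unfolding set_mult_def using t h(1) by blast
    qed
  qed
qed

lemma G_le_AGammaL1:
  assumes gf: "galois_field fld p d" shows "G \<subseteq> AGammaL1 fld"
proof
  interpret F: galois_field fld p d by (rule gf)
  interpret A: permutation_group \<Omega> "AGammaL1 fld" using F.permutation_group_AGammaL1 by simp
  fix g assume g: "g \<in> G"
  obtain h where h: "h \<in> H" "\<forall>x\<in>\<Omega>. g x = g z \<boxplus> h x" using decompose[OF g] .
  have gz: "g z \<in> \<Omega>" by (rule elem_closed[OF g z])
  have t: "tau (g z) \<in> N" by (rule tau(1)[OF gz])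
  have tG: "tau (g z) \<in> G" "h \<in> G" using t N_G h(1) by auto
  have "tau (g z) \<in> F.transl ` \<Omega>" using t F.translation_group_eq N_eq_translation_group by simp
  then have tA: "tau (g z) \<in> AGammaL1 fld" using F.transl_AGammaL1 by auto
  have hA: "h \<in> AGammaL1 fld" using H_le_GammaL1[OF gf] h(1) by (auto simp: GammaL1_def stabilizer_def)
  have "g = compose \<Omega> (tau (g z)) h"
  proof (rule elem_eqI[OF g compose_mem[OF tG]])
    show "g x = compose \<Omega> (tau (g z)) h x" if "x \<in> \<Omega>" for x
      using that h(2) by (simp add: compose_def plus_def)
  qed
  then show "g \<in> AGammaL1 fld" using A.compose_mem[OF tA hA] by simp
qed

text \<open>Evaluation at \<open>u\<close> matches \<open>M\<close> with the scalars of
  \<open>H\<close>, so the abstract hypotheses on \<open>M\<close> become those of the section on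
  scalar orbits.\<close>

theorem affine_structure:
  assumes r: "Factorial_Ring.prime (r::nat)" and M_exp: "\<forall>m\<in>M. \<forall>x\<in>\<Omega>. (m ^^ r) x = x"
    and M_nontriv: "\<exists>m\<in>M. m \<noteq> (\<lambda>x\<in>\<Omega>. x)"
    and M_orbits: "\<forall>h\<in>H. \<forall>v\<in>\<Omega>. v \<noteq> z \<longrightarrow> (\<exists>m\<in>M. h v = m v)"
  shows "\<exists>d e t. d \<ge> 1 \<and> card \<Omega> = p ^ d \<and>
       subgroup G (perm_group \<Omega> (AGammaL1 fld)) \<and>
       semidirect_product (perm_group \<Omega> G) (translation_group fld) H \<and>
       subgroup H (perm_group \<Omega> (GammaL1 fld)) \<and>
       iso_cyclic_semidirect (perm_group \<Omega> H) t e \<and>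
       t = card (H \<inter> GL1 fld) \<and> primitive_prime_divisor t p d \<and>
       (e = 1 \<or> Factorial_Ring.prime e \<and> e dvd d \<and> t = (p ^ d - 1) div (p ^ (d div e) - 1))"
proof -
  have M_orbit: "\<exists>m\<in>M. h v = m v" if "h \<in> H" "v \<in> \<Omega>" "v \<noteq> z" for h v
    by (rule mp[OF bspec[OF bspec[OF M_orbits that(1)] that(2)] that(3)])
  obtain d where gf: "galois_field fld p d" by (rule fld_galois_field)
  interpret F: galois_field fld p d by (rule gf)
  interpret A: permutation_group \<Omega> "AGammaL1 fld" using F.permutation_group_AGammaL1 by simp
  interpret GL: permutation_group \<Omega> "GammaL1 fld" using F.permutation_group_GammaL1 by simp
  have HG: "H \<subseteq> GammaL1 fld" by (rule H_le_GammaL1[OF gf])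
  interpret S: semilinear_group fld p d H
    using HG H.permutation_group_axioms gf by (simp add: semilinear_group_def semilinear_group_axioms_def)
  have M_mul: "m x = mulmap (m u) x" if "m \<in> M" "x \<in> \<Omega>" for m x
    using mulmap_eq[OF M_bicentralizing[OF that(1)] refl M.elem_closed[OF that(1) u(1)] that(2)] by simp
  have M_scalar: "m u \<in> S.scalars" if m: "m \<in> M" for m
  proof -
    have mu: "m u \<in> \<Omega>" by (rule M.elem_closed[OF m u(1)])
    have mH: "m \<in> H" using m M_H by blast
    have "m u \<noteq> z" using M.elem_inj[OF m u(1) z] u(2) mH by auto
    moreover have "F.semilin (m u) 0 = m"
    proof (rule extensionalityI[of _ \<Omega>])
      show "m \<in> extensional \<Omega>" using M.elem_Bij[OF m] by (simp add: Bij_def)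
      show "F.semilin (m u) 0 \<in> extensional \<Omega>" by (simp add: F.semilin_def)
      show "F.semilin (m u) 0 x = m x" if "x \<in> \<Omega>" for x
        using F.semilin_apply[of x "m u" 0] that M_mul[OF m that] F.nat_pow_eone[of x] by simp
    qed
    ultimately show ?thesis using mu mH by (simp add: S.scalars_def)
  qed
  \<comment> \<open>A scalar is the image of \<open>u\<close> under its multiplication map, and
    \<open>H\<close> and \<open>M\<close> have the same orbit of \<open>u\<close>.\<close>
  have scalar_M: "\<exists>m\<in>M. a = m u" if a: "a \<in> S.scalars" for a
  proof -
    have "F.semilin a 0 \<in> H" "a \<in> \<Omega>" using a by (auto simp: S.scalars_def)
    moreover from this have "F.semilin a 0 u = a" using F.semilin_one[of a 0] by simp
    ultimately show ?thesis using M_orbit[of "F.semilin a 0" u] u by auto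
  qed
  have pow_r: "a [^]\<^bsub>fld\<^esub> r = \<one>\<^bsub>fld\<^esub>" if a: "a \<in> S.scalars" for a
  proof -
    obtain m where m: "m \<in> M" "a = m u" using scalar_M[OF a] by blast
    have ac: "a \<in> carrier fld" using a by (simp add: S.scalars_def)
    have "a [^]\<^bsub>fld\<^esub> k = (m ^^ k) u" for k :: nat
    proof (induction k)
      case (Suc k)
      have "(m ^^ k) u \<in> \<Omega>" using Suc F.nat_pow_closed[OF ac, of k] by simp
      then have "(m ^^ Suc k) u = mulmap a ((m ^^ k) u)" using M_mul[OF m(1)] m(2) by simp
      also have "\<dots> = a \<otimes>\<^bsub>fld\<^esub> a [^]\<^bsub>fld\<^esub> k" using Suc by simp
      also have "\<dots> = a [^]\<^bsub>fld\<^esub> Suc k" by (rule F.nat_pow_Suc2[OF ac, symmetric])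
      finally show ?case by simp
    qed simp
    then show ?thesis using M_exp m(1) u(1) by simp
  qed
  \<comment> \<open>At most \<open>r\<close> elements satisfy x^r = 1; conversely a nontrivial
    element of \<open>M\<close> gives a scalar other than one killed by both \<open>r\<close> and
    the number of scalars, so \<open>r\<close> divides that number.\<close>
  have card: "card S.scalars = r"
  proof (rule antisym)
    have "card S.scalars \<le> card {x \<in> carrier fld. x [^]\<^bsub>fld\<^esub> r = \<one>\<^bsub>fld\<^esub>}"
      using pow_r F.finite_carrier by (intro card_mono) (auto simp: S.scalars_def)
    also have "\<dots> \<le> r" using F.num_roots_le_deg[OF F.finite_carrier, of r] prime_gt_0_nat[OF r] by simp
    finally show "card S.scalars \<le> r" .
    obtain m where m: "m \<in> M" "m \<noteq> (\<lambda>x\<in>\<Omega>. x)" using M_nontriv by blast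
    have mu: "m u \<in> S.scalars" by (rule M_scalar[OF m(1)])
    have "m u \<noteq> u"
    proof
      assume e: "m u = u"
      have "m = (\<lambda>x\<in>\<Omega>. x)"
      proof (rule M.elem_eqI[OF m(1) M.id_mem])
        show "m x = (\<lambda>x\<in>\<Omega>. x) x" if "x \<in> \<Omega>" for x using M_mul[OF m(1) that] e mulmap_one[OF that] that by simp
      qed
      then show False using m(2) by simp
    qed
    then have "\<not> coprime r (card S.scalars)"
      using S.coprime_pow_eq_one[OF _ pow_r[OF mu] S.scalars_pow_card[OF mu]] mu prime_gt_0_nat[OF r]
      by (auto simp: S.scalars_def)
    then have "r dvd card S.scalars" using r prime_imp_coprime by blast
    then show "r \<le> card S.scalars" using S.card_scalars_pos by (rule dvd_imp_le)
  qed
  have prime: "Factorial_Ring.prime (card S.scalars)" using card r by simp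
  have orb: "\<exists>a\<in>S.scalars. h v = a \<otimes>\<^bsub>fld\<^esub> v" if hv: "h \<in> H" "v \<in> carrier fld" "v \<noteq> \<zero>\<^bsub>fld\<^esub>" for h v
  proof -
    obtain m where m: "m \<in> M" "h v = m v" using M_orbit[OF hv(1), of v] hv(2,3) by auto
    then have "h v = m u \<otimes>\<^bsub>fld\<^esub> v" using M_mul[OF m(1), of v] hv(2) by simp
    then show ?thesis using M_scalar[OF m(1)] by blast
  qed
  have irr: "W = carrier fld" if W: "W \<subseteq> carrier fld" "\<zero>\<^bsub>fld\<^esub> \<in> W" "W \<noteq> {\<zero>\<^bsub>fld\<^esub>}"
    "\<And>x y. x \<in> W \<Longrightarrow> y \<in> W \<Longrightarrow> x \<oplus>\<^bsub>fld\<^esub> y \<in> W"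
    "\<And>a x. a \<in> S.scalars \<Longrightarrow> x \<in> W \<Longrightarrow> a \<otimes>\<^bsub>fld\<^esub> x \<in> W" for W
  proof -
    have "W = \<Omega>"
    proof (rule M_irreducible)
      show "m x \<in> W" if "m \<in> M" "x \<in> W" for m x
        using W(5)[OF M_scalar[OF that(1)] that(2)] M_mul[OF that(1), of x] W(1) that(2) by auto
    qed (use W in auto)
    then show ?thesis by simp
  qed
  obtain e where e: "iso_cyclic_semidirect (perm_group \<Omega> H) (card S.scalars) e"
     "e = 1 \<or> Factorial_Ring.prime e \<and> e dvd d \<and> card S.scalars = (p ^ d - 1) div (p ^ (d div e) - 1)"
  proof -
    have "\<exists>e. iso_cyclic_semidirect (perm_group (carrier fld) H) (card S.scalars) e \<and>
     (e = 1 \<or> Factorial_Ring.prime e \<and> e dvd d \<and> card S.scalars = (p ^ d - 1) div (p ^ (d div e) - 1))"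
    proof (rule S.semilinear_group_structure[OF prime])
      show "\<exists>a\<in>S.scalars. h v = a \<otimes>\<^bsub>fld\<^esub> v" if "h \<in> H" "v \<in> carrier fld" "v \<noteq> \<zero>\<^bsub>fld\<^esub>" for h v
        by (rule orb[OF that])
    qed (rule irr)
    then show thesis using that by auto
  qed
  have ppd: "primitive_prime_divisor (card S.scalars) p d"
  proof (rule S.card_scalars_primitive[OF prime])
    show "\<exists>a\<in>S.scalars. h v = a \<otimes>\<^bsub>fld\<^esub> v" if "h \<in> H" "v \<in> carrier fld" "v \<noteq> \<zero>\<^bsub>fld\<^esub>" for h v
      by (rule orb[OF that])
  qed (rule irr)
  have "subgroup G (perm_group \<Omega> (AGammaL1 fld))"
    unfolding A.subgroup_perm_group_iff using subgroup_Bij G_le_AGammaL1[OF gf] by blast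
  moreover have "subgroup H (perm_group \<Omega> (GammaL1 fld))"
    unfolding GL.subgroup_perm_group_iff using H.subgroup_Bij HG by blast
  moreover have "semidirect_product (perm_group \<Omega> G) (translation_group fld) H"
    using affine_semidirect N_eq_translation_group by simp
  moreover have "d \<ge> 1" using F.d_pos by simp
  moreover have "card \<Omega> = p ^ d" using F.card_R by simp
  moreover have "card S.scalars = card (H \<inter> GL1 fld)" using S.card_H_Int_GL1 by simp
  ultimately show ?thesis using e ppd by blast
qed

end

section \<open>Soluble extremely primitive groups\<close>

text \<open>The field is built on \<Omega> itself, so no relabelling occurs here.\<close>

theorem (in permutation_group) solvable_extremely_primitive_affine:
  assumes fin: "finite \<Omega>" and sol: "solvable (perm_group \<Omega> G)" and ep: "extremely_primitive \<Omega> G"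
  shows "\<exists>p d (F :: 'a ring) H t e. Factorial_Ring.prime p \<and> d \<ge> 1 \<and> field F \<and> carrier F = \<Omega> \<and> card \<Omega> = p ^ d \<and>
       subgroup G (perm_group \<Omega> (AGammaL1 F)) \<and>
       semidirect_product (perm_group \<Omega> G) (translation_group F) H \<and>
       subgroup H (perm_group \<Omega> (GammaL1 F)) \<and>
       iso_cyclic_semidirect (perm_group \<Omega> H) t e \<and>
       t = card (H \<inter> GL1 F) \<and> primitive_prime_divisor t p d \<and>
       (e = 1 \<or> Factorial_Ring.prime e \<and> e dvd d \<and> t = (p ^ d - 1) div (p ^ (d div e) - 1))"
proof -
  note ep = ep[unfolded extremely_primitive_iff, THEN conjunct2]
  note trans = ep[THEN conjunct1] and prim = ep[THEN conjunct2, THEN conjunct1]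
  note nreg = ep[THEN conjunct2, THEN conjunct2, THEN conjunct1]
    and suborb = ep[THEN conjunct2, THEN conjunct2, THEN conjunct2]
  obtain x0 g0 where g0: "x0 \<in> \<Omega>" "g0 \<in> G" "g0 x0 = x0" "g0 \<noteq> (\<lambda>x\<in>\<Omega>. x)" using nreg by blast
  obtain N p where N: "permutation_group \<Omega> N" "N \<subseteq> G" "\<exists>n\<in>N. n \<noteq> (\<lambda>x\<in>\<Omega>. x)" "Factorial_Ring.prime (p::nat)"
    "\<forall>g\<in>G. \<forall>n\<in>N. \<exists>n'\<in>N. \<forall>x\<in>\<Omega>. g (n x) = n' (g x)"
    "\<forall>m\<in>N. \<forall>n\<in>N. \<forall>x\<in>\<Omega>. m (n x) = n (m x)" "\<forall>n\<in>N. \<forall>x\<in>\<Omega>. (n ^^ p) x = x"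
    using obtain_elementary_abelian_normal[OF fin sol g0(2,4)] .
  interpret N: permutation_group \<Omega> N by (rule N(1))
  obtain n0 where n0: "n0 \<in> N" "n0 \<noteq> (\<lambda>x\<in>\<Omega>. x)" using N(3) by blast
  have "\<exists>z\<in>\<Omega>. n0 z \<noteq> z"
  proof (rule ccontr)
    assume "\<not> (\<exists>z\<in>\<Omega>. n0 z \<noteq> z)"
    then have "n0 = (\<lambda>x\<in>\<Omega>. x)" by (intro N.elem_eqI[OF n0(1) N.id_mem]) simp
    then show False using n0(2) by simp
  qed
  then obtain z where z: "z \<in> \<Omega>" "n0 z \<noteq> z" by blast
  \<comment> \<open>This point shows that the \<open>N\<close>-orbit of \<open>z\<close> is not a
    singleton, and it is reused as the one of the field.\<close>
  define u where "u = n0 z"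
  have u: "u \<in> \<Omega>" "u \<noteq> z" unfolding u_def using N.elem_closed[OF n0(1) z(1)] z(2) by auto
  have "{n z | n. n \<in> N} = {z} \<or> {n z | n. n \<in> N} = \<Omega>"
    by (rule normal_orbit_cases[OF N(1,2,5) subset_refl _ prim z(1)]) (rule elem_closed)
  moreover have "u \<in> {n z | n. n \<in> N}" using n0(1) unfolding u_def by blast
  ultimately have N_orbit: "{n z | n. n \<in> N} = \<Omega>" using u(2) by auto
  interpret A: affine_action \<Omega> G z N p
  proof unfold_locales
    show "\<exists>n\<in>N. n z = x" if "x \<in> \<Omega>" for x
    proof -
      have "x \<in> {n z | n. n \<in> N}" unfolding N_orbit by (rule that)
      then show ?thesis by auto
    qed
  qed (use fin z N in auto)
  \<comment> \<open>The nontrivial stabiliser is known at \<open>x0\<close> only; transitivity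
    conjugates its element to the origin.\<close>
  obtain h0 where h0: "h0 \<in> stab z" "h0 \<noteq> (\<lambda>x\<in>\<Omega>. x)"
  proof -
    obtain k where k: "k \<in> G" "k z = x0" using trans z(1) g0(1) by blast
    obtain k' where k': "k' \<in> G" "\<forall>x\<in>\<Omega>. k' (k x) = x" "\<forall>x\<in>\<Omega>. k (k' x) = x" using obtain_inverse[OF k(1)] .
    define h where "h = compose \<Omega> k' (compose \<Omega> g0 k)"
    have hx: "h x = k' (g0 (k x))" if "x \<in> \<Omega>" for x using that by (simp add: h_def compose_def)
    have "h \<in> G" unfolding h_def using compose_mem k(1) k'(1) g0(2) by blast
    moreover have "h z = k' (k z)" using hx[OF z(1)] k(2) g0(3) by simp
    then have "h z = z" using k'(2) z(1) by simp
    moreover have "h \<noteq> (\<lambda>x\<in>\<Omega>. x)"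
    proof
      assume hid: "h = (\<lambda>x\<in>\<Omega>. x)"
      have "g0 = (\<lambda>x\<in>\<Omega>. x)"
      proof (rule elem_eqI[OF g0(2) id_mem])
        fix x assume x: "x \<in> \<Omega>"
        have k'x: "k' x \<in> \<Omega>" by (rule elem_closed[OF k'(1) x])
        have "k' (g0 (k (k' x))) = k' x" using hx[OF k'x] hid k'x by simp
        then have "k' (g0 x) = k' x" using k'(3) x by simp
        then show "g0 x = (\<lambda>x\<in>\<Omega>. x) x" using elem_inj[OF k'(1) elem_closed[OF g0(2) x] x] x by simp
      qed
      then show False using g0(4) by simp
    qed
    ultimately show thesis by (intro that[of h]) simp_all
  qed
  obtain M r where M: "permutation_group \<Omega> M" "M \<subseteq> stab z" "\<exists>n\<in>M. n \<noteq> (\<lambda>x\<in>\<Omega>. x)" "Factorial_Ring.prime (r::nat)"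
    "\<forall>g\<in>stab z. \<forall>n\<in>M. \<exists>n'\<in>M. \<forall>x\<in>\<Omega>. g (n x) = n' (g x)"
    "\<forall>m\<in>M. \<forall>n\<in>M. \<forall>x\<in>\<Omega>. m (n x) = n (m x)" "\<forall>n\<in>M. \<forall>x\<in>\<Omega>. (n ^^ r) x = x"
    using A.H.obtain_elementary_abelian_normal[OF fin solvable_stab[OF z(1) sol] h0] .
  interpret M: permutation_group \<Omega> M by (rule M(1))
  \<comment> \<open>The vectors fixed by \<open>M\<close> form a subgroup, invariant under
    \<open>H\<close> because \<open>M\<close> is normal in \<open>H\<close>; it is not everything
    because \<open>M\<close> is nontrivial.\<close>
  have fixed: "v = z" if v: "v \<in> \<Omega>" "\<forall>m\<in>M. m v = v" for v
  proof -
    define W where "W = {v \<in> \<Omega>. \<forall>m\<in>M. m v = v}"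
    have Mz: "m z = z" if "m \<in> M" for m using M(2) that by blast
    have "W = {z} \<or> W = \<Omega>"
    proof (rule A.invariant_subgroup_trivial[OF prim])
      show "z \<in> W" using z Mz by (simp add: W_def)
      show "W \<subseteq> \<Omega>" by (auto simp: W_def)
      show "A.plus x y \<in> W" if xy: "x \<in> W" "y \<in> W" for x y
      proof -
        have c: "x \<in> \<Omega>" "y \<in> \<Omega>" using xy by (auto simp: W_def)
        have "m (A.plus x y) = A.plus x y" if m: "m \<in> M" for m
        proof -
          have "m x = x" "m y = y" using xy m by (simp_all add: W_def)
          then show ?thesis using A.H_plus[OF subsetD[OF M(2) m] c] by simp
        qed
        then show ?thesis using A.plus_closed[OF c] by (simp add: W_def)
      qed
      show "h x \<in> W" if hx: "h \<in> stab z" "x \<in> W" for h x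
      proof -
        have x: "x \<in> \<Omega>" "\<forall>m\<in>M. m x = x" using hx(2) by (auto simp: W_def)
        have hxc: "h x \<in> \<Omega>" by (rule A.H.elem_closed[OF hx(1) x(1)])
        obtain k where k: "k \<in> stab z" "\<forall>x\<in>\<Omega>. k (h x) = x" "\<forall>x\<in>\<Omega>. h (k x) = x" using A.H.obtain_inverse[OF hx(1)] .
        have "m (h x) = h x" if m: "m \<in> M" for m
        proof -
          obtain m' where m': "m' \<in> M" "\<forall>x\<in>\<Omega>. k (m x) = m' (k x)" using M(5) k(1) m by blast
          have "k (m (h x)) = m' (k (h x))" using m'(2) hxc by blast
          also have "\<dots> = x" using k(2) x m'(1) by simp
          finally have "k (m (h x)) = k (h x)" using k(2) x(1) by simp
          then show ?thesis using A.H.elem_inj[OF k(1) M.elem_closed[OF m hxc] hxc] by simp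
        qed
        then show ?thesis using hxc by (simp add: W_def)
      qed
    qed
    moreover have "W \<noteq> \<Omega>"
    proof
      assume W: "W = \<Omega>"
      obtain m where m: "m \<in> M" "m \<noteq> (\<lambda>x\<in>\<Omega>. x)" using M(3) by blast
      have "m = (\<lambda>x\<in>\<Omega>. x)"
      proof (rule M.elem_eqI[OF m(1) M.id_mem])
        fix x assume x: "x \<in> \<Omega>"
        then have "x \<in> W" using W by simp
        then show "m x = (\<lambda>x\<in>\<Omega>. x) x" using m(1) x by (simp add: W_def)
      qed
      then show False using m(2) by simp
    qed
    ultimately have "W = {z}" by blast
    moreover have "v \<in> W" using v by (simp add: W_def)
    ultimately show "v = z" by simp
  qed
  have orbit: "\<exists>m\<in>M. h v = m v" if h: "h \<in> stab z" and v: "v \<in> \<Omega>" "v \<noteq> z" for h v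
  proof -
    let ?\<Delta> = "{h v | h. h \<in> stab z}"
    have \<Delta>: "?\<Delta> \<subseteq> \<Omega>" using elem_closed v by auto
    have v\<Delta>: "v \<in> ?\<Delta>" using A.H.id_mem v(1) by (intro CollectI exI[of _ "\<lambda>x\<in>\<Omega>. x"]) simp
    have blk: "only_trivial_blocks (stab z) ?\<Delta>" by (rule mp[OF bspec[OF bspec[OF suborb z(1)] v(1)] v(2)])
    have "{m v | m. m \<in> M} = {v} \<or> {m v | m. m \<in> M} = ?\<Delta>"
    proof (rule A.H.normal_orbit_cases[OF M(1,2,5) \<Delta> _ blk v\<Delta>])
      show "g y \<in> ?\<Delta>" if "g \<in> stab z" "y \<in> ?\<Delta>" for g y
        by (rule bspec[OF bij_betwE[OF A.H.orbit_bij_betw[OF v(1) that(1)]] that(2)])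
    qed
    moreover have "{m v | m. m \<in> M} \<noteq> {v}"
    proof
      assume e: "{m v | m. m \<in> M} = {v}"
      have "m v = v" if "m \<in> M" for m
      proof -
        have "m v \<in> {m v | m. m \<in> M}" using that by blast
        then show ?thesis unfolding e by simp
      qed
      then show False using fixed[OF v(1)] v(2) by blast
    qed
    ultimately have "{m v | m. m \<in> M} = ?\<Delta>" by blast
    moreover have "h v \<in> ?\<Delta>" using h by blast
    ultimately have "h v \<in> {m v | m. m \<in> M}" by (simp only:)
    then show ?thesis by auto
  qed
  interpret I: irreducible_pair \<Omega> G z N p M u
  proof unfold_locales
    fix W assume W: "W \<subseteq> \<Omega>" "z \<in> W" "W \<noteq> {z}" "\<And>x y. x \<in> W \<Longrightarrow> y \<in> W \<Longrightarrow> A.plus x y \<in> W"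
      "\<And>m x. m \<in> M \<Longrightarrow> x \<in> W \<Longrightarrow> m x \<in> W"
    have "h x \<in> W" if hx: "h \<in> stab z" "x \<in> W" for h x
    proof (cases "x = z")
      case True
      then show ?thesis using hx by simp
    next
      case False
      obtain m where m: "m \<in> M" "h x = m x" using orbit[OF hx(1) _ False] hx(2) W(1) by blast
      then show ?thesis using W(5)[OF m(1) hx(2)] by simp
    qed
    then have "W = {z} \<or> W = \<Omega>" by (intro A.invariant_subgroup_trivial[OF prim W(2,1)] W(4))
    then show "W = \<Omega>" using W(3) by simp
  qed (use u M in auto)
  have orbits: "\<forall>h\<in>stab z. \<forall>v\<in>\<Omega>. v \<noteq> z \<longrightarrow> (\<exists>m\<in>M. h v = m v)"
    by (intro ballI impI) (rule orbit)
  obtain d e t where *: "d \<ge> 1" "card \<Omega> = p ^ d"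
       "subgroup G (perm_group \<Omega> (AGammaL1 I.fld))"
       "semidirect_product (perm_group \<Omega> G) (translation_group I.fld) (stab z)"
       "subgroup (stab z) (perm_group \<Omega> (GammaL1 I.fld))"
       "iso_cyclic_semidirect (perm_group \<Omega> (stab z)) t e"
       "t = card (stab z \<inter> GL1 I.fld)" "primitive_prime_divisor t p d"
       "e = 1 \<or> Factorial_Ring.prime e \<and> e dvd d \<and> t = (p ^ d - 1) div (p ^ (d div e) - 1)"
    using I.affine_structure[OF M(4,7,3) orbits] by blast
  show ?thesis
    by (intro exI[of _ p] exI[of _ d] exI[of _ I.fld] exI[of _ "stab z"] exI[of _ t] exI[of _ e] conjI
        N(4) * I.field_fld I.fld_simps(1))
qed

theorem theorem1p1:
  fixes \<Omega> :: "'a set" and G :: "('a \<Rightarrow> 'a) set"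
  assumes "finite \<Omega>"
    and "subgroup G (BijGroup \<Omega>)"
    and "solvable (perm_group \<Omega> G)"
  shows "extremely_primitive \<Omega> G \<longleftrightarrow>
    (\<exists>(p::nat) (d::nat) (F :: nat ring) G' H (t::nat) (e::nat).
       Factorial_Ring.prime p \<and> d \<ge> 1 \<and> field F \<and> card (carrier F) = p ^ d \<and>
       permutation_isomorphic \<Omega> G (carrier F) G' \<and>
       subgroup G' (perm_group (carrier F) (AGammaL1 F)) \<and>
       semidirect_product (perm_group (carrier F) G') (translation_group F) H \<and>
       subgroup H (perm_group (carrier F) (GammaL1 F)) \<and>
       iso_cyclic_semidirect (perm_group (carrier F) H) t e \<and>
       t = card (H \<inter> GL1 F) \<and>
       primitive_prime_divisor t p d \<and>
       (e = 1 \<or>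
        Factorial_Ring.prime e \<and> e dvd d \<and> t = (p ^ d - 1) div (p ^ (d div e) - 1)))"
    (is "?L \<longleftrightarrow> ?R")
proof
  interpret G: permutation_group \<Omega> G by (rule permutation_group.intro[OF assms(2)])
  show ?R if ep: ?L
  proof -
    \<comment> \<open>The points are numbered first, so that the field constructed on them has type
      \<open>nat ring\<close>.\<close>
    obtain f where f: "bij_betw f \<Omega> {0..<card \<Omega>}" using ex_bij_betw_finite_nat[OF assms(1)] by blast
    obtain G' where G': "permutation_group {0..<card \<Omega>} G'" "permutation_isomorphic \<Omega> G {0..<card \<Omega>} G'"
      "extremely_primitive \<Omega> G \<Longrightarrow> extremely_primitive {0..<card \<Omega>} G'"
      "solvable (perm_group \<Omega> G) \<Longrightarrow> solvable (perm_group {0..<card \<Omega>} G')"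
      using permutation_group_transport[OF G.permutation_group_axioms f] by blast
    obtain p d and F :: "nat ring" and H t e where *: "Factorial_Ring.prime p" "d \<ge> 1" "field F"
       "carrier F = {0..<card \<Omega>}" "card {0..<card \<Omega>} = p ^ d"
       "subgroup G' (perm_group {0..<card \<Omega>} (AGammaL1 F))"
       "semidirect_product (perm_group {0..<card \<Omega>} G') (translation_group F) H"
       "subgroup H (perm_group {0..<card \<Omega>} (GammaL1 F))"
       "iso_cyclic_semidirect (perm_group {0..<card \<Omega>} H) t e"
       "t = card (H \<inter> GL1 F)" "primitive_prime_divisor t p d"
       "e = 1 \<or> Factorial_Ring.prime e \<and> e dvd d \<and> t = (p ^ d - 1) div (p ^ (d div e) - 1)"
      using permutation_group.solvable_extremely_primitive_affine[OF G'(1) _ G'(4)[OF assms(3)] G'(3)[OF ep]]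
      by auto
    show ?R
      by (intro exI[of _ p] exI[of _ d] exI[of _ F] exI[of _ G'] exI[of _ H] exI[of _ t] exI[of _ e] conjI
          *(1-3,10-12) *(5-9)[folded *(4)] G'(2)[folded *(4)])
  qed
  show ?L if R: ?R
  proof -
    obtain p d and F :: "nat ring" and G' H t e where *: "Factorial_Ring.prime p" "d \<ge> 1" "field F"
       "card (carrier F) = p ^ d" "permutation_isomorphic \<Omega> G (carrier F) G'"
       "subgroup G' (perm_group (carrier F) (AGammaL1 F))"
       "semidirect_product (perm_group (carrier F) G') (translation_group F) H"
       "subgroup H (perm_group (carrier F) (GammaL1 F))"
       "iso_cyclic_semidirect (perm_group (carrier F) H) t e"
       "t = card (H \<inter> GL1 F)" "primitive_prime_divisor t p d"
       "e = 1 \<or> Factorial_Ring.prime e \<and> e dvd d \<and> t = (p ^ d - 1) div (p ^ (d div e) - 1)"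
      using R by (elim exE conjE) (rule that)
    interpret F: galois_field F p d
      using *(1,3,4) by (simp add: galois_field_def galois_field_axioms_def)
    have ep: "extremely_primitive (carrier F) G'"
      by (rule F.affine_extremely_primitive[OF *(6-12)])
    interpret A: permutation_group "carrier F" "AGammaL1 F" by (rule F.permutation_group_AGammaL1)
    have "permutation_group (carrier F) G'"
      using *(6) A.subgroup_perm_group_iff by (intro permutation_group.intro) blast
    then show ?L
      by (rule permutation_isomorphic_imp_extremely_primitive[OF G.permutation_group_axioms _ *(5) ep])
  qed
qed

end
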